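(* Let $G/N$ and $H/M$ be TSI groups with a Polish cover. For $\alpha<\omega_1$ write $\mathrm{Ph}^\alpha(G/N)=G_\alpha/N$ and $\mathrm{Ph}^\alpha(H/M)=H_\alpha/M$. Suppose that $(W,U,\varphi):G/N\to H/M$ is a pseudomorphism. For $\alpha<\omega_1$ define $W_\alpha:=W\cap G_\alpha$. Then, for every $\alpha<\omega_1$: 1. $\varphi$ maps $W_\alpha$ to $H_\alpha$; 2. $\varphi|_{W_\alpha}$ is $(G_\alpha,H_\alpha)$-uniformly continuous, i.e. uniformly continuous with respect to the uniformities of the TSI Polish groups $G_\alpha$ and $H_\alpha$ (with their own Polish group topologies).
   Context: **Polish covers and phantom subgroups.** A Polish subgroup of a Polish group $G$ is a subgroup $N$ that is a Polish group in a (necessarily unique) topology making the inclusion $N\to G$ continuous. A group with a Polish cover is $G/N$ with $G$ a Polish group and $N$ a normal Polish subgroup. For $\lambda$ zero or a countable limit ordinal and $n<\omega$ let $\Gamma_{\lambda}=\boldsymbol\Pi^0_{1+\lambda}$ and $\Gamma_{\lambda+n}=\boldsymbol\Pi^0_{1+\lambda+n+1}$ for $n\ge1$. It is known that for each $\alpha<\omega_1$ there is a least Polish subgroup $G_\alpha$ of $G$ with $N\subseteq G_\alpha$ and $G_\alpha\in\Gamma_\alpha(G)$; it is normal in $G$, and $\mathrm{Ph}^\alpha(G/N):=G_\alpha/N$. **TSI.** A Polish group is TSI if it admits a compatible two-sided invariant metric; then its left, right and two-sided uniformities coincide and are called its uniformity. A group with a Polish cover $G/N$ is TSI if there are compatible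 two-sided invariant metrics $d_\infty$ on $N$ and $d_0$ on $G$ such that $d_0\le d_\infty\le1$ on $N$ and the conjugation action of $G$ on $(N,d_\infty)$ is isometric. (If $G/N$ is TSI, then so is $G_\alpha/N$ for every $\alpha<\omega_1$.) For TSI Polish groups $G,H$, a map from a subset of $G$ to $H$ is $(G,H)$-uniformly continuous if it is uniformly continuous for the uniformities induced by $G$ and $H$. **Local uniformly continuous maps.** A local uniformly continuous map $G/N\to H/M$ is a triple $(W,U,\varphi)$ where $W\subseteq G$ is an open symmetric neighborhood of the identity of $G$, $U\subseteq N$ is an open neighborhood of the identity of $N$ (in the Polish topology of $N$), and $\varphi:W\to H$ is $(G,H)$-uniformly continuous, such that, with $W_\infty:=W\cap N$: $\varphi(1)=1$; $\varphi(x^{-1})=\varphi(x)^{-1}$ for $x\in W$; $\varphi(W_\infty)\subseteq M$; $U\subseteq W_\infty$; and $\varphi|_U$ is $(N,M)$-uniformly continuous. **Pseudomorphisms.** A pseudomorphism $G/N\to H/M$ is a local uniformly continuous map $(W,U,\varphi)$ for which there is a function $\sigma:D\to M$, where $D:=\{(z,x)\in N\times W: zx\in W\}$, such that $\varphi(zx)=\sigma(z,x)\varphi(x)$ for all $(z,x)\in D$, and $\sigma$ restricted to $D_U:=\{(z,x)\in D: z\in U\}$ is $(N,M)$-uniformly continuous in the first variable $z$, with modulus of uniform continuity independent of the second variable $x$. *)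

theory Defs
  imports "HOL-Analysis.Analysis" "HOL-Algebra.Coset"
begin

section \<open>Countable ordinals\<close>

text \<open>
  The elements of the type below are the countable ordinals: its order has order type
  $\omega_1$, being isomorphic to the cardinal successor of the order of the natural numbers.
  The lemmas \<open>countable_lessThan_omega1\<close> and \<open>uncountable_UNIV_omega1\<close> confirm this.
\<close>

typedef omega1 = "Field (cardSuc natLeq)"
  using Field_cardSuc_not_empty[OF natLeq_Card_order] by blast

lemma Well_order_cardSuc_natLeq: "Well_order (cardSuc natLeq)"
  using card_order_on_well_order_on[OF cardSuc_Card_order[OF natLeq_Card_order]] .

instantiation omega1 :: linorder
begin

definition less_eq_omega1 :: "omega1 \<Rightarrow> omega1 \<Rightarrow> bool" where
  "\<alpha> \<le> \<beta> \<longleftrightarrow> (Rep_omega1 \<alpha>, Rep_omega1 \<beta>) \<in> cardSuc natLeq"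

definition less_omega1 :: "omega1 \<Rightarrow> omega1 \<Rightarrow> bool" where
  "\<alpha> < \<beta> \<longleftrightarrow> \<alpha> \<le> \<beta> \<and> \<alpha> \<noteq> (\<beta> :: omega1)"

instance
proof -
  have lin: "linear_order_on (Field (cardSuc natLeq)) (cardSuc natLeq)"
    using Well_order_cardSuc_natLeq by (simp add: well_order_on_def)
  then have r: "refl_on (Field (cardSuc natLeq)) (cardSuc natLeq)"
    and t: "trans (cardSuc natLeq)" and a: "antisym (cardSuc natLeq)"
    and tot: "total_on (Field (cardSuc natLeq)) (cardSuc natLeq)"
    by (auto simp: linear_order_on_def partial_order_on_def preorder_on_def)
  have refl: "\<alpha> \<le> \<alpha>" for \<alpha> :: omega1
    unfolding less_eq_omega1_def using r Rep_omega1 by (auto simp: refl_on_def)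
  have anti: "\<alpha> \<le> \<beta> \<Longrightarrow> \<beta> \<le> \<alpha> \<Longrightarrow> \<alpha> = \<beta>" for \<alpha> \<beta> :: omega1
    unfolding less_eq_omega1_def using a by (meson Rep_omega1_inject antisymD)
  show "OFCLASS(omega1, linorder_class)"
  proof
    fix \<alpha> \<beta> \<gamma> :: omega1
    show "\<alpha> \<le> \<alpha>" by (rule refl)
    show "\<alpha> \<le> \<beta> \<Longrightarrow> \<beta> \<le> \<alpha> \<Longrightarrow> \<alpha> = \<beta>" by (rule anti)
    show "(\<alpha> < \<beta>) = (\<alpha> \<le> \<beta> \<and> \<not> \<beta> \<le> \<alpha>)"
      using anti refl unfolding less_omega1_def by blast
    show "\<alpha> \<le> \<beta> \<Longrightarrow> \<beta> \<le> \<gamma> \<Longrightarrow> \<alpha> \<le> \<gamma>"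
      unfolding less_eq_omega1_def using t by (meson transD)
    show "\<alpha> \<le> \<beta> \<or> \<beta> \<le> \<alpha>"
      using tot refl Rep_omega1[of \<alpha>] Rep_omega1[of \<beta>] unfolding less_eq_omega1_def total_on_def
      by (metis Rep_omega1_inject)
  qed
qed

end

instance omega1 :: wellorder
proof
  fix P :: "omega1 \<Rightarrow> bool" and \<alpha>
  assume step: "\<And>\<alpha>. (\<And>\<beta>. \<beta> < \<alpha> \<Longrightarrow> P \<beta>) \<Longrightarrow> P \<alpha>"
  have "wf (cardSuc natLeq - Id)"
    using Well_order_cardSuc_natLeq by (simp add: well_order_on_def)
  then have "wf (inv_image (cardSuc natLeq - Id) Rep_omega1)"
    by (rule wf_inv_image)
  moreover have "inv_image (cardSuc natLeq - Id) Rep_omega1 = {(\<beta>, \<alpha>). \<beta> < \<alpha>}"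
    by (auto simp: inv_image_def less_omega1_def less_eq_omega1_def Rep_omega1_inject)
  ultimately show "P \<alpha>"
    using step by (auto intro: wf_induct_rule[of "{(\<beta>, \<alpha>). \<beta> < \<alpha>}" P])
qed

lemma countable_iff_ordLeq_natLeq:
  includes cardinal_syntax
  shows "countable A \<longleftrightarrow> |A| \<le>o natLeq"
proof -
  have "countable A \<longleftrightarrow> |A| \<le>o |UNIV :: nat set|"
    unfolding countable_def by (simp flip: card_of_ordLeq)
  then show ?thesis
    using ordLeq_ordIso_trans[OF _ card_of_nat, of "|A|"]
      ordLeq_ordIso_trans[OF _ ordIso_symmetric[OF card_of_nat], of "|A|"] by blast
qed

lemma countable_lessThan_omega1: "countable {..<\<alpha> :: omega1}"
proof -
  include cardinal_syntax
  let ?r = "cardSuc natLeq"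
  have "|underS ?r (Rep_omega1 \<alpha>)| <o ?r"
    by (rule card_of_underS[OF cardSuc_Card_order[OF natLeq_Card_order] Rep_omega1])
  then have "countable (underS ?r (Rep_omega1 \<alpha>))"
    by (simp add: countable_iff_ordLeq_natLeq cardSuc_ordLeq_ordLess natLeq_Card_order
        card_of_Card_order)
  moreover have "Rep_omega1 ` {..<\<alpha>} \<subseteq> underS ?r (Rep_omega1 \<alpha>)"
    by (auto simp: underS_def less_omega1_def less_eq_omega1_def Rep_omega1_inject)
  ultimately have "countable (Rep_omega1 ` {..<\<alpha>})"
    by (rule countable_subset[rotated])
  then show ?thesis
    by (rule countable_image_inj_on) (simp add: inj_on_def Rep_omega1_inject)
qed

lemma uncountable_UNIV_omega1: "uncountable (UNIV :: omega1 set)"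
proof
  include cardinal_syntax
  assume "countable (UNIV :: omega1 set)"
  then have "countable (range Rep_omega1)" by (rule countable_image)
  then have "|Field (cardSuc natLeq)| \<le>o natLeq"
    using type_definition.Rep_range[OF type_definition_omega1]
    by (simp add: countable_iff_ordLeq_natLeq)
  then have "cardSuc natLeq \<le>o natLeq"
    using ordIso_ordLeq_trans[OF ordIso_symmetric[OF card_of_Field_ordIso[OF
          cardSuc_Card_order[OF natLeq_Card_order]]]] by blast
  then show False
    using cardSuc_greater[OF natLeq_Card_order] not_ordLess_ordLeq by blast
qed

instantiation omega1 :: zero
begin
definition zero_omega1 :: omega1 where "zero_omega1 = (LEAST \<alpha>. True)"
instance ..
end

definition osucc :: "omega1 \<Rightarrow> omega1" where
  "osucc \<alpha> = (LEAST \<beta>. \<alpha> < \<beta>)"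


section \<open>The Borel hierarchy\<close>

text \<open>
  The index is shifted: \<open>Pi0 X \<alpha>\<close> is the class of $\Pi^0_{1+\alpha}$ subsets of \<open>X\<close>, the
  map $\alpha \mapsto 1 + \alpha$ being the order isomorphism of the ordinals with the ordinals
  $\geq 1$. The second rule takes the complement of the $\Sigma^0_{1+\alpha}$ set
  $\bigcup_n A_n$; it applies only if $\alpha > 0$.
\<close>

inductive Pi0 :: "'a topology \<Rightarrow> omega1 \<Rightarrow> 'a set \<Rightarrow> bool" for X :: "'a topology" where
  closed: "closedin X A \<Longrightarrow> Pi0 X 0 A"
| compl_Union: "(\<And>n :: nat. \<beta> n < \<alpha>) \<Longrightarrow> (\<And>n. Pi0 X (\<beta> n) (A n)) \<Longrightarrow>
    Pi0 X \<alpha> (topspace X - (\<Union>n. A n))"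

text \<open>
  For \<open>\<alpha>\<close> zero or a limit, $\Gamma_\alpha = \Pi^0_{1+\alpha}$. Every other \<open>\<alpha>\<close> is
  $\lambda + n$ with $\lambda$ zero or a limit and $n \geq 1$, that is, a successor, and then
  $\Gamma_\alpha = \Pi^0_{1+\lambda+n+1} = \Pi^0_{1+(\alpha+1)}$.
\<close>

definition Gamma_class :: "'a topology \<Rightarrow> omega1 \<Rightarrow> 'a set \<Rightarrow> bool" where
  "Gamma_class X \<alpha> A \<longleftrightarrow> (if \<exists>\<beta>. \<alpha> = osucc \<beta> then Pi0 X (osucc \<alpha>) A else Pi0 X \<alpha> A)"


section \<open>Polish groups and groups with a Polish cover\<close>

definition topological_group :: "('a, 'm) monoid_scheme \<Rightarrow> 'a topology \<Rightarrow> bool" where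
  "topological_group G T \<longleftrightarrow>
     group G \<and> topspace T = carrier G \<and>
     continuous_map (prod_topology T T) T (\<lambda>(x, y). x \<otimes>\<^bsub>G\<^esub> y) \<and>
     continuous_map T T (\<lambda>x. inv\<^bsub>G\<^esub> x)"

definition polish_group :: "('a, 'm) monoid_scheme \<Rightarrow> 'a topology \<Rightarrow> bool" where
  "polish_group G T \<longleftrightarrow>
     topological_group G T \<and> completely_metrizable_space T \<and> second_countable T"

definition polish_subgroup_topology ::
  "('a, 'm) monoid_scheme \<Rightarrow> 'a topology \<Rightarrow> 'a set \<Rightarrow> 'a topology \<Rightarrow> bool" where
  "polish_subgroup_topology G T N S \<longleftrightarrow>
     polish_group (G\<lparr>carrier := N\<rparr>) S \<and> continuous_map S T (\<lambda>x. x)"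

definition polish_subgroup :: "('a, 'm) monoid_scheme \<Rightarrow> 'a topology \<Rightarrow> 'a set \<Rightarrow> bool" where
  "polish_subgroup G T N \<longleftrightarrow> subgroup N G \<and> (\<exists>S. polish_subgroup_topology G T N S)"

text \<open>The Polish group topology of a Polish subgroup; it is unique.\<close>

definition polish_top :: "('a, 'm) monoid_scheme \<Rightarrow> 'a topology \<Rightarrow> 'a set \<Rightarrow> 'a topology" where
  "polish_top G T N = (THE S. polish_subgroup_topology G T N S)"

definition polish_cover :: "('a, 'm) monoid_scheme \<Rightarrow> 'a topology \<Rightarrow> 'a set \<Rightarrow> bool" where
  "polish_cover G T N \<longleftrightarrow> polish_group G T \<and> N \<lhd> G \<and> polish_subgroup G T N"

text \<open>The group $G_\alpha$, for which $\mathrm{Ph}^\alpha(G/N) = G_\alpha/N$; the order is inclusion.\<close>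

definition phantom_subgroup ::
  "('a, 'm) monoid_scheme \<Rightarrow> 'a topology \<Rightarrow> 'a set \<Rightarrow> omega1 \<Rightarrow> 'a set" where
  "phantom_subgroup G T N \<alpha> =
     (LEAST L. polish_subgroup G T L \<and> N \<subseteq> L \<and> Gamma_class T \<alpha> L)"


section \<open>Two-sided invariant metrics and uniform continuity\<close>

text \<open>
  Here and below a topology \<open>S\<close> whose \<open>topspace\<close> is a subgroup of \<open>G\<close> stands for that
  subgroup with the topology \<open>S\<close>.
\<close>

definition tsi_metric ::
  "('a, 'm) monoid_scheme \<Rightarrow> 'a topology \<Rightarrow> ('a \<Rightarrow> 'a \<Rightarrow> real) \<Rightarrow> bool" where
  "tsi_metric G S d \<longleftrightarrow>
     Metric_space (topspace S) d \<and> Metric_space.mtopology (topspace S) d = S \<and>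
     (\<forall>x\<in>topspace S. \<forall>y\<in>topspace S. \<forall>z\<in>topspace S.
        d (z \<otimes>\<^bsub>G\<^esub> x) (z \<otimes>\<^bsub>G\<^esub> y) = d x y \<and> d (x \<otimes>\<^bsub>G\<^esub> z) (y \<otimes>\<^bsub>G\<^esub> z) = d x y)"

definition tsi_polish_cover :: "('a, 'm) monoid_scheme \<Rightarrow> 'a topology \<Rightarrow> 'a set \<Rightarrow> bool" where
  "tsi_polish_cover G T N \<longleftrightarrow>
     polish_cover G T N \<and>
     (\<exists>d\<^sub>N d\<^sub>0. tsi_metric G (polish_top G T N) d\<^sub>N \<and> tsi_metric G T d\<^sub>0 \<and>
        (\<forall>x\<in>N. \<forall>y\<in>N. d\<^sub>0 x y \<le> d\<^sub>N x y \<and> d\<^sub>N x y \<le> 1) \<and>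
        (\<forall>g\<in>carrier G. \<forall>x\<in>N. \<forall>y\<in>N.
           d\<^sub>N (g \<otimes>\<^bsub>G\<^esub> x \<otimes>\<^bsub>G\<^esub> inv\<^bsub>G\<^esub> g) (g \<otimes>\<^bsub>G\<^esub> y \<otimes>\<^bsub>G\<^esub> inv\<^bsub>G\<^esub> g) = d\<^sub>N x y))"

text \<open>
  Uniform continuity of a map from a subset \<open>A\<close> of \<open>(topspace S, S)\<close> to \<open>(topspace T, T)\<close>,
  for the left uniformities, which for TSI groups are the uniformities of these groups.
\<close>

definition group_uniformly_continuous ::
  "('a, 'm) monoid_scheme \<Rightarrow> 'a topology \<Rightarrow> ('b, 'n) monoid_scheme \<Rightarrow> 'b topology \<Rightarrow>
   'a set \<Rightarrow> ('a \<Rightarrow> 'b) \<Rightarrow> bool" where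
  "group_uniformly_continuous G S H T A f \<longleftrightarrow>
     A \<subseteq> topspace S \<and> f \<in> A \<rightarrow> topspace T \<and>
     (\<forall>V. openin T V \<and> \<one>\<^bsub>H\<^esub> \<in> V \<longrightarrow>
        (\<exists>O'. openin S O' \<and> \<one>\<^bsub>G\<^esub> \<in> O' \<and>
           (\<forall>x\<in>A. \<forall>y\<in>A. inv\<^bsub>G\<^esub> x \<otimes>\<^bsub>G\<^esub> y \<in> O' \<longrightarrow> inv\<^bsub>H\<^esub> (f x) \<otimes>\<^bsub>H\<^esub> f y \<in> V)))"


section \<open>Pseudomorphisms\<close>

text \<open>The map \<open>\<phi>\<close> is a total function of which only the restriction to \<open>W\<close> is relevant.\<close>

definition local_uniformly_continuous_map ::
  "('a, 'm) monoid_scheme \<Rightarrow> 'a topology \<Rightarrow> 'a set \<Rightarrow>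
   ('b, 'n) monoid_scheme \<Rightarrow> 'b topology \<Rightarrow> 'b set \<Rightarrow>
   'a set \<Rightarrow> 'a set \<Rightarrow> ('a \<Rightarrow> 'b) \<Rightarrow> bool" where
  "local_uniformly_continuous_map G TG N H TH M W U \<phi> \<longleftrightarrow>
     openin TG W \<and> \<one>\<^bsub>G\<^esub> \<in> W \<and> (\<forall>x\<in>W. inv\<^bsub>G\<^esub> x \<in> W) \<and>
     openin (polish_top G TG N) U \<and> \<one>\<^bsub>G\<^esub> \<in> U \<and>
     group_uniformly_continuous G TG H TH W \<phi> \<and>
     \<phi> \<one>\<^bsub>G\<^esub> = \<one>\<^bsub>H\<^esub> \<and>
     (\<forall>x\<in>W. \<phi> (inv\<^bsub>G\<^esub> x) = inv\<^bsub>H\<^esub> (\<phi> x)) \<and>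
     \<phi> ` (W \<inter> N) \<subseteq> M \<and>
     U \<subseteq> W \<inter> N \<and>
     group_uniformly_continuous G (polish_top G TG N) H (polish_top H TH M) U \<phi>"

definition pseudomorphism ::
  "('a, 'm) monoid_scheme \<Rightarrow> 'a topology \<Rightarrow> 'a set \<Rightarrow>
   ('b, 'n) monoid_scheme \<Rightarrow> 'b topology \<Rightarrow> 'b set \<Rightarrow>
   'a set \<Rightarrow> 'a set \<Rightarrow> ('a \<Rightarrow> 'b) \<Rightarrow> bool" where
  "pseudomorphism G TG N H TH M W U \<phi> \<longleftrightarrow>
     local_uniformly_continuous_map G TG N H TH M W U \<phi> \<and>
     (let D = {(z, x). z \<in> N \<and> x \<in> W \<and> z \<otimes>\<^bsub>G\<^esub> x \<in> W};
          D\<^sub>U = {(z, x) \<in> D. z \<in> U}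
      in \<exists>\<sigma>. \<sigma> \<in> D \<rightarrow> M \<and>
           (\<forall>(z, x)\<in>D. \<phi> (z \<otimes>\<^bsub>G\<^esub> x) = \<sigma> (z, x) \<otimes>\<^bsub>H\<^esub> \<phi> x) \<and>
           (\<forall>V. openin (polish_top H TH M) V \<and> \<one>\<^bsub>H\<^esub> \<in> V \<longrightarrow>
              (\<exists>O'. openin (polish_top G TG N) O' \<and> \<one>\<^bsub>G\<^esub> \<in> O' \<and>
                 (\<forall>x z z'. (z, x) \<in> D\<^sub>U \<and> (z', x) \<in> D\<^sub>U \<and> inv\<^bsub>G\<^esub> z \<otimes>\<^bsub>G\<^esub> z' \<in> O' \<longrightarrow>
                    inv\<^bsub>H\<^esub> (\<sigma> (z, x)) \<otimes>\<^bsub>H\<^esub> \<sigma> (z', x) \<in> V))))"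

end

theory Submission
  imports Defs "HOL-Library.Option_ord"
begin

text \<open>
  For \<open>V\<^sub>\<delta> = {v \<in> N. lenN v < \<delta>}\<close>, iterated closures of \<open>V\<^sub>\<delta>\<close> give conjugation invariant
  neighborhoods \<open>pball p \<delta>\<close>, and $G_\alpha$ is the set of elements of \<open>G\<close> that can be moved by \<open>N\<close>
  into each of the neighborhoods of index below \<open>Some \<alpha>\<close>. That this set is Polish follows from the
  completeness of \<open>d0\<close>, and its complexity is read off the definition. It is the least one since a
  $\Pi^0_{1+\alpha+1}$ set that contains \<open>N\<close> is comeager in it: genericity of Borel sets is transferred
  between the group topologies by an induction on the Borel rank. With this description,
  the theorem reduces to the fact that a pseudomorphism maps \<open>pball p \<delta>\<close> into \<open>pball p \<epsilon>\<close>, which holds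
  by induction on \<open>p\<close>.
\<close>

section \<open>Baire category\<close>

text \<open>\<open>phantom_subgroup\<close> is given only by a least-element property, which says
  nothing about the action of a map, whereas a pseudomorphism controls single elements and their
  moves by small elements of \<open>N\<close>. Hence the explicit description. Its minimality is the
  hard half. If \<open>L\<close> is a candidate, its complement is a countable union of sets of
  index at most \<alpha>, each disjoint from \<open>N\<close>. One that were generic on an open part
  of G_\<alpha> would have to be generic on an open part of \<open>N\<close>, which is absurd. So
  genericity has to pass from a group topology to a finer one on a smaller group. For arbitrary sets
  this fails: a set can be comeager in \<open>G\<close> and disjoint from \<open>N\<close>. For sets
  of low Borel rank it holds, but only in alternation with a transfer in the other direction. All
  the topologies are Polish, so sets that are generic on overlapping open sets meet, and every
  contradiction has this form. As \<open>polish_top\<close> is a definite description, uniqueness of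
  Polish subgroup topologies enters too; it is obtained by category rather than by measurability of
  inverse maps.\<close>

definition meager_in :: "'a topology \<Rightarrow> 'a set \<Rightarrow> bool" where
  "meager_in X S \<longleftrightarrow>
     (\<exists>\<F>. countable \<F> \<and> (\<forall>F\<in>\<F>. closedin X F \<and> X interior_of F = {}) \<and> S \<subseteq> \<Union>\<F>)"

lemma meager_in_subset: "meager_in X S \<Longrightarrow> T \<subseteq> S \<Longrightarrow> meager_in X T"
  unfolding meager_in_def by (meson subset_trans)

lemma meager_in_closed: "closedin X F \<Longrightarrow> X interior_of F = {} \<Longrightarrow> S \<subseteq> F \<Longrightarrow> meager_in X S"
  unfolding meager_in_def by (intro exI[of _ "{F}"]) auto

lemma meager_in_empty: "meager_in X {}"
  unfolding meager_in_def by (intro exI[of _ "{}"]) auto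

lemma meager_in_UN:
  assumes "countable I" and "\<And>i. i \<in> I \<Longrightarrow> meager_in X (S i)"
  shows "meager_in X (\<Union>i\<in>I. S i)"
proof -
  have "\<forall>i\<in>I. \<exists>\<F>. countable \<F> \<and>
      (\<forall>F\<in>\<F>. closedin X F \<and> X interior_of F = {}) \<and> S i \<subseteq> \<Union>\<F>"
    using assms(2) unfolding meager_in_def by simp
  then obtain \<F> where \<F>: "\<forall>i\<in>I. countable (\<F> i) \<and>
      (\<forall>F\<in>\<F> i. closedin X F \<and> X interior_of F = {}) \<and> S i \<subseteq> \<Union>(\<F> i)"
    by (rule bchoice[THEN exE])
  show ?thesis
    unfolding meager_in_def
  proof (intro exI conjI)
    show "countable (\<Union>i\<in>I. \<F> i)" using assms(1) \<F> by blast
    show "\<forall>F\<in>\<Union>(\<F> ` I). closedin X F \<and> X interior_of F = {}" using \<F> by auto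
    show "(\<Union>i\<in>I. S i) \<subseteq> \<Union>(\<Union>(\<F> ` I))"
    proof
      fix x assume "x \<in> (\<Union>i\<in>I. S i)"
      then obtain i where "i \<in> I" "x \<in> S i" by blast
      then show "x \<in> \<Union>(\<Union>(\<F> ` I))" using bspec[OF \<F>, of i] by blast
    qed
  qed
qed

lemma meager_in_Un: "meager_in X S \<Longrightarrow> meager_in X T \<Longrightarrow> meager_in X (S \<union> T)"
  using meager_in_UN[of "UNIV :: bool set" X "\<lambda>b. if b then S else T"]
  by (simp add: UNIV_bool Un_commute)

lemma meager_in_homeomorphic_image:
  assumes "homeomorphic_map X X f" and "meager_in X S"
  shows "meager_in X (f ` S)"
proof -
  from assms(2) obtain \<F> where \<F>: "countable \<F>"
      "\<And>F. F \<in> \<F> \<Longrightarrow> closedin X F \<and> X interior_of F = {}" "S \<subseteq> \<Union>\<F>"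
    unfolding meager_in_def by blast
  show ?thesis
    unfolding meager_in_def
  proof (intro exI conjI ballI)
    show "countable ((`) f ` \<F>)" using \<F> by blast
    show "f ` S \<subseteq> \<Union>((`) f ` \<F>)" using \<F>(3) by blast
  next
    fix F' assume "F' \<in> (`) f ` \<F>"
    then obtain F where F: "F \<in> \<F>" "F' = f ` F" by blast
    have "F \<subseteq> topspace X" using \<F>(2)[OF F(1)] closedin_subset by blast
    then show "closedin X F'" "X interior_of F' = {}"
      using \<F>(2)[OF F(1)] F(2) assms(1) homeomorphic_map_interior_of[OF assms(1)]
        homeomorphic_map_closedness by (metis, force)
  qed
qed

lemma not_meager_in_open:
  assumes "completely_metrizable_space X" and "openin X O'" and "meager_in X O'"
  shows "O' = {}"
proof -
  from assms(3) obtain \<F> where \<F>: "countable \<F>"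
      "\<And>F. F \<in> \<F> \<Longrightarrow> closedin X F \<and> X interior_of F = {}" "O' \<subseteq> \<Union>\<F>"
    unfolding meager_in_def by blast
  have "X interior_of \<Union>\<F> = {}"
    using assms(1) \<F>(1,2) by (intro Baire_category_alt) auto
  then show ?thesis
    using assms(2) \<F>(3) interior_of_maximal by blast
qed

text \<open>A nonempty open set cannot be the union of the two exceptional sets. The transfer
  arguments below derive their contradictions from this, for disjoint \<open>S\<close> and
  \<open>T\<close>.\<close>

lemma comeager_in_open_meet:
  assumes "completely_metrizable_space X" and "openin X O'" "openin X P"
    and "meager_in X (O' - S)" "meager_in X (P - T)" and "x \<in> O' \<inter> P"
  shows "S \<inter> T \<inter> O' \<inter> P \<noteq> {}"
proof
  assume "S \<inter> T \<inter> O' \<inter> P = {}"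
  then have "O' \<inter> P \<subseteq> (O' - S) \<union> (P - T)" by blast
  then have "meager_in X (O' \<inter> P)"
    using meager_in_Un[OF assms(4,5)] meager_in_subset by blast
  then show False
    using not_meager_in_open[OF assms(1)] assms(2,3,6) by blast
qed

lemma meager_in_open_diff_closure:
  assumes "openin X O'"
  shows "meager_in X (X closure_of O' - O')"
proof (rule meager_in_closed[OF _ _ subset_refl])
  show "closedin X (X closure_of O' - O')" by (simp add: assms closedin_diff)
  show "X interior_of (X closure_of O' - O') = {}"
  proof (rule ccontr)
    assume "X interior_of (X closure_of O' - O') \<noteq> {}"
    then obtain x where x: "x \<in> X interior_of (X closure_of O' - O')" by blast
    then have "x \<in> X closure_of O'" using interior_of_subset by fastforce
    then have "X interior_of (X closure_of O' - O') \<inter> O' \<noteq> {}"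
      using x openin_interior_of unfolding in_closure_of by blast
    then show False using interior_of_subset[of X "X closure_of O' - O'"] by blast
  qed
qed

lemma meager_in_closed_diff_interior:
  assumes "closedin X F"
  shows "meager_in X (F - X interior_of F)"
proof -
  have "openin X (topspace X - F)" using assms by blast
  then have "meager_in X (X closure_of (topspace X - F) - (topspace X - F))"
    by (rule meager_in_open_diff_closure)
  then show ?thesis
    using closedin_subset[OF assms]
    by (rule_tac meager_in_subset) (auto simp: interior_of_closure_of)
qed

text \<open>The family may be uncountable. Each of its members is a union of basic open sets in
  which \<open>S\<close> is meager, and a countable base has only countably many of those.\<close>

lemma meager_in_localize:
  assumes "second_countable X" and "\<And>P. P \<in> \<P> \<Longrightarrow> openin X P \<and> meager_in X (P \<inter> S)"
  shows "meager_in X (\<Union>\<P> \<inter> S)"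
proof -
  obtain \<B> where \<B>: "countable \<B>" "\<And>V. V \<in> \<B> \<Longrightarrow> openin X V"
      "\<And>U x. openin X U \<Longrightarrow> x \<in> U \<Longrightarrow> \<exists>V\<in>\<B>. x \<in> V \<and> V \<subseteq> U"
    using assms(1) unfolding second_countable_def by (metis (no_types, lifting))
  let ?\<C> = "{V \<in> \<B>. meager_in X (V \<inter> S)}"
  have "meager_in X (\<Union>V\<in>?\<C>. V \<inter> S)"
    using \<B>(1) by (intro meager_in_UN) auto
  moreover have "\<Union>\<P> \<inter> S \<subseteq> (\<Union>V\<in>?\<C>. V \<inter> S)"
  proof
    fix x assume "x \<in> \<Union>\<P> \<inter> S"
    then obtain P where P: "P \<in> \<P>" "x \<in> P" "x \<in> S" by blast
    then obtain V where V: "V \<in> \<B>" "x \<in> V" "V \<subseteq> P" using \<B>(3) assms(2) by metis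
    then have "meager_in X (V \<inter> S)"
      using assms(2)[OF P(1)] meager_in_subset by (metis Int_mono subset_refl)
    then show "x \<in> (\<Union>V\<in>?\<C>. V \<inter> S)" using V P by blast
  qed
  ultimately show ?thesis by (rule meager_in_subset)
qed

lemma Pi0_subset: "Pi0 X \<alpha> A \<Longrightarrow> A \<subseteq> topspace X"
  by (induction rule: Pi0.induct) (auto simp: closedin_def)

text \<open>A local form of the Baire property. The Borel class refers to \<open>T\<close> and the
  category to \<open>X\<close>, because one set is examined in many finer group topologies. A closed
  set is comeager in its interior, and the rest of it is meager.\<close>

lemma Pi0_comeager_or_meager:
  assumes "Pi0 T \<alpha> A" and "second_countable X" and "continuous_map X T (\<lambda>x. x)"
    and "openin X O'" and "\<not> meager_in X (O' \<inter> A)"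
  shows "\<exists>P. openin X P \<and> P \<noteq> {} \<and> P \<subseteq> O' \<and> meager_in X (P - A)"
  using assms(1,4,5)
proof (induction arbitrary: O' rule: Pi0.induct)
  case (closed A)
  have A: "closedin X (topspace X \<inter> A)"
  proof -
    have "topspace X \<inter> A = {x \<in> topspace X. x \<in> A}" by blast
    then show ?thesis using closedin_continuous_map_preimage[OF assms(3) closed(1)] by simp
  qed
  let ?C = "topspace X \<inter> A"
  define P where "P = O' \<inter> X interior_of ?C"
  have "openin X P" unfolding P_def using closed.prems by (intro openin_Int) auto
  moreover have "meager_in X (P - A)"
    by (rule meager_in_subset[OF meager_in_empty])
      (use interior_of_subset[of X ?C] in \<open>unfold P_def, blast\<close>)
  moreover have "P \<noteq> {}"
  proof
    assume "P = {}"
    then have "O' \<inter> A \<subseteq> ?C - X interior_of ?C"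
      using openin_subset[OF closed.prems(1)] unfolding P_def by blast
    then show False
      using closed.prems(2) meager_in_subset meager_in_closed_diff_interior[OF A] by blast
  qed
  moreover have "P \<subseteq> O'" unfolding P_def by blast
  ultimately show ?case
    by blast
next
  case (compl_Union \<beta> \<alpha> A)
  define \<P> where "\<P> = {P. openin X P \<and> P \<subseteq> O' \<and> (\<exists>n. meager_in X (P - A n))}"
  have Pmeager: "meager_in X (\<Union>\<P> \<inter> (topspace T - (\<Union>n. A n)))"
  proof (rule meager_in_localize[OF assms(2)])
    fix P assume "P \<in> \<P>"
    then obtain n where "openin X P" "meager_in X (P - A n)" unfolding \<P>_def by blast
    moreover have "P \<inter> (topspace T - (\<Union>n. A n)) \<subseteq> P - A n" by blast
    ultimately show "openin X P \<and> meager_in X (P \<inter> (topspace T - (\<Union>n. A n)))"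
      using meager_in_subset by metis
  qed
  have opP: "openin X (\<Union>\<P>)" by (rule openin_Union) (simp add: \<P>_def)
  \<comment> \<open>Away from the closure of \<Union>\<P>, no \<open>A n\<close> is comeager in a
    nonempty open set, so by induction each is meager there. If nothing of \<open>O'\<close> were
    left, \<open>O'\<close> would meet the complement of the union in a meager set only.\<close>
  define P where "P = O' - X closure_of \<Union>\<P>"
  have P: "openin X P" unfolding P_def using compl_Union.prems(1) by (simp add: openin_diff)
  have "meager_in X (P \<inter> A n)" for n
  proof (rule ccontr)
    assume "\<not> meager_in X (P \<inter> A n)"
    then obtain Q where Q: "openin X Q" "Q \<noteq> {}" "Q \<subseteq> P" "meager_in X (Q - A n)"
      using compl_Union.IH P by blast
    then have "Q \<in> \<P>" unfolding \<P>_def P_def by blast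
    then have "Q \<subseteq> X closure_of \<Union>\<P>"
      using closure_of_subset[OF openin_subset[OF opP]] by blast
    then show False using Q unfolding P_def by blast
  qed
  then have "meager_in X (\<Union>n. P \<inter> A n)" by (intro meager_in_UN) auto
  then have "meager_in X (P - (topspace T - (\<Union>n. A n)))"
  proof (rule meager_in_subset)
    have "topspace X \<subseteq> topspace T" using assms(3) by (auto simp: continuous_map_def)
    then show "P - (topspace T - (\<Union>n. A n)) \<subseteq> (\<Union>n. P \<inter> A n)"
      using openin_subset[OF P] by blast
  qed
  moreover have "P \<noteq> {}"
  proof
    assume "P = {}"
    then have "O' \<inter> (topspace T - (\<Union>n. A n)) \<subseteq>
        (X closure_of \<Union>\<P> - \<Union>\<P>) \<union> (\<Union>\<P> \<inter> (topspace T - (\<Union>n. A n)))"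
      unfolding P_def by blast
    then show False
      using compl_Union.prems(2)
        meager_in_subset[OF meager_in_Un[OF meager_in_open_diff_closure[OF opP] Pmeager]] by metis
  qed
  moreover have "P \<subseteq> O'" unfolding P_def by blast
  ultimately show ?case using P by blast
qed

text \<open>If all \<open>O' \<inter> A n\<close> were meager, their union would be meager. This
  trades the failure of genericity at one rank for genericity of a single set at a lower
  rank.\<close>

lemma not_comeager_compl_UnionE:
  assumes "\<And>n :: nat. Pi0 T (\<beta> n) (A n)" and "second_countable X"
    and "continuous_map X T (\<lambda>x. x)" and "openin X O'"
    and "\<not> meager_in X (O' - (topspace T - (\<Union>n. A n)))"
  obtains n P where "openin X P" "P \<noteq> {}" "P \<subseteq> O'" "meager_in X (P - A n)"
proof -
  have "O' - (topspace T - (\<Union>n. A n)) \<subseteq> (\<Union>n. O' \<inter> A n)"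
    using openin_subset[OF assms(4)] assms(3) by (auto simp: continuous_map_def)
  then have "\<not> meager_in X (\<Union>n. O' \<inter> A n)" using assms(5) meager_in_subset by blast
  then obtain n where "\<not> meager_in X (O' \<inter> A n)"
    using meager_in_UN[of "UNIV :: nat set" X "\<lambda>n. O' \<inter> A n"] by auto
  then show thesis
    using Pi0_comeager_or_meager[OF assms(1-4)] that by blast
qed


section \<open>The classes of the Borel hierarchy\<close>

lemma zero_le_omega1: "0 \<le> (\<alpha> :: omega1)"
  unfolding zero_omega1_def by (rule Least_le) simp

text \<open>A greatest element would make the type countable, since its initial segments
  are.\<close>

lemma less_osucc: "\<alpha> < osucc \<alpha>"
proof -
  have "\<exists>\<beta>. \<alpha> < \<beta>"
  proof (rule ccontr)
    assume "\<nexists>\<beta>. \<alpha> < \<beta>"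
    then have "UNIV = insert \<alpha> {..<\<alpha>}" by (auto simp: not_less_iff_gr_or_eq)
    then show False
      using countable_lessThan_omega1[of \<alpha>] uncountable_UNIV_omega1 by (metis countable_insert)
  qed
  then show ?thesis unfolding osucc_def by (rule LeastI_ex)
qed

lemma less_osucc_iff: "\<beta> < osucc \<alpha> \<longleftrightarrow> \<beta> \<le> \<alpha>"
  using less_osucc[of \<alpha>] not_less_Least[of \<beta> "\<lambda>\<beta>. \<alpha> < \<beta>"] unfolding osucc_def
  by (meson linorder_not_le order_le_less_trans)

lemma osucc_le_iff: "osucc \<alpha> \<le> \<beta> \<longleftrightarrow> \<alpha> < \<beta>"
  by (metis less_osucc_iff linorder_not_le)

lemma Pi0_empty: "Pi0 X 0 {}" by (simp add: Pi0.closed)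

lemma Pi0_zero_iff: "Pi0 X 0 A \<longleftrightarrow> closedin X A"
proof
  assume "Pi0 X 0 A"
  then show "closedin X A"
    by (cases rule: Pi0.cases) (use zero_le_omega1 in \<open>auto simp: not_less[symmetric]\<close>)
qed (rule Pi0.closed)

lemma Pi0_cases:
  assumes "Pi0 X \<alpha> A"
  obtains "\<alpha> = 0" "closedin X A"
  | \<beta> B where "\<And>n :: nat. \<beta> n < \<alpha>" "\<And>n. Pi0 X (\<beta> n) (B n)" "A = topspace X - (\<Union>n. B n)"
  using assms by (cases rule: Pi0.cases) auto

text \<open>The rule \<open>compl_Union\<close> takes a sequence. A finite or empty family is padded
  with empty sets, which are closed and hence of index 0, below \<alpha>.\<close>

lemma Pi0_compl_countable_Union:
  assumes "0 < \<alpha>" and "countable I" and "\<And>i. i \<in> I \<Longrightarrow> \<exists>\<beta><\<alpha>. Pi0 X \<beta> (B i)"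
  shows "Pi0 X \<alpha> (topspace X - (\<Union>i\<in>I. B i))"
proof -
  define B' where "B' n = (if n \<in> to_nat_on I ` I then B (from_nat_into I n) else {})" for n
  have "\<exists>\<beta><\<alpha>. Pi0 X \<beta> (B' n)" for n
    using assms Pi0_empty by (auto simp: B'_def)
  then obtain \<beta> where "\<And>n. \<beta> n < \<alpha>" "\<And>n. Pi0 X (\<beta> n) (B' n)" by metis
  then have "Pi0 X \<alpha> (topspace X - (\<Union>n. B' n))" by (rule Pi0.compl_Union)
  moreover have "(\<Union>n. B' n) = (\<Union>i\<in>I. B i)"
    using assms(2) unfolding B'_def by (fastforce split: if_splits)
  ultimately show ?thesis by simp
qed

text \<open>Raising the index is immediate for the inductive rule. The leap from index 0 uses that
  closed sets of a metrizable space are countable intersections of open sets.\<close>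

lemma Pi0_mono:
  assumes "metrizable_space X" and "Pi0 X \<alpha> A" and "\<alpha> \<le> \<beta>"
  shows "Pi0 X \<beta> A"
  using assms(2)
proof (cases rule: Pi0_cases)
  case 1
  show ?thesis
  proof (cases "\<beta> = 0")
    case True
    then show ?thesis using 1 assms by simp
  next
    case False
    then have "0 < \<beta>" using zero_le_omega1[of \<beta>] by order
    have "fsigma_in X (topspace X - A)"
      using open_imp_fsigma_in[OF assms(1)] 1 by blast
    then obtain C where C: "\<And>n::nat. closedin X (C n)" "(\<Union>n. C n) = topspace X - A"
      unfolding fsigma_in_ascending by metis
    have "Pi0 X \<beta> (topspace X - (\<Union>n. C n))"
      using \<open>0 < \<beta>\<close> C(1) by (intro Pi0.compl_Union[of "\<lambda>n. 0"]) (auto intro: Pi0.closed)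
    moreover have "topspace X - (\<Union>n. C n) = A"
      using C(2) closedin_subset[OF 1(2)] by blast
    ultimately show ?thesis by simp
  qed
next
  case (2 \<gamma> B)
  then show ?thesis using assms(3) by (auto intro!: Pi0.compl_Union[of \<gamma>] intro: order_less_le_trans)
qed

lemma Pi0_Inter:
  assumes "metrizable_space X" and "countable I" "I \<noteq> {}" and "\<And>i. i \<in> I \<Longrightarrow> Pi0 X \<alpha> (A i)"
  shows "Pi0 X \<alpha> (\<Inter>i\<in>I. A i)"
proof (cases "\<alpha> = 0")
  case True
  then show ?thesis using assms by (auto simp: Pi0_zero_iff)
next
  case False
  then have pos: "0 < \<alpha>" using zero_le_omega1[of \<alpha>] by order
  have "\<exists>B. (\<forall>n :: nat. \<exists>\<beta><\<alpha>. Pi0 X \<beta> (B n)) \<and> A i = topspace X - (\<Union>n. B n)"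
    if "i \<in> I" for i
    using assms(4)[OF that] False by (cases rule: Pi0_cases) blast+
  then obtain B where B: "\<And>i n. i \<in> I \<Longrightarrow> \<exists>\<beta><\<alpha>. Pi0 X \<beta> (B i (n :: nat))"
      "\<And>i. i \<in> I \<Longrightarrow> A i = topspace X - (\<Union>n. B i n)" by metis
  have "Pi0 X \<alpha> (topspace X - (\<Union>p\<in>I \<times> UNIV. B (fst p) (snd p)))"
    using assms(2) B(1) by (intro Pi0_compl_countable_Union[OF pos]) auto
  moreover have "topspace X - (\<Union>p\<in>I \<times> UNIV. B (fst p) (snd p)) = (\<Inter>i\<in>I. A i)"
    using B(2) assms(3) by auto
  ultimately show ?thesis by simp
qed

lemma Pi0_Int:
  assumes "metrizable_space X" and "Pi0 X \<alpha> A" "Pi0 X \<alpha> B"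
  shows "Pi0 X \<alpha> (A \<inter> B)"
  using Pi0_Inter[OF assms(1), of "UNIV :: bool set" \<alpha> "\<lambda>b. if b then A else B"] assms(2,3)
  by (simp add: UNIV_bool Int_commute)

lemma Pi0_homeomorphic_image:
  assumes "homeomorphic_map X X f" and "Pi0 X \<alpha> A"
  shows "Pi0 X \<alpha> (f ` A)"
  using assms(2)
proof induction
  case (closed A)
  then show ?case
    using assms(1) closedin_subset homeomorphic_map_closedness by (metis Pi0.closed)
next
  case (compl_Union \<beta> \<alpha> A)
  have "f ` (topspace X - (\<Union>n. A n)) = topspace X - (\<Union>n. f ` A n)"
  proof -
    have inj: "inj_on f (topspace X)" and sur: "f ` topspace X = topspace X"
      using assms(1) homeomorphic_imp_injective_map homeomorphic_imp_surjective_map by blast+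
    have "A n \<subseteq> topspace X" for n using Pi0_subset compl_Union by blast
    then have "f ` (topspace X - (\<Union>n. A n)) = f ` topspace X - f ` (\<Union>n. A n)"
      by (intro inj_on_image_set_diff[OF inj]) auto
    then show ?thesis using sur by (simp add: image_UN)
  qed
  then show ?case using compl_Union by (metis Pi0.compl_Union)
qed

section \<open>Polish groups\<close>

lemma topological_group_left_translation:
  assumes "topological_group G T" and "g \<in> carrier G"
  shows "homeomorphic_map T T (\<lambda>x. g \<otimes>\<^bsub>G\<^esub> x)"
proof -
  interpret group G using assms(1) by (simp add: topological_group_def)
  have top: "topspace T = carrier G"
    and mult: "continuous_map (prod_topology T T) T (\<lambda>(x, y). x \<otimes>\<^bsub>G\<^esub> y)"
    using assms(1) by (simp_all add: topological_group_def)
  have cont: "continuous_map T T (\<lambda>x. h \<otimes>\<^bsub>G\<^esub> x)" if "h \<in> carrier G" for h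
  proof -
    have "continuous_map T (prod_topology T T) (\<lambda>x. (h, x))"
      using that top by (simp add: continuous_map_pairwise o_def)
    from continuous_map_compose[OF this mult] show ?thesis by (simp add: o_def)
  qed
  have "homeomorphic_maps T T (\<lambda>x. g \<otimes>\<^bsub>G\<^esub> x) (\<lambda>x. inv\<^bsub>G\<^esub> g \<otimes>\<^bsub>G\<^esub> x)"
    unfolding homeomorphic_maps_def
    using assms(2) cont top by (auto simp flip: m_assoc)
  then show ?thesis using homeomorphic_map_maps by blast
qed

lemma topological_group_division_nbhd:
  assumes "topological_group G T" and "openin T U" and "\<one>\<^bsub>G\<^esub> \<in> U"
  obtains V where "openin T V" "\<one>\<^bsub>G\<^esub> \<in> V"
    "\<forall>x\<in>V. \<forall>y\<in>V. x \<otimes>\<^bsub>G\<^esub> inv\<^bsub>G\<^esub> y \<in> U"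
proof -
  interpret group G using assms(1) by (simp add: topological_group_def)
  have top: "topspace T = carrier G"
    and mult: "continuous_map (prod_topology T T) T (\<lambda>(x, y). x \<otimes>\<^bsub>G\<^esub> y)"
    and minv: "continuous_map T T (\<lambda>x. inv\<^bsub>G\<^esub> x)"
    using assms(1) by (simp_all add: topological_group_def)
  have "continuous_map (prod_topology T T) (prod_topology T T) (\<lambda>p. (fst p, inv\<^bsub>G\<^esub> (snd p)))"
    using continuous_map_compose[OF continuous_map_snd minv]
    by (simp add: continuous_map_pairwise o_def continuous_map_fst)
  from continuous_map_compose[OF this mult]
  have div: "continuous_map (prod_topology T T) T (\<lambda>p. fst p \<otimes>\<^bsub>G\<^esub> inv\<^bsub>G\<^esub> (snd p))"
    by (simp add: o_def)
  let ?D = "{p \<in> topspace (prod_topology T T). fst p \<otimes>\<^bsub>G\<^esub> inv\<^bsub>G\<^esub> (snd p) \<in> U}"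
  have "openin (prod_topology T T) ?D"
    by (rule openin_continuous_map_preimage[OF div assms(2)])
  moreover have one: "(\<one>\<^bsub>G\<^esub>, \<one>\<^bsub>G\<^esub>) \<in> ?D" using assms(3) top by simp
  ultimately have "\<exists>A B. openin T A \<and> openin T B \<and> \<one>\<^bsub>G\<^esub> \<in> A \<and> \<one>\<^bsub>G\<^esub> \<in> B \<and> A \<times> B \<subseteq> ?D"
    by (simp only: openin_prod_topology_alt)
  then obtain A B where AB: "openin T A" "openin T B" "\<one>\<^bsub>G\<^esub> \<in> A" "\<one>\<^bsub>G\<^esub> \<in> B" "A \<times> B \<subseteq> ?D"
    by (elim exE conjE)
  show thesis
  proof (rule that[of "A \<inter> B"])
    show "openin T (A \<inter> B)" "\<one>\<^bsub>G\<^esub> \<in> A \<inter> B" using AB by auto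
    show "\<forall>x\<in>A \<inter> B. \<forall>y\<in>A \<inter> B. x \<otimes>\<^bsub>G\<^esub> inv\<^bsub>G\<^esub> y \<in> U"
      using AB(5) by auto
  qed
qed

text \<open>All translates of \<open>V\<close> form an open cover, and a second countable space is
  Lindelof.\<close>

lemma topological_group_countable_translates:
  assumes "topological_group G T" and "second_countable T" and "openin T V" and "V \<noteq> {}"
  obtains C where "countable C" "C \<subseteq> carrier G" "carrier G \<subseteq> (\<Union>g\<in>C. (\<lambda>x. g \<otimes>\<^bsub>G\<^esub> x) ` V)"
proof -
  interpret group G using assms(1) by (simp add: topological_group_def)
  have top: "topspace T = carrier G" using assms(1) by (simp add: topological_group_def)
  define \<V> where "\<V> = (\<lambda>g. (\<lambda>x. g \<otimes>\<^bsub>G\<^esub> x) ` V) ` carrier G"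
  have V: "V \<subseteq> carrier G" using openin_subset[OF assms(3)] top by simp
  obtain v where v: "v \<in> V" using assms(4) by blast
  have "openin T ((\<lambda>x. g \<otimes>\<^bsub>G\<^esub> x) ` V)" if "g \<in> carrier G" for g
    using homeomorphic_map_openness[OF topological_group_left_translation[OF assms(1) that]]
      assms(3) V top by blast
  then have "\<And>W. W \<in> \<V> \<Longrightarrow> openin T W" unfolding \<V>_def by blast
  moreover have "\<Union>\<V> = topspace T"
  proof
    show "\<Union>\<V> \<subseteq> topspace T" using V top unfolding \<V>_def by auto
    show "topspace T \<subseteq> \<Union>\<V>"
    proof
      fix x assume "x \<in> topspace T"
      then have x: "x \<in> carrier G" using top by simp
      then have "x = (x \<otimes>\<^bsub>G\<^esub> inv\<^bsub>G\<^esub> v) \<otimes>\<^bsub>G\<^esub> v"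
        using v V by (simp add: m_assoc subsetD)
      then show "x \<in> \<Union>\<V>"
        using x v V unfolding \<V>_def by (intro UnionI[of "(\<lambda>y. (x \<otimes>\<^bsub>G\<^esub> inv\<^bsub>G\<^esub> v) \<otimes>\<^bsub>G\<^esub> y) ` V"]) auto
    qed
  qed
  ultimately have "\<exists>\<W>. countable \<W> \<and> \<W> \<subseteq> \<V> \<and> \<Union>\<W> = topspace T"
    using second_countable_imp_Lindelof_space[OF assms(2)] unfolding Lindelof_space_def by simp
  then obtain \<W> where \<W>: "countable \<W>" "\<W> \<subseteq> \<V>" "\<Union>\<W> = topspace T"
    by (elim exE conjE)
  obtain C where C: "countable C" "C \<subseteq> carrier G" "\<W> = (\<lambda>g. (\<lambda>x. g \<otimes>\<^bsub>G\<^esub> x) ` V) ` C"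
    using countable_subset_image[of \<W> "\<lambda>g. (\<lambda>x. g \<otimes>\<^bsub>G\<^esub> x) ` V" "carrier G"] \<W>(1,2)
    unfolding \<V>_def by auto
  show thesis
    using C(3) \<W>(3) top by (intro that[OF C(1,2)]) auto
qed

section \<open>Uniqueness of the Polish topology of a Polish subgroup\<close>

lemma meager_in_open_diff_dense:
  assumes "openin X A" and "openin X D"
    and dense: "\<And>W. openin X W \<Longrightarrow> W \<noteq> {} \<Longrightarrow> W \<subseteq> A \<Longrightarrow> W \<inter> D \<noteq> {}"
  shows "meager_in X (A - D)"
proof -
  have "meager_in X (X closure_of (A \<inter> D) - A \<inter> D)"
    by (rule meager_in_open_diff_closure) (simp add: assms openin_Int)
  moreover have "A - D \<subseteq> X closure_of (A \<inter> D) - A \<inter> D"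
  proof
    fix x assume x: "x \<in> A - D"
    have "x \<in> X closure_of (A \<inter> D)"
      unfolding in_closure_of
    proof (intro conjI allI impI)
      show "x \<in> topspace X" using x openin_subset[OF assms(1)] by blast
      fix W assume "x \<in> W \<and> openin X W"
      then have "(W \<inter> A) \<inter> D \<noteq> {}"
        using x assms(1) by (intro dense) auto
      then show "\<exists>y. y \<in> A \<inter> D \<and> y \<in> W" by blast
    qed
    then show "x \<in> X closure_of (A \<inter> D) - A \<inter> D" using x by blast
  qed
  ultimately show ?thesis by (rule meager_in_subset)
qed

text \<open>Writing \<open>U\<^sup>*\<close> for the \<open>Q\<close>-interior of the \<open>Q\<close>-closure of a \<open>P\<close>-open set \<open>U\<close>, generic points of
  \<open>U\<^sup>*\<close> lie in \<open>V\<^sup>*\<close> for arbitrarily small \<open>V \<subseteq> U\<close>; completeness of \<open>P\<close> puts them in \<open>U\<close>.\<close>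

lemma meager_in_interior_closure_diff:
  assumes P: "completely_metrizable_space P" "second_countable P"
    and Q: "Hausdorff_space Q" "topspace Q = topspace P"
    and finer: "\<And>V. openin Q V \<Longrightarrow> openin P V"
    and ne: "\<And>V. openin P V \<Longrightarrow> V \<noteq> {} \<Longrightarrow> Q interior_of (Q closure_of V) \<noteq> {}"
    and U: "openin P U"
  shows "meager_in Q (Q interior_of (Q closure_of U) - U)"
proof -
  define st where "st V = Q interior_of (Q closure_of V)" for V
  obtain M m where "Metric_space M m" and mc: "Metric_space.mcomplete M m"
      and Pm: "P = Metric_space.mtopology M m"
    using P(1) unfolding completely_metrizable_space_def by blast
  then interpret m: Metric_space M m by simp
  obtain \<B> where \<B>: "countable \<B>" "\<And>V. V \<in> \<B> \<Longrightarrow> openin P V"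
      "\<And>U x. openin P U \<Longrightarrow> x \<in> U \<Longrightarrow> \<exists>V\<in>\<B>. x \<in> V \<and> V \<subseteq> U"
    using P(2) unfolding second_countable_def by (metis (no_types, lifting))
  have st_open: "openin Q (st V)" for V unfolding st_def by simp
  have st_closure: "st V \<subseteq> Q closure_of V" for V
    unfolding st_def by (rule interior_of_subset)
  \<comment> \<open>The admissible refinements of \<open>V\<close>: basic sets with
    \<open>P\<close>-closure inside \<open>V\<close> and of small radius in the complete metric, so
    that chains of them shrink to a point.\<close>
  define S where "S V n = {V' \<in> \<B>. V' \<noteq> {} \<and> P closure_of V' \<subseteq> V \<and>
      (\<exists>a. P closure_of V' \<subseteq> m.mcball a (1 / Suc n))}" for V n
  \<comment> \<open>The points of \<open>st V\<close> without a next refinement. They form a meager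
    set: a nonempty \<open>Q\<close>-open part of \<open>st V\<close> meets \<open>V\<close>, the
    intersection is \<open>P\<close>-open by \<open>finer\<close>, and so it contains an admissible
    refinement.\<close>
  define E where "E V n = st V - (\<Union>V'\<in>S V n. st V')" for V n
  have E: "meager_in Q (E V n)" if V: "openin P V" for V n
    unfolding E_def
  proof (rule meager_in_open_diff_dense[OF st_open])
    show "openin Q (\<Union>V'\<in>S V n. st V')" using st_open by blast
    fix W assume W: "openin Q W" "W \<noteq> {}" "W \<subseteq> st V"
    then have "W \<inter> V \<noteq> {}"
      using st_closure[of V] openin_Int_closure_of_eq_empty[of Q W V] by blast
    then obtain x where x: "x \<in> W \<inter> V" by blast
    have "openin P (W \<inter> V)" using finer W(1) V by blast
    then obtain r where r: "r > 0" "m.mcball x r \<subseteq> W \<inter> V"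
      using x unfolding Pm m.openin_mtopology_mcball by blast
    define r' where "r' = min r (1 / Suc n)"
    have r': "r' > 0" "r' \<le> r" "r' \<le> 1 / Suc n" using r(1) by (auto simp: r'_def)
    have xM: "x \<in> M" using x openin_subset[OF V] Pm by auto
    have "\<exists>V'\<in>\<B>. x \<in> V' \<and> V' \<subseteq> m.mball x r'"
      using r'(1) xM by (intro \<B>(3)) (auto simp: Pm)
    then obtain V' where V': "V' \<in> \<B>" "x \<in> V'" "V' \<subseteq> m.mball x r'" by blast
    have cl: "P closure_of V' \<subseteq> m.mcball x r'"
      using V'(3) m.mball_subset_mcball unfolding Pm
      by (intro closure_of_minimal) auto
    moreover have "m.mcball x r' \<subseteq> m.mcball x r" "m.mcball x r' \<subseteq> m.mcball x (1 / Suc n)"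
      using r' by auto
    ultimately have "V' \<in> S V n"
      using V' r(2) unfolding S_def by blast
    have "V' \<subseteq> W"
      using cl closure_of_subset[OF openin_subset[OF \<B>(2)[OF V'(1)]]]
        \<open>m.mcball x r' \<subseteq> m.mcball x r\<close> r(2) by blast
    have "st V' \<noteq> {}" unfolding st_def using ne \<B>(2) V' by blast
    then have "st V' \<inter> V' \<noteq> {}"
      using st_closure[of V'] openin_Int_closure_of_eq_empty[OF st_open[of V'], of V'] by blast
    then show "W \<inter> (\<Union>V'\<in>S V n. st V') \<noteq> {}"
      using \<open>V' \<in> S V n\<close> \<open>V' \<subseteq> W\<close> by blast
  qed
  \<comment> \<open>Only \<open>U\<close> and basic sets occur in chains of refinements, so
    countably many exceptional sets suffice.\<close>
  define bad where "bad = (\<Union>p\<in>insert U \<B> \<times> (UNIV :: nat set). E (fst p) (snd p))"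
  have bad: "meager_in Q bad"
    unfolding bad_def using \<B>(1,2) U E by (intro meager_in_UN) auto
  have "st U - bad \<subseteq> U"
  proof
    fix y assume y: "y \<in> st U - bad"
    have step: "\<exists>V'. V' \<in> S V n \<and> y \<in> st V'" if "V \<in> insert U \<B>" "y \<in> st V" for V n
    proof -
      have "(V, n) \<in> insert U \<B> \<times> UNIV" using that(1) by blast
      then have "y \<notin> E (fst (V, n)) (snd (V, n))" using y unfolding bad_def by blast
      then have "y \<notin> E V n" by simp
      then show ?thesis using that(2) unfolding E_def by blast
    qed
    have "\<exists>f. \<forall>n. (f n \<in> insert U \<B> \<and> y \<in> st (f n) \<and> (n = 0 \<longrightarrow> f n = U)) \<and> f (Suc n) \<in> S (f n) n"
    proof (rule dependent_nat_choice)
      show "\<exists>x. x \<in> insert U \<B> \<and> y \<in> st x \<and> (0 = (0::nat) \<longrightarrow> x = U)"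
        using y by blast
    next
      fix V and n :: nat assume V: "V \<in> insert U \<B> \<and> y \<in> st V \<and> (n = 0 \<longrightarrow> V = U)"
      then obtain V' where "V' \<in> S V n" "y \<in> st V'" using step by blast
      then show "\<exists>V'. (V' \<in> insert U \<B> \<and> y \<in> st V' \<and> (Suc n = 0 \<longrightarrow> V' = U)) \<and> V' \<in> S V n"
        unfolding S_def by blast
    qed
    then obtain f where f: "\<And>n. f n \<in> insert U \<B>" "\<And>n. y \<in> st (f n)" "f 0 = U"
        "\<And>n. f (Suc n) \<in> S (f n) n" by metis
    define C where "C n = P closure_of f (Suc n)" for n
    have fop: "openin P (f n)" for n using f(1)[of n] U \<B>(2)[of "f n"] by blast
    have fC: "f (Suc n) \<subseteq> C n" for n
      unfolding C_def by (rule closure_of_subset[OF openin_subset[OF fop]])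
    have Cf: "C n \<subseteq> f n" for n unfolding C_def using f(4)[of n] by (simp add: S_def)
    have "\<exists>l. l \<in> M \<and> \<Inter> (range C) = {l}"
    proof (rule mc[unfolded m.mcomplete_nest_sing, rule_format], intro conjI allI impI)
      show "closedin m.mtopology (C n)" for n unfolding C_def Pm[symmetric] by simp
      show "C n \<noteq> {}" for n using fC[of n] f(4)[of n] by (auto simp: S_def)
      show "decseq C" by (rule decseq_SucI) (use Cf fC in blast)
      fix e :: real assume "e > 0"
      then obtain n where n: "1 / Suc n < e" using nat_approx_posE by blast
      obtain a where "C n \<subseteq> m.mcball a (1 / Suc n)" using f(4)[of n] by (auto simp: S_def C_def)
      also have "\<dots> \<subseteq> m.mcball a e" using n by auto
      finally show "\<exists>n a. C n \<subseteq> m.mcball a e" by blast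
    qed
    then obtain l where l: "l \<in> M" "\<And>n. l \<in> C n" by blast
    \<comment> \<open>\<open>y\<close> is known to lie only in the \<open>Q\<close>-closures of the
      sets \<open>f n\<close>. These sets shrink to \<open>l\<close> in \<open>P\<close>, so they
      end up inside any \<open>Q\<close>-neighborhood of \<open>l\<close>, and Hausdorffness of
      \<open>Q\<close> forces \<open>y\<close> to be \<open>l\<close>.\<close>
    have "l = y"
    proof (rule ccontr)
      assume "l \<noteq> y"
      have lt: "l \<in> topspace Q" using l(1) Q(2) Pm by simp
      have yt: "y \<in> topspace Q" using f(2)[of 0] openin_subset[OF st_open] by blast
      obtain A B where AB: "openin Q A" "openin Q B" "l \<in> A" "y \<in> B" "disjnt A B"
        using Q(1) lt yt \<open>l \<noteq> y\<close> unfolding Hausdorff_space_def by metis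
      obtain r where r: "r > 0" "m.mball l r \<subseteq> A"
        using finer[OF AB(1)] AB(3) unfolding Pm m.openin_mtopology by blast
      obtain n where n: "1 / Suc n < r / 2" using nat_approx_posE[of "r / 2"] r(1) by auto
      obtain a where a: "C n \<subseteq> m.mcball a (1 / Suc n)" using f(4)[of n] by (auto simp: S_def C_def)
      have "C n \<subseteq> m.mball l r"
      proof
        fix c assume c: "c \<in> C n"
        have *: "c \<in> M" "a \<in> M" "m a c \<le> 1 / Suc n" "m a l \<le> 1 / Suc n" "l \<in> M"
          using subsetD[OF a c] subsetD[OF a l(2)[of n]] by auto
        then have "m l c \<le> m a l + m a c" using m.triangle'' by blast
        then show "c \<in> m.mball l r" using n * by simp
      qed
      then have "f (Suc n) \<subseteq> A" using fC r(2) by blast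
      moreover have "y \<in> Q closure_of f (Suc n)" using f(2) st_closure by blast
      ultimately show False
        using AB(2,4,5) unfolding in_closure_of disjnt_def by blast
    qed
    then show "y \<in> U" using l(2)[of 0] Cf[of 0] f(3) by blast
  qed
  then have "st U - U \<subseteq> bad" by blast
  then show ?thesis using bad meager_in_subset unfolding st_def by blast
qed

text \<open>A Pettis argument: a \<open>P\<close>-open \<open>V\<close> is comeager in the
  \<open>Q\<close>-open set \<open>Vs\<close>. For g near \<one> in \<open>Q\<close> the sets
  \<open>Vs\<close> and g \<open>Vs\<close> overlap, so \<open>V\<close> meets g \<open>V\<close>
  and g is a quotient of two elements of \<open>V\<close>. Thus \<open>P\<close>-neighborhoods of
  \<one> are \<open>Q\<close>-neighborhoods.\<close>

lemma polish_group_finer_topology_eq: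
  assumes P: "polish_group G P" and Q: "polish_group G Q"
    and finer: "\<And>V. openin Q V \<Longrightarrow> openin P V"
  shows "P = Q"
proof -
  have tP: "topological_group G P" and tQ: "topological_group G Q"
    and cP: "completely_metrizable_space P" and cQ: "completely_metrizable_space Q"
    and sP: "second_countable P"
    using P Q by (auto simp: polish_group_def)
  interpret group G using tP by (simp add: topological_group_def)
  have topP: "topspace P = carrier G" and topQ: "topspace Q = carrier G"
    using tP tQ by (simp_all add: topological_group_def)
  have haus: "Hausdorff_space Q"
    using cQ completely_metrizable_imp_metrizable_space metrizable_imp_Hausdorff_space by blast
  \<comment> \<open>Otherwise \<open>V\<close> is nowhere dense for \<open>Q\<close>, and countably
    many translates of it cover the group.\<close>
  have ne: "Q interior_of (Q closure_of V) \<noteq> {}" if V: "openin P V" "V \<noteq> {}" for V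
  proof
    assume *: "Q interior_of (Q closure_of V) = {}"
    have VQ: "V \<subseteq> topspace Q" using openin_subset[OF V(1)] topP topQ by simp
    have mV: "meager_in Q V"
      by (rule meager_in_closed[OF closedin_closure_of * closure_of_subset[OF VQ]])
    obtain C where C: "countable C" "C \<subseteq> carrier G" "carrier G \<subseteq> (\<Union>g\<in>C. (\<lambda>x. g \<otimes>\<^bsub>G\<^esub> x) ` V)"
      by (rule topological_group_countable_translates[OF tP sP V])
    have "meager_in Q (\<Union>g\<in>C. (\<lambda>x. g \<otimes>\<^bsub>G\<^esub> x) ` V)"
      using C(1,2) mV topological_group_left_translation[OF tQ]
      by (intro meager_in_UN meager_in_homeomorphic_image) auto
    then have "meager_in Q (topspace Q)" using C(3) unfolding topQ by (rule meager_in_subset)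
    then show False using not_meager_in_open[OF cQ openin_topspace] topQ by auto
  qed
  have nbhd: "\<exists>O'. openin Q O' \<and> \<one>\<^bsub>G\<^esub> \<in> O' \<and> O' \<subseteq> U" if U: "openin P U" "\<one>\<^bsub>G\<^esub> \<in> U" for U
  proof -
    obtain V where V: "openin P V" "\<one>\<^bsub>G\<^esub> \<in> V"
        "\<forall>x\<in>V. \<forall>y\<in>V. x \<otimes>\<^bsub>G\<^esub> inv\<^bsub>G\<^esub> y \<in> U"
      by (rule topological_group_division_nbhd[OF tP U])
    define Vs where "Vs = Q interior_of (Q closure_of V)"
    have op: "openin Q Vs" unfolding Vs_def by simp
    have mg: "meager_in Q (Vs - V)"
      unfolding Vs_def
      by (rule meager_in_interior_closure_diff[OF cP sP haus _ finer ne V(1)]) (simp_all add: topP topQ)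
    obtain a where a: "a \<in> Vs" using ne V unfolding Vs_def by blast
    have Vsc: "Vs \<subseteq> carrier G" using openin_subset[OF op] topQ by simp
    have Vc: "V \<subseteq> carrier G" using openin_subset[OF V(1)] topP by simp
    \<comment> \<open>The elements g for which the fixed point \<open>a\<close> lies in both
      \<open>Vs\<close> and g \<open>Vs\<close>.\<close>
    define O' where "O' = {g \<in> topspace Q. inv\<^bsub>G\<^esub> g \<otimes>\<^bsub>G\<^esub> a \<in> Vs}"
    have "continuous_map Q Q (\<lambda>g. inv\<^bsub>G\<^esub> g \<otimes>\<^bsub>G\<^esub> a)"
    proof -
      have "continuous_map Q (prod_topology Q Q) (\<lambda>g. (inv\<^bsub>G\<^esub> g, a))"
        using tQ a Vsc topQ by (auto simp: continuous_map_pairwise o_def topological_group_def)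
      then show ?thesis
        using continuous_map_compose[of Q "prod_topology Q Q" "\<lambda>g. (inv\<^bsub>G\<^esub> g, a)" Q "\<lambda>(x, y). x \<otimes>\<^bsub>G\<^esub> y"] tQ
        by (simp add: topological_group_def o_def)
    qed
    then have "openin Q O'" unfolding O'_def by (rule openin_continuous_map_preimage[OF _ op])
    moreover have "\<one>\<^bsub>G\<^esub> \<in> O'" unfolding O'_def using a Vsc topQ by auto
    moreover have "O' \<subseteq> U"
    proof
      fix g assume "g \<in> O'"
      then have g: "g \<in> carrier G" "inv\<^bsub>G\<^esub> g \<otimes>\<^bsub>G\<^esub> a \<in> Vs" by (auto simp: O'_def topQ)
      let ?t = "(\<lambda>x. g \<otimes>\<^bsub>G\<^esub> x)"
      have ht: "homeomorphic_map Q Q ?t" by (rule topological_group_left_translation[OF tQ g(1)])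
      have "openin Q (?t ` Vs)" using homeomorphic_map_openness[OF ht] op Vsc topQ by auto
      moreover have "meager_in Q (?t ` Vs - ?t ` V)"
        by (rule meager_in_subset[OF meager_in_homeomorphic_image[OF ht mg]]) (rule image_diff_subset)
      moreover have "a \<in> Vs \<inter> ?t ` Vs"
      proof -
        have "a = ?t (inv\<^bsub>G\<^esub> g \<otimes>\<^bsub>G\<^esub> a)" using g(1) a Vsc by (simp flip: m_assoc add: subsetD)
        then show ?thesis using a g(2) by blast
      qed
      ultimately have "V \<inter> ?t ` V \<inter> Vs \<inter> ?t ` Vs \<noteq> {}"
        by (intro comeager_in_open_meet[OF cQ op _ mg])
      then obtain v v' where v: "v \<in> V" "v' \<in> V" "v = g \<otimes>\<^bsub>G\<^esub> v'" by blast
      then have "g = v \<otimes>\<^bsub>G\<^esub> inv\<^bsub>G\<^esub> v'" using g(1) Vc by (simp add: m_assoc subsetD)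
      then show "g \<in> U" using V(3) v by blast
    qed
    ultimately show ?thesis by blast
  qed
  have "openin Q U" if U: "openin P U" for U
  proof (subst openin_subopen, intro ballI)
    fix x assume x: "x \<in> U"
    have xc: "x \<in> carrier G" using x openin_subset[OF U] topP by blast
    have hP: "homeomorphic_map P P (\<lambda>y. inv\<^bsub>G\<^esub> x \<otimes>\<^bsub>G\<^esub> y)"
      by (rule topological_group_left_translation[OF tP inv_closed[OF xc]])
    have hQ: "homeomorphic_map Q Q (\<lambda>y. x \<otimes>\<^bsub>G\<^esub> y)"
      by (rule topological_group_left_translation[OF tQ xc])
    have Uc: "U \<subseteq> carrier G" using openin_subset[OF U] topP by simp
    have "openin P ((\<lambda>y. inv\<^bsub>G\<^esub> x \<otimes>\<^bsub>G\<^esub> y) ` U)"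
      using homeomorphic_map_openness[OF hP openin_subset[OF U]] U by simp
    moreover have "\<one>\<^bsub>G\<^esub> \<in> (\<lambda>y. inv\<^bsub>G\<^esub> x \<otimes>\<^bsub>G\<^esub> y) ` U"
      using xc by (intro image_eqI[OF _ x]) simp
    ultimately obtain O' where O': "openin Q O'" "\<one>\<^bsub>G\<^esub> \<in> O'" "O' \<subseteq> (\<lambda>y. inv\<^bsub>G\<^esub> x \<otimes>\<^bsub>G\<^esub> y) ` U"
      using nbhd by blast
    show "\<exists>T. openin Q T \<and> x \<in> T \<and> T \<subseteq> U"
    proof (intro exI conjI)
      show "openin Q ((\<lambda>y. x \<otimes>\<^bsub>G\<^esub> y) ` O')"
        using homeomorphic_map_openness[OF hQ openin_subset[OF O'(1)]] O'(1) by simp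
      show "x \<in> (\<lambda>y. x \<otimes>\<^bsub>G\<^esub> y) ` O'"
        using xc by (intro image_eqI[OF _ O'(2)]) simp
      show "(\<lambda>y. x \<otimes>\<^bsub>G\<^esub> y) ` O' \<subseteq> U"
      proof
        fix z assume "z \<in> (\<lambda>y. x \<otimes>\<^bsub>G\<^esub> y) ` O'"
        then obtain u where u: "u \<in> U" "z = x \<otimes>\<^bsub>G\<^esub> (inv\<^bsub>G\<^esub> x \<otimes>\<^bsub>G\<^esub> u)" using O'(3) by blast
        then have "z = u" using xc Uc by (simp flip: m_assoc add: subsetD)
        then show "z \<in> U" using u by simp
      qed
    qed
  qed
  then show ?thesis using finer by (auto simp: topology_eq)
qed

lemma continuous_map_into_diagonal_pullback:
  assumes "continuous_map Z P f" "continuous_map Z Q f" and "topspace P \<subseteq> A"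
  shows "continuous_map Z (pullback_topology A (\<lambda>x. (x, x)) (prod_topology P Q)) f"
proof (rule continuous_map_pullback')
  show "continuous_map Z (prod_topology P Q) ((\<lambda>x. (x, x)) \<circ> f)"
    using assms by (simp add: continuous_map_pairwise o_def)
  show "topspace Z \<subseteq> f -` A"
    using assms(1,3) by (auto simp: continuous_map_def)
qed

text \<open>Both topologies are compared with their join. The join is Polish because it is the
  diagonal in the product of \<open>P\<close> and \<open>Q\<close>, which is closed as the set where
  two continuous maps into the Hausdorff space \<open>T\<close> agree.\<close>

lemma polish_group_topology_unique:
  assumes P: "polish_group G P" and Q: "polish_group G Q"
    and T: "Hausdorff_space T" "continuous_map P T (\<lambda>x. x)" "continuous_map Q T (\<lambda>x. x)"
  shows "P = Q"
proof -
  have tP: "topological_group G P" and tQ: "topological_group G Q"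
    and cP: "completely_metrizable_space P" and cQ: "completely_metrizable_space Q"
    and sP: "second_countable P" and sQ: "second_countable Q"
    using P Q by (auto simp: polish_group_def)
  have topP: "topspace P = carrier G" and topQ: "topspace Q = carrier G"
    using tP tQ by (simp_all add: topological_group_def)
  let ?\<Delta> = "\<lambda>x. (x, x)"
  \<comment> \<open>The coarsest topology that refines both \<open>P\<close> and
    \<open>Q\<close>.\<close>
  define J where "J = pullback_topology (carrier G) ?\<Delta> (prod_topology P Q)"
  have topJ: "topspace J = carrier G"
    unfolding J_def topspace_pullback_topology using topP topQ by auto
  have JPQ: "continuous_map J (prod_topology P Q) ?\<Delta>"
    using continuous_map_pullback[OF continuous_map_id, of "carrier G" ?\<Delta> "prod_topology P Q"]
    by (simp add: J_def o_def)
  have JP: "continuous_map J P (\<lambda>x. x)" and JQ: "continuous_map J Q (\<lambda>x. x)"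
    using JPQ by (simp_all add: continuous_map_pairwise o_def)
  note into_J = continuous_map_into_diagonal_pullback[of _ P _ Q "carrier G", folded J_def]
  have finerP: "openin J V" if "openin P V" for V
  proof -
    have "{x \<in> topspace J. x \<in> V} = V" using openin_subset[OF that] topP topJ by auto
    then show ?thesis using openin_continuous_map_preimage[OF JP that] by simp
  qed
  have finerQ: "openin J V" if "openin Q V" for V
  proof -
    have "{x \<in> topspace J. x \<in> V} = V" using openin_subset[OF that] topQ topJ by auto
    then show ?thesis using openin_continuous_map_preimage[OF JQ that] by simp
  qed
  have multJ: "continuous_map (prod_topology J J) X (\<lambda>(x, y). x \<otimes>\<^bsub>G\<^esub> y)"
    if "topological_group G X" "continuous_map J X (\<lambda>x. x)" for X
  proof -
    have "continuous_map (prod_topology J J) (prod_topology X X) (\<lambda>p. p)"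
      using continuous_map_compose[OF continuous_map_fst that(2), of J]
        continuous_map_compose[OF continuous_map_snd that(2), of J]
      by (simp add: continuous_map_pairwise o_def)
    from continuous_map_compose[OF this, of X "\<lambda>(x, y). x \<otimes>\<^bsub>G\<^esub> y"] show ?thesis
      using that(1) by (simp add: topological_group_def o_def)
  qed
  have invJ: "continuous_map J X (\<lambda>x. inv\<^bsub>G\<^esub> x)"
    if "topological_group G X" "continuous_map J X (\<lambda>x. x)" for X
    using continuous_map_compose[OF that(2), of X "\<lambda>x. inv\<^bsub>G\<^esub> x"] that(1)
    by (simp add: topological_group_def o_def)
  have tJ: "topological_group G J"
    unfolding topological_group_def
    using tP topJ topP into_J[OF multJ[OF tP JP] multJ[OF tQ JQ]]
      into_J[OF invJ[OF tP JP] invJ[OF tQ JQ]]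
    by (simp add: topological_group_def)
  have "completely_metrizable_space J"
  proof -
    let ?D = "{p \<in> topspace (prod_topology P Q). fst p = snd p}"
    have "closedin (prod_topology P Q) ?D"
      using T(1) continuous_map_compose[OF continuous_map_fst T(2), of Q]
        continuous_map_compose[OF continuous_map_snd T(3), of P]
      by (intro closedin_continuous_maps_eq) (simp_all add: o_def)
    then have cD: "completely_metrizable_space (subtopology (prod_topology P Q) ?D)"
      using cP cQ completely_metrizable_space_prod_topology completely_metrizable_space_closedin by blast
    have "homeomorphic_maps J (subtopology (prod_topology P Q) ?D) ?\<Delta> fst"
      unfolding homeomorphic_maps_def
    proof (intro conjI ballI)
      show "continuous_map J (subtopology (prod_topology P Q) ?D) ?\<Delta>"
        using JPQ topJ topP topQ by (auto simp: continuous_map_in_subtopology)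
      have 1: "continuous_map (subtopology (prod_topology P Q) ?D) P fst"
        by (rule continuous_map_from_subtopology[OF continuous_map_fst])
      have "continuous_map (subtopology (prod_topology P Q) ?D) Q snd"
        by (rule continuous_map_from_subtopology[OF continuous_map_snd])
      then have 2: "continuous_map (subtopology (prod_topology P Q) ?D) Q fst"
        by (rule continuous_map_eq) auto
      show "continuous_map (subtopology (prod_topology P Q) ?D) J fst"
        using 1 2 topP by (intro into_J) auto
    qed auto
    then show ?thesis
      using cD homeomorphic_completely_metrizable_space homeomorphic_maps_imp_homeomorphic_space
      by blast
  qed
  moreover have "second_countable J"
  proof -
    obtain A where A: "countable A" "\<And>V. V \<in> A \<Longrightarrow> openin P V"
        "\<And>U x. openin P U \<Longrightarrow> x \<in> U \<Longrightarrow> \<exists>V\<in>A. x \<in> V \<and> V \<subseteq> U"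
      using sP unfolding second_countable_def by (metis (no_types, lifting))
    obtain B where B: "countable B" "\<And>V. V \<in> B \<Longrightarrow> openin Q V"
        "\<And>U x. openin Q U \<Longrightarrow> x \<in> U \<Longrightarrow> \<exists>V\<in>B. x \<in> V \<and> V \<subseteq> U"
      using sQ unfolding second_countable_def by (metis (no_types, lifting))
    show ?thesis
      unfolding second_countable_def
    proof (intro exI conjI allI impI ballI)
      show "countable ((\<lambda>(U, V). U \<inter> V) ` (A \<times> B))" using A(1) B(1) by blast
      show "openin J W" if "W \<in> (\<lambda>(U, V). U \<inter> V) ` (A \<times> B)" for W
        using that A(2) B(2) finerP finerQ by (auto intro: openin_Int)
      fix W x assume "openin J W \<and> x \<in> W"
      then obtain S where S: "openin (prod_topology P Q) S" "W = ?\<Delta> -` S \<inter> carrier G" "(x, x) \<in> S" "x \<in> carrier G"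
        unfolding J_def openin_pullback_topology by auto
      have "\<exists>U V. openin P U \<and> openin Q V \<and> x \<in> U \<and> x \<in> V \<and> U \<times> V \<subseteq> S"
        using S(1,3) by (simp only: openin_prod_topology_alt)
      then obtain U V where UV: "openin P U" "openin Q V" "x \<in> U" "x \<in> V" "U \<times> V \<subseteq> S"
        by (elim exE conjE)
      obtain U' where U': "U' \<in> A" "x \<in> U'" "U' \<subseteq> U" using A(3)[OF UV(1,3)] by blast
      obtain V' where V': "V' \<in> B" "x \<in> V'" "V' \<subseteq> V" using B(3)[OF UV(2,4)] by blast
      have "U' \<inter> V' \<subseteq> W"
      proof
        fix y assume "y \<in> U' \<inter> V'"
        then have "y \<in> U" "y \<in> V" using U'(3) V'(3) by auto
        moreover from this have "(y, y) \<in> S" using subsetD[OF UV(5)] by blast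
        ultimately show "y \<in> W" using S(2) openin_subset[OF UV(1)] topP by auto
      qed
      then show "\<exists>V\<in>(\<lambda>(U, V). U \<inter> V) ` (A \<times> B). x \<in> V \<and> V \<subseteq> W"
        using U' V' by (intro bexI[of _ "U' \<inter> V'"]) auto
    qed
  qed
  ultimately have "polish_group G J" using tJ by (simp add: polish_group_def)
  then show ?thesis
    using polish_group_finer_topology_eq[OF _ P finerP] polish_group_finer_topology_eq[OF _ Q finerQ]
    by metis
qed

section \<open>Invariant metrics on groups\<close>

text \<open>Conceptually, the group is a dense G_delta in its completion, and so is its coset by the
  limit x of a Cauchy sequence; the two meet, so x g = h with g and h in the group. The proof
  carries out this Baire argument with balls in the group itself, and the limit found is h
  g^-1.\<close>

lemma completely_metrizable_biinvariant_mcomplete: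
  assumes "group G" and d: "Metric_space (carrier G) d"
    and cm: "completely_metrizable_space (Metric_space.mtopology (carrier G) d)"
    and left: "\<And>x y z. x \<in> carrier G \<Longrightarrow> y \<in> carrier G \<Longrightarrow> z \<in> carrier G \<Longrightarrow>
      d (z \<otimes>\<^bsub>G\<^esub> x) (z \<otimes>\<^bsub>G\<^esub> y) = d x y"
    and right: "\<And>x y z. x \<in> carrier G \<Longrightarrow> y \<in> carrier G \<Longrightarrow> z \<in> carrier G \<Longrightarrow>
      d (x \<otimes>\<^bsub>G\<^esub> z) (y \<otimes>\<^bsub>G\<^esub> z) = d x y"
  shows "Metric_space.mcomplete (carrier G) d"
proof -
  interpret group G by fact
  interpret d: Metric_space "carrier G" d by fact
  obtain M m where "Metric_space M m" and mc: "Metric_space.mcomplete M m"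
      and top: "d.mtopology = Metric_space.mtopology M m"
    using cm unfolding completely_metrizable_space_def by blast
  then interpret m: Metric_space M m by simp
  have M: "M = carrier G" using arg_cong[OF top, of topspace] by simp
  have small: "\<exists>\<rho>>0. \<rho> \<le> e \<and> d.mcball x \<rho> \<subseteq> d.mcball y r \<and> d.mcball x \<rho> \<subseteq> m.mcball x e"
    if "d y x < r" "x \<in> carrier G" "y \<in> carrier G" "e > 0" for x y r and e :: real
  proof -
    have "openin d.mtopology (d.mball y r \<inter> m.mball x e)"
      by (rule openin_Int[OF d.openin_mball]) (simp add: top)
    moreover have "x \<in> m.mball x e" using that(2,4) M m.centre_in_mball_iff by blast
    then have "x \<in> d.mball y r \<inter> m.mball x e" using that by simp
    ultimately obtain \<rho> where \<rho>: "\<rho> > 0" "d.mcball x \<rho> \<subseteq> d.mball y r \<inter> m.mball x e"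
      unfolding d.openin_mtopology_mcball by blast
    have "d.mcball x (min \<rho> e) \<subseteq> d.mcball x \<rho>" by auto
    then show ?thesis
      using \<rho> that(4) d.mball_subset_mcball[of y r] m.mball_subset_mcball[of x e]
      by (intro exI[of _ "min \<rho> e"]) auto
  qed
  have "\<exists>l. limitin d.mtopology \<sigma> l sequentially" if cau: "d.MCauchy \<sigma>" for \<sigma>
  proof -
    have \<sigma>: "\<sigma> i \<in> carrier G" for i using cau unfolding d.MCauchy_def by blast
    have cauchy: "\<exists>k'\<ge>k. \<forall>i\<ge>k'. \<forall>j\<ge>k'. d (\<sigma> i) (\<sigma> j) < e" if "e > 0" for e k
    proof -
      obtain K where "\<forall>i j. K \<le> i \<longrightarrow> K \<le> j \<longrightarrow> d (\<sigma> i) (\<sigma> j) < e"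
        using cau \<open>e > 0\<close> unfolding d.MCauchy_def by blast
      then show ?thesis by (intro exI[of _ "max k K"]) auto
    qed
    \<comment> \<open>In such a state all late terms of \<sigma> move the center \<open>g\<close>
      into the ball around \<open>h\<close>.\<close>
    define I where "I s \<longleftrightarrow> (case s of (g, h, r, k) \<Rightarrow> g \<in> carrier G \<and> h \<in> carrier G \<and> r > 0 \<and>
        (\<forall>i\<ge>k. d (\<sigma> i \<otimes>\<^bsub>G\<^esub> g) h < r))" for s :: "'a \<times> 'a \<times> real \<times> nat"
    \<comment> \<open>The new balls must also be small for the complete metric \<open>m\<close> of
      the same topology, since completeness of \<open>d\<close> is what is to be shown.\<close>
    define J where "J n s s' \<longleftrightarrow> (case (s, s') of ((g, h, r, k), (g', h', r', k')) \<Rightarrow>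
        r' \<le> 1 / Suc n \<and> d.mcball g' r' \<subseteq> d.mcball g r \<and> d.mcball h' r' \<subseteq> d.mcball h r \<and>
        (\<exists>a. d.mcball g' r' \<subseteq> m.mcball a (1 / Suc n)) \<and>
        (\<exists>a. d.mcball h' r' \<subseteq> m.mcball a (1 / Suc n)))" for n :: nat and s s' :: "'a \<times> 'a \<times> real \<times> nat"
    have step: "\<exists>s'. I s' \<and> J n s s'" if "I s" for s n
    proof -
      obtain g h r k where s: "s = (g, h, r, k)" by (cases s)
      have g: "g \<in> carrier G" and h: "h \<in> carrier G" and r: "r > 0"
        and gh: "\<And>i. i \<ge> k \<Longrightarrow> d (\<sigma> i \<otimes>\<^bsub>G\<^esub> g) h < r"
        using \<open>I s\<close> by (auto simp: I_def s)
      obtain \<rho> where \<rho>: "\<rho> > 0" "d.mcball g \<rho> \<subseteq> d.mcball g r" "d.mcball g \<rho> \<subseteq> m.mcball g (1 / Suc n)"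
        using small[of g g r "1 / Suc n"] g r by auto
      obtain a where a: "a \<ge> k" "\<And>i j. i \<ge> a \<Longrightarrow> j \<ge> a \<Longrightarrow> d (\<sigma> i) (\<sigma> j) < \<rho> / 2"
        using cauchy[of "\<rho> / 2" k] \<rho>(1) by auto
      define h' where "h' = \<sigma> a \<otimes>\<^bsub>G\<^esub> g"
      have h': "h' \<in> carrier G" using \<sigma> g by (simp add: h'_def)
      have "d h h' < r" using gh[OF a(1)] d.commute by (simp add: h'_def)
      then obtain t where t: "t > 0" "t \<le> min (1 / Suc n) (\<rho> / 2)" "d.mcball h' t \<subseteq> d.mcball h r"
          "d.mcball h' t \<subseteq> m.mcball h' (min (1 / Suc n) (\<rho> / 2))"
        using small[of h h' r "min (1 / Suc n) (\<rho> / 2)"] h h' \<rho>(1) by auto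
      obtain b where b: "b \<ge> a" "\<And>i j. i \<ge> b \<Longrightarrow> j \<ge> b \<Longrightarrow> d (\<sigma> i) (\<sigma> j) < t"
        using cauchy[of t a] t(1) by auto
      \<comment> \<open>First \<open>h\<close> is replaced by \<open>h'\<close>, a late translate of
        \<open>g\<close>; then \<open>g\<close> is corrected so that \<open>\<sigma> b\<close> maps
        it to \<open>h'\<close> exactly. By invariance the correction is as small as the distance of
        \<open>\<sigma> a\<close> and \<open>\<sigma> b\<close>.\<close>
      define g' where "g' = inv\<^bsub>G\<^esub> (\<sigma> b) \<otimes>\<^bsub>G\<^esub> h'"
      have g': "g' \<in> carrier G" using \<sigma> h' by (simp add: g'_def)
      have \<sigma>g': "\<sigma> b \<otimes>\<^bsub>G\<^esub> g' = h'" using \<sigma> h' by (simp add: g'_def flip: m_assoc)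
      have "d g g' = d (\<sigma> b \<otimes>\<^bsub>G\<^esub> g) (\<sigma> b \<otimes>\<^bsub>G\<^esub> g')" using left \<sigma> g g' by simp
      also have "\<dots> = d (\<sigma> b) (\<sigma> a)" using right \<sigma> g by (simp add: \<sigma>g' h'_def)
      also have "\<dots> < \<rho> / 2" using a(2) b(1) by simp
      finally have gg': "d g g' < \<rho> / 2" .
      have sub: "d.mcball g' t \<subseteq> d.mcball g \<rho>"
        using gg' t(2) g by (intro d.mcball_subset) (auto simp: d.commute[of g' g])
      have "I (g', h', t, b)"
        unfolding I_def
      proof (simp, intro conjI allI impI)
        show "g' \<in> carrier G" "h' \<in> carrier G" "0 < t" by (fact g' h' t(1))+
        fix i assume "b \<le> i"
        have "d (\<sigma> i \<otimes>\<^bsub>G\<^esub> g') h' = d (\<sigma> i \<otimes>\<^bsub>G\<^esub> g') (\<sigma> b \<otimes>\<^bsub>G\<^esub> g')" by (simp add: \<sigma>g')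
        also have "\<dots> = d (\<sigma> i) (\<sigma> b)" using right \<sigma> g' by simp
        also have "\<dots> < t" using b(2) \<open>b \<le> i\<close> by simp
        finally show "d (\<sigma> i \<otimes>\<^bsub>G\<^esub> g') h' < t" .
      qed
      moreover have "J n s (g', h', t, b)"
        unfolding J_def s
      proof (simp only: prod.case, intro conjI exI)
        show "t \<le> 1 / Suc n" using t(2) by simp
        show "d.mcball g' t \<subseteq> d.mcball g r" "d.mcball g' t \<subseteq> m.mcball g (1 / Suc n)"
          using sub \<rho> by blast+
        show "d.mcball h' t \<subseteq> d.mcball h r" by (fact t(3))
        have "m.mcball h' (min (1 / Suc n) (\<rho> / 2)) \<subseteq> m.mcball h' (1 / Suc n)" by auto
        then show "d.mcball h' t \<subseteq> m.mcball h' (1 / Suc n)" using t(4) by blast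
      qed
      ultimately show ?thesis by blast
    qed
    obtain a where a: "\<And>i j. i \<ge> a \<Longrightarrow> j \<ge> a \<Longrightarrow> d (\<sigma> i) (\<sigma> j) < 1"
      using cauchy[of 1 0] by auto
    have init: "I (\<one>\<^bsub>G\<^esub>, \<sigma> a, 1, a)" using \<sigma> a by (simp add: I_def)
    have "\<exists>f. \<forall>n. I (f n) \<and> J n (f n) (f (Suc n))"
      using init step by (intro dependent_nat_choice) blast+
    then obtain f where f: "\<And>n. I (f n)" "\<And>n. J n (f n) (f (Suc n))" by metis
    define g h r k where "g n = fst (f (Suc n))" and "h n = fst (snd (f (Suc n)))"
      and "r n = fst (snd (snd (f (Suc n))))" and "k n = snd (snd (snd (f (Suc n))))" for n
    have fn: "f (Suc n) = (g n, h n, r n, k n)" for n by (simp add: g_def h_def r_def k_def)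
    have I: "g n \<in> carrier G" "h n \<in> carrier G" "r n > 0"
        "\<And>i. i \<ge> k n \<Longrightarrow> d (\<sigma> i \<otimes>\<^bsub>G\<^esub> g n) (h n) < r n" for n
      using f(1)[of "Suc n"] by (auto simp: fn I_def)
    have J: "r n \<le> 1 / Suc n" "\<exists>a. d.mcball (g n) (r n) \<subseteq> m.mcball a (1 / Suc n)"
        "\<exists>a. d.mcball (h n) (r n) \<subseteq> m.mcball a (1 / Suc n)" for n
      using f(2)[of n] by (cases "f n"; simp only: fn J_def prod.case; elim conjE; assumption)+
    have dec: "d.mcball (g (Suc n)) (r (Suc n)) \<subseteq> d.mcball (g n) (r n)"
        "d.mcball (h (Suc n)) (r (Suc n)) \<subseteq> d.mcball (h n) (r n)" for n
      using f(2)[of "Suc n"] by (simp only: fn J_def prod.case; elim conjE; assumption)+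
    have nest: "\<exists>l\<in>carrier G. \<forall>n. l \<in> d.mcball (c n) (r n)"
      if c: "\<And>n. c n \<in> carrier G" "\<And>n. d.mcball (c (Suc n)) (r (Suc n)) \<subseteq> d.mcball (c n) (r n)"
        "\<And>n. \<exists>a. d.mcball (c n) (r n) \<subseteq> m.mcball a (1 / Suc n)" for c
    proof -
      have "\<exists>l. l \<in> M \<and> \<Inter> (range (\<lambda>n. d.mcball (c n) (r n))) = {l}"
      proof (rule mc[unfolded m.mcomplete_nest_sing, rule_format], intro conjI allI impI)
        show "closedin m.mtopology (d.mcball (c n) (r n))" for n unfolding top[symmetric] by simp
        show "d.mcball (c n) (r n) \<noteq> {}" for n
          using d.centre_in_mcball_iff[of "c n" "r n"] c(1)[of n] I(3)[of n] by force
        show "decseq (\<lambda>n. d.mcball (c n) (r n))" by (rule decseq_SucI) (rule c(2))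
        fix e :: real assume "e > 0"
        then obtain n where n: "1 / Suc n < e" using nat_approx_posE by blast
        obtain a where "d.mcball (c n) (r n) \<subseteq> m.mcball a (1 / Suc n)" using c(3) by blast
        also have "\<dots> \<subseteq> m.mcball a e" using n by auto
        finally show "\<exists>n a. d.mcball (c n) (r n) \<subseteq> m.mcball a e" by blast
      qed
      then show ?thesis using M by blast
    qed
    obtain gl where gl: "gl \<in> carrier G" "\<And>n. gl \<in> d.mcball (g n) (r n)"
      using nest[of g] I(1) dec(1) J(2) by blast
    obtain hl where hl: "hl \<in> carrier G" "\<And>n. hl \<in> d.mcball (h n) (r n)"
      using nest[of h] I(2) dec(2) J(3) by blast
    have "limitin d.mtopology \<sigma> (hl \<otimes>\<^bsub>G\<^esub> inv\<^bsub>G\<^esub> gl) sequentially"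
      unfolding d.limit_metric_sequentially
    proof (intro conjI allI impI)
      show "hl \<otimes>\<^bsub>G\<^esub> inv\<^bsub>G\<^esub> gl \<in> carrier G" using gl hl by simp
      fix e :: real assume "e > 0"
      then obtain n where n: "1 / Suc n < e / 3" using nat_approx_posE[of "e / 3"] by auto
      show "\<exists>N. \<forall>i\<ge>N. \<sigma> i \<in> carrier G \<and> d (\<sigma> i) (hl \<otimes>\<^bsub>G\<^esub> inv\<^bsub>G\<^esub> gl) < e"
      proof (intro exI allI impI conjI)
        fix i assume i: "k n \<le> i"
        show "\<sigma> i \<in> carrier G" by (rule \<sigma>)
        have "d (\<sigma> i) (hl \<otimes>\<^bsub>G\<^esub> inv\<^bsub>G\<^esub> gl)
            = d (\<sigma> i \<otimes>\<^bsub>G\<^esub> gl) ((hl \<otimes>\<^bsub>G\<^esub> inv\<^bsub>G\<^esub> gl) \<otimes>\<^bsub>G\<^esub> gl)"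
          using \<sigma> gl(1) hl(1) by (simp only: right inv_closed m_closed)
        also have "\<dots> = d (\<sigma> i \<otimes>\<^bsub>G\<^esub> gl) hl"
          using gl(1) hl(1) by (simp add: m_assoc)
        also have "\<dots> \<le> d (\<sigma> i \<otimes>\<^bsub>G\<^esub> gl) (\<sigma> i \<otimes>\<^bsub>G\<^esub> g n) + d (\<sigma> i \<otimes>\<^bsub>G\<^esub> g n) hl"
          using \<sigma> gl(1) hl(1) I by (intro d.triangle) auto
        also have "d (\<sigma> i \<otimes>\<^bsub>G\<^esub> g n) hl \<le> d (\<sigma> i \<otimes>\<^bsub>G\<^esub> g n) (h n) + d (h n) hl"
          using \<sigma> gl(1) hl(1) I by (intro d.triangle) auto
        also have "d (\<sigma> i \<otimes>\<^bsub>G\<^esub> gl) (\<sigma> i \<otimes>\<^bsub>G\<^esub> g n) = d (g n) gl"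
          using left \<sigma> gl(1) I(1) d.commute by metis
        also have "d (g n) gl \<le> r n" using gl(2)[of n] by simp
        also have "d (h n) hl \<le> r n" using hl(2)[of n] by simp
        also have "d (\<sigma> i \<otimes>\<^bsub>G\<^esub> g n) (h n) < r n" using I(4) i by simp
        finally show "d (\<sigma> i) (hl \<otimes>\<^bsub>G\<^esub> inv\<^bsub>G\<^esub> gl) < e" using J(1)[of n] n by linarith
      qed
    qed
    then show ?thesis by blast
  qed
  then show ?thesis unfolding d.mcomplete_def by blast
qed

lemma biinvariant_topological_group:
  assumes "group G" and K: "subgroup K G" and d: "Metric_space K d"
    and left: "\<And>x y z. x \<in> K \<Longrightarrow> y \<in> K \<Longrightarrow> z \<in> K \<Longrightarrow> d (z \<otimes>\<^bsub>G\<^esub> x) (z \<otimes>\<^bsub>G\<^esub> y) = d x y"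
    and right: "\<And>x y z. x \<in> K \<Longrightarrow> y \<in> K \<Longrightarrow> z \<in> K \<Longrightarrow> d (x \<otimes>\<^bsub>G\<^esub> z) (y \<otimes>\<^bsub>G\<^esub> z) = d x y"
  shows "topological_group (G\<lparr>carrier := K\<rparr>) (Metric_space.mtopology K d)"
proof -
  interpret group G by fact
  interpret K: subgroup K G by fact
  interpret d: Metric_space K d by fact
  have "continuous_map (prod_topology d.mtopology d.mtopology) d.mtopology (\<lambda>(x, y). x \<otimes>\<^bsub>G\<^esub> y)"
    unfolding d.continuous_map_to_metric
  proof (intro ballI allI impI)
    fix p and e :: real assume p: "p \<in> topspace (prod_topology d.mtopology d.mtopology)" and "e > 0"
    obtain x y where xy: "p = (x, y)" "x \<in> K" "y \<in> K" using p by auto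
    show "\<exists>U. openin (prod_topology d.mtopology d.mtopology) U \<and> p \<in> U \<and>
        (\<forall>q\<in>U. (case q of (x, y) \<Rightarrow> x \<otimes>\<^bsub>G\<^esub> y) \<in> d.mball (case p of (x, y) \<Rightarrow> x \<otimes>\<^bsub>G\<^esub> y) e)"
    proof (intro exI conjI ballI)
      show "openin (prod_topology d.mtopology d.mtopology) (d.mball x (e / 2) \<times> d.mball y (e / 2))"
        by (simp add: openin_prod_Times_iff)
      show "p \<in> d.mball x (e / 2) \<times> d.mball y (e / 2)" using xy \<open>e > 0\<close> by simp
      fix q assume "q \<in> d.mball x (e / 2) \<times> d.mball y (e / 2)"
      then obtain a b where ab: "q = (a, b)" "a \<in> K" "b \<in> K" "d x a < e / 2" "d y b < e / 2"
        by auto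
      have "d (x \<otimes>\<^bsub>G\<^esub> y) (a \<otimes>\<^bsub>G\<^esub> b) \<le> d (x \<otimes>\<^bsub>G\<^esub> y) (a \<otimes>\<^bsub>G\<^esub> y) + d (a \<otimes>\<^bsub>G\<^esub> y) (a \<otimes>\<^bsub>G\<^esub> b)"
        using xy ab by (intro d.triangle) auto
      also have "\<dots> = d x a + d y b" using left right xy ab by simp
      finally show "(case q of (x, y) \<Rightarrow> x \<otimes>\<^bsub>G\<^esub> y) \<in> d.mball (case p of (x, y) \<Rightarrow> x \<otimes>\<^bsub>G\<^esub> y) e"
        using xy ab by simp
    qed
  qed
  moreover have inv: "inv\<^bsub>G\<lparr>carrier := K\<rparr>\<^esub> x = inv\<^bsub>G\<^esub> x" if "x \<in> K" for x
    using m_inv_consistent[OF K that] .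
  moreover have "continuous_map d.mtopology d.mtopology (\<lambda>x. inv\<^bsub>G\<^esub> x)"
    unfolding d.continuous_map_to_metric
  proof (intro ballI allI impI)
    fix x and e :: real assume x: "x \<in> topspace d.mtopology" and "e > 0"
    then have x: "x \<in> K" by simp
    show "\<exists>U. openin d.mtopology U \<and> x \<in> U \<and> (\<forall>y\<in>U. inv\<^bsub>G\<^esub> y \<in> d.mball (inv\<^bsub>G\<^esub> x) e)"
    proof (intro exI[of _ "d.mball x e"] conjI ballI)
      fix y assume "y \<in> d.mball x e"
      then have y: "y \<in> K" "d x y < e" by auto
      have "d (inv\<^bsub>G\<^esub> x) (inv\<^bsub>G\<^esub> y)
          = d ((x \<otimes>\<^bsub>G\<^esub> inv\<^bsub>G\<^esub> x) \<otimes>\<^bsub>G\<^esub> y) ((x \<otimes>\<^bsub>G\<^esub> inv\<^bsub>G\<^esub> y) \<otimes>\<^bsub>G\<^esub> y)"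
        using x y by (simp only: left right K.m_closed K.m_inv_closed)
      also have "\<dots> = d y x" using x y by (simp add: m_assoc)
      finally show "inv\<^bsub>G\<^esub> y \<in> d.mball (inv\<^bsub>G\<^esub> x) e" using x y d.commute by simp
    qed (use x \<open>e > 0\<close> in auto)
  qed
  then have "continuous_map d.mtopology d.mtopology (\<lambda>x. inv\<^bsub>G\<lparr>carrier := K\<rparr>\<^esub> x)"
    by (rule continuous_map_eq) (simp add: inv)
  ultimately show ?thesis
    using subgroup_imp_group[OF K] by (simp add: topological_group_def)
qed

lemma (in Metric_space) second_countable_mtopology_dense:
  assumes "countable Q" "Q \<subseteq> M" and "\<And>x e. x \<in> M \<Longrightarrow> e > 0 \<Longrightarrow> \<exists>q\<in>Q. d q x < e"
  shows "second_countable mtopology"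
  unfolding second_countable_def
proof (intro exI conjI allI impI ballI)
  let ?B = "(\<lambda>(q, n). mball q (1 / real (Suc n))) ` (Q \<times> UNIV)"
  show "countable ?B" using assms(1) by blast
  show "openin mtopology V" if "V \<in> ?B" for V using that by auto
  fix U x assume Ux: "openin mtopology U \<and> x \<in> U"
  then obtain r where r: "r > 0" "mball x r \<subseteq> U" and x: "x \<in> M"
    unfolding openin_mtopology by blast
  obtain n where n: "1 / Suc n < r / 2" using nat_approx_posE[of "r / 2"] r(1) by auto
  obtain q where q: "q \<in> Q" "d q x < 1 / Suc n" using assms(3)[OF x, of "1 / Suc n"] by auto
  have "mball q (1 / Suc n) \<subseteq> mball x r"
    using q n x assms(2) commute[of q x] by (intro mball_subset) auto
  then show "\<exists>V\<in>?B. x \<in> V \<and> V \<subseteq> U"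
    using q r(2) x assms(2) by (intro bexI[of _ "mball q (1 / Suc n)"]) auto
qed

lemma (in group) inv_mult_cancel [simp]: "x \<in> carrier G \<Longrightarrow> y \<in> carrier G \<Longrightarrow> inv x \<otimes> (x \<otimes> y) = y"
  by (simp flip: m_assoc)

lemma (in group) mult_inv_cancel [simp]: "x \<in> carrier G \<Longrightarrow> y \<in> carrier G \<Longrightarrow> x \<otimes> (inv x \<otimes> y) = y"
  by (simp flip: m_assoc)


section \<open>Groups with a Polish cover of TSI type\<close>

lemma None_less_iff: "None < p \<longleftrightarrow> p \<noteq> None"
  by (cases p) auto

lemma None_less_if_Some_le: "Some \<alpha> \<le> j \<Longrightarrow> None < j"
  by (cases j) auto

lemma countable_lessThan_option: "countable {j. j < (p :: omega1 option)}"
proof (rule countable_subset)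
  show "{j. j < p} \<subseteq> insert None (Some ` {..<the p})"
  proof
    fix j assume "j \<in> {j. j < p}"
    then show "j \<in> insert None (Some ` {..<the p})" by (cases j; cases p) auto
  qed
  show "countable (insert None (Some ` {..<the p}))" using countable_lessThan_omega1 by simp
qed

text \<open>The metrics and \<open>TN\<close> are parameters, so that they need not be unfolded from
  an existential and a definite description; \<open>TN\<close> becomes
  \<open>polish_top G T N\<close> on instantiation.\<close>

locale tsi_cover = group G for G :: "('a, 'm) monoid_scheme" (structure) +
  fixes T :: "'a topology" and N :: "'a set" and TN :: "'a topology"
    and dN d0 :: "'a \<Rightarrow> 'a \<Rightarrow> real"
  assumes polish: "polish_group G T"
    and normal: "N \<lhd> G"
    and polishN: "polish_subgroup_topology G T N TN"
    and tsiN: "tsi_metric G TN dN"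
    and tsi0: "tsi_metric G T d0"
    and d0_le_dN: "x \<in> N \<Longrightarrow> y \<in> N \<Longrightarrow> d0 x y \<le> dN x y"
    and dN_le_1: "x \<in> N \<Longrightarrow> y \<in> N \<Longrightarrow> dN x y \<le> 1"
    and dN_conj: "g \<in> carrier G \<Longrightarrow> x \<in> N \<Longrightarrow> y \<in> N \<Longrightarrow>
      dN (g \<otimes> x \<otimes> inv g) (g \<otimes> y \<otimes> inv g) = dN x y"
begin

sublocale N: subgroup N G using normal by (rule normal_imp_subgroup)

lemma topspace_T: "topspace T = carrier G"
  using polish by (simp add: polish_group_def topological_group_def)

lemma topspace_TN: "topspace TN = N"
  using polishN by (simp add: polish_subgroup_topology_def polish_group_def topological_group_def)

sublocale d0: Metric_space "carrier G" d0
  using tsi0 topspace_T by (simp add: tsi_metric_def)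

sublocale dN: Metric_space N dN
  using tsiN topspace_TN by (simp add: tsi_metric_def)

lemma mtopology_d0: "d0.mtopology = T"
  using tsi0 topspace_T by (simp add: tsi_metric_def)

lemma mtopology_dN: "dN.mtopology = TN"
  using tsiN topspace_TN by (simp add: tsi_metric_def)

lemma metrizable_T: "metrizable_space T"
  using d0.metrizable_space_mtopology by (simp add: mtopology_d0)

lemma N_conj: "g \<in> carrier G \<Longrightarrow> x \<in> N \<Longrightarrow> g \<otimes> x \<otimes> inv g \<in> N"
  using normal by (simp add: normal_inv_iff)

lemma d0_left: "\<lbrakk>x \<in> carrier G; y \<in> carrier G; z \<in> carrier G\<rbrakk> \<Longrightarrow> d0 (z \<otimes> x) (z \<otimes> y) = d0 x y"
  and d0_right: "\<lbrakk>x \<in> carrier G; y \<in> carrier G; z \<in> carrier G\<rbrakk> \<Longrightarrow> d0 (x \<otimes> z) (y \<otimes> z) = d0 x y"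
  using tsi0 topspace_T by (simp_all add: tsi_metric_def)

lemma dN_left: "\<lbrakk>x \<in> N; y \<in> N; z \<in> N\<rbrakk> \<Longrightarrow> dN (z \<otimes> x) (z \<otimes> y) = dN x y"
  and dN_right: "\<lbrakk>x \<in> N; y \<in> N; z \<in> N\<rbrakk> \<Longrightarrow> dN (x \<otimes> z) (y \<otimes> z) = dN x y"
  using tsiN topspace_TN by (simp_all add: tsi_metric_def)

lemma mcomplete_d0: "d0.mcomplete"
  using polish d0_left d0_right
  by (intro completely_metrizable_biinvariant_mcomplete)
    (simp_all add: polish_group_def mtopology_d0 group_axioms d0.Metric_space_axioms)

section \<open>Invariant lengths on \<open>G\<close> and \<open>N\<close>\<close>

definition len0 :: "'a \<Rightarrow> real" where "len0 x = d0 x \<one>"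
definition lenN :: "'a \<Rightarrow> real" where "lenN x = dN x \<one>"

lemma d0_eq: "x \<in> carrier G \<Longrightarrow> y \<in> carrier G \<Longrightarrow> d0 x y = len0 (inv x \<otimes> y)"
  using d0_left[of x y "inv x"] d0.commute by (simp add: len0_def)

lemma dN_eq: "x \<in> N \<Longrightarrow> y \<in> N \<Longrightarrow> dN x y = lenN (inv x \<otimes> y)"
  using dN_left[of x y "inv x"] dN.commute by (simp add: lenN_def)

lemma len0_nonneg: "0 \<le> len0 x" by (simp add: len0_def)

lemma len0_eq_0: "x \<in> carrier G \<Longrightarrow> len0 x = 0 \<longleftrightarrow> x = \<one>" by (simp add: len0_def)

lemma len0_mult: "x \<in> carrier G \<Longrightarrow> y \<in> carrier G \<Longrightarrow> len0 (x \<otimes> y) \<le> len0 x + len0 y"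
  using d0.triangle[of "x \<otimes> y" "x \<otimes> \<one>" "\<one>"] d0_left[of y "\<one>" x] by (simp add: len0_def)

lemma len0_inv: "x \<in> carrier G \<Longrightarrow> len0 (inv x) = len0 x"
  using d0_left[of "inv x" "\<one>" x] d0.commute by (simp add: len0_def)

lemma len0_conj: "x \<in> carrier G \<Longrightarrow> g \<in> carrier G \<Longrightarrow> len0 (g \<otimes> x \<otimes> inv g) = len0 x"
  using d0_left[of x "\<one>" g] d0_right[of "g \<otimes> x" g "inv g"] by (simp add: len0_def)

lemma lenN_one: "lenN \<one> = 0" by (simp add: lenN_def)

lemma lenN_le_1: "x \<in> N \<Longrightarrow> lenN x \<le> 1" using dN_le_1 by (simp add: lenN_def)

lemma lenN_mult: "x \<in> N \<Longrightarrow> y \<in> N \<Longrightarrow> lenN (x \<otimes> y) \<le> lenN x + lenN y"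
  using dN.triangle[of "x \<otimes> y" "x \<otimes> \<one>" "\<one>"] dN_left[of y "\<one>" x] by (simp add: lenN_def)

lemma lenN_inv: "x \<in> N \<Longrightarrow> lenN (inv x) = lenN x"
  using dN_left[of "inv x" "\<one>" x] dN.commute by (simp add: lenN_def)

lemma lenN_conj: "x \<in> N \<Longrightarrow> g \<in> carrier G \<Longrightarrow> lenN (g \<otimes> x \<otimes> inv g) = lenN x"
  using dN_conj[of g x "\<one>"] by (simp add: lenN_def)

lemma len0_le_lenN: "x \<in> N \<Longrightarrow> len0 x \<le> lenN x"
  using d0_le_dN by (simp add: len0_def lenN_def)

lemma openin_T: "openin T A \<longleftrightarrow> A \<subseteq> carrier G \<and>
    (\<forall>x\<in>A. \<exists>r>0. \<forall>y\<in>carrier G. len0 (inv x \<otimes> y) < r \<longrightarrow> y \<in> A)"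
  unfolding mtopology_d0[symmetric] d0.openin_mtopology
  by (rule conj_cong[OF refl]) (auto simp: subset_iff d0_eq Ball_def imp_conjL cong: conj_cong)

lemma openin_TN: "openin TN A \<longleftrightarrow> A \<subseteq> N \<and>
    (\<forall>x\<in>A. \<exists>r>0. \<forall>y\<in>N. lenN (inv x \<otimes> y) < r \<longrightarrow> y \<in> A)"
  unfolding mtopology_dN[symmetric] dN.openin_mtopology
  by (rule conj_cong[OF refl]) (auto simp: subset_iff dN_eq Ball_def imp_conjL cong: conj_cong)

text \<open>The index \<open>None\<close> stands for \<open>G\<close> itself, with closed balls of \<open>d0\<close>. For the other indices,
  \<open>pball p \<delta>\<close> is the closure of \<open>{v \<in> N. lenN v < \<delta>}\<close> with respect to all the earlier balls. The
  sets \<open>pball j \<theta>\<close> with \<open>j < Some \<alpha>\<close> induce a neighborhood base of the identity of $G_\alpha$.\<close>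

function (domintros) pball :: "omega1 option \<Rightarrow> real \<Rightarrow> 'a set" where
  "pball p \<delta> = {x \<in> carrier G. (p = None \<longrightarrow> len0 x \<le> \<delta>) \<and>
     (\<forall>j. j < p \<longrightarrow> (\<forall>\<theta>>0. \<exists>v\<in>N. lenN v < \<delta> \<and> inv v \<otimes> x \<in> pball j \<theta>))}"
  by auto
termination
  by (relation "inv_image {(x, y). x < y} fst") (auto intro: wf_inv_image wf)

declare pball.simps [simp del]

lemma pball_None: "x \<in> pball None \<delta> \<longleftrightarrow> x \<in> carrier G \<and> len0 x \<le> \<delta>"
  by (simp add: pball.simps[of None])

lemma pball_iff: "None < p \<Longrightarrow> x \<in> pball p \<delta> \<longleftrightarrow> x \<in> carrier G \<and>
    (\<forall>j<p. \<forall>\<theta>>0. \<exists>v\<in>N. lenN v < \<delta> \<and> inv v \<otimes> x \<in> pball j \<theta>)"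
  by (subst pball.simps) auto

lemma pball_carrier: "x \<in> pball p \<delta> \<Longrightarrow> x \<in> carrier G"
  by (subst (asm) pball.simps) auto

text \<open>Conjugating the approximating element keeps it in \<open>N\<close> with the same length.
  Through \<open>pball_swap\<close> this makes left and right differences interchangeable in
  everything that follows.\<close>

lemma pball_conj:
  "x \<in> pball p \<delta> \<Longrightarrow> g \<in> carrier G \<Longrightarrow> g \<otimes> x \<otimes> inv g \<in> pball p \<delta>"
proof (induction p arbitrary: x \<delta> rule: less_induct)
  case (less p)
  have x: "x \<in> carrier G" using less.prems pball_carrier by blast
  show ?case
  proof (cases "p = None")
    case True
    then show ?thesis using less.prems x by (simp add: pball_None len0_conj)
  next
    case False
    then have p: "None < p" by (simp add: None_less_iff)
    show ?thesis
      unfolding pball_iff[OF p]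
    proof (intro conjI allI impI)
      show "g \<otimes> x \<otimes> inv g \<in> carrier G" using x less.prems by simp
      fix j and \<theta> :: real assume j: "j < p" and "\<theta> > 0"
      then obtain v where v: "v \<in> N" "lenN v < \<delta>" "inv v \<otimes> x \<in> pball j \<theta>"
        using less.prems(1) pball_iff[OF p] by blast
      have "g \<otimes> (inv v \<otimes> x) \<otimes> inv g \<in> pball j \<theta>"
        using less.IH[OF j v(3) less.prems(2)] .
      also have "g \<otimes> (inv v \<otimes> x) \<otimes> inv g = inv (g \<otimes> v \<otimes> inv g) \<otimes> (g \<otimes> x \<otimes> inv g)"
        using v(1) x less.prems(2) by (simp add: m_assoc inv_mult_group)
      finally show "\<exists>v\<in>N. lenN v < \<delta> \<and> inv v \<otimes> (g \<otimes> x \<otimes> inv g) \<in> pball j \<theta>"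
        using v less.prems(2) by (intro bexI[of _ "g \<otimes> v \<otimes> inv g"]) (auto simp: lenN_conj N_conj)
    qed
  qed
qed

lemma pball_swap:
  assumes "x \<otimes> y \<in> pball p \<delta>" and "x \<in> carrier G" "y \<in> carrier G"
  shows "y \<otimes> x \<in> pball p \<delta>"
  using pball_conj[OF assms(1), of "inv x"] assms(2,3) by (simp add: m_assoc)

text \<open>Inversion puts the approximating element on the right; \<open>pball_swap\<close> brings
  it back to the left.\<close>

lemma pball_inv: "x \<in> pball p \<delta> \<Longrightarrow> inv x \<in> pball p \<delta>"
proof (induction p arbitrary: x \<delta> rule: less_induct)
  case (less p)
  have x: "x \<in> carrier G" using less.prems pball_carrier by blast
  show ?case
  proof (cases "p = None")
    case True
    then show ?thesis using less.prems x by (simp add: pball_None len0_inv)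
  next
    case False
    then have p: "None < p" by (simp add: None_less_iff)
    show ?thesis
      unfolding pball_iff[OF p]
    proof (intro conjI allI impI)
      show "inv x \<in> carrier G" using x by simp
      fix j and \<theta> :: real assume j: "j < p" and "\<theta> > 0"
      then obtain v where v: "v \<in> N" "lenN v < \<delta>" "inv v \<otimes> x \<in> pball j \<theta>"
        using less.prems(1) pball_iff[OF p] by blast
      have "inv x \<otimes> v \<in> pball j \<theta>"
        using less.IH[OF j v(3)] v(1) x by (simp add: inv_mult_group)
      then have "inv (inv v) \<otimes> inv x \<in> pball j \<theta>"
        using pball_swap v(1) x by simp
      then show "\<exists>v\<in>N. lenN v < \<delta> \<and> inv v \<otimes> inv x \<in> pball j \<theta>"
        using v by (intro bexI[of _ "inv v"]) (auto simp: lenN_inv)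
    qed
  qed
qed

text \<open>If v approximates x and w approximates y, then v w approximates x y: (v w)^-1 x y is a
  conjugate of v^-1 x times w^-1 y. The radii in \<open>N\<close> add up, and the tolerance is
  halved.\<close>

lemma pball_mult: "x \<in> pball p a \<Longrightarrow> y \<in> pball p b \<Longrightarrow> x \<otimes> y \<in> pball p (a + b)"
proof (induction p arbitrary: x y a b rule: less_induct)
  case (less p)
  have x: "x \<in> carrier G" and y: "y \<in> carrier G" using less.prems pball_carrier by blast+
  show ?case
  proof (cases "p = None")
    case True
    then show ?thesis using less.prems x y len0_mult[OF x y] by (simp add: pball_None)
  next
    case False
    then have p: "None < p" by (simp add: None_less_iff)
    show ?thesis
      unfolding pball_iff[OF p]
    proof (intro conjI allI impI)
      show "x \<otimes> y \<in> carrier G" using x y by simp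
      fix j and \<theta> :: real assume j: "j < p" and "\<theta> > 0"
      then have t: "\<theta> / 2 > 0" by simp
      obtain v where v: "v \<in> N" "lenN v < a" "inv v \<otimes> x \<in> pball j (\<theta> / 2)"
        using less.prems(1) pball_iff[OF p] j t by blast
      obtain w where w: "w \<in> N" "lenN w < b" "inv w \<otimes> y \<in> pball j (\<theta> / 2)"
        using less.prems(2) pball_iff[OF p] j t by blast
      have "inv w \<otimes> (inv v \<otimes> x) \<otimes> inv (inv w) \<in> pball j (\<theta> / 2)"
        using pball_conj[OF v(3), of "inv w"] w(1) by simp
      from less.IH[OF j this w(3)]
      have "(inv w \<otimes> (inv v \<otimes> x) \<otimes> inv (inv w)) \<otimes> (inv w \<otimes> y) \<in> pball j \<theta>" by simp
      also have "(inv w \<otimes> (inv v \<otimes> x) \<otimes> inv (inv w)) \<otimes> (inv w \<otimes> y) = inv (v \<otimes> w) \<otimes> (x \<otimes> y)"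
        using v(1) w(1) x y by (simp add: m_assoc inv_mult_group)
      finally show "\<exists>v\<in>N. lenN v < a + b \<and> inv v \<otimes> (x \<otimes> y) \<in> pball j \<theta>"
        using v w lenN_mult[OF v(1) w(1)] by (intro bexI[of _ "v \<otimes> w"]) auto
    qed
  qed
qed

lemma N_in_pball: "v \<in> N \<Longrightarrow> lenN v < \<delta> \<Longrightarrow> v \<in> pball p \<delta>"
proof (induction p arbitrary: v \<delta> rule: less_induct)
  case (less p)
  show ?case
  proof (cases "p = None")
    case True
    then show ?thesis using less.prems len0_le_lenN[of v] by (simp add: pball_None)
  next
    case False
    then have p: "None < p" by (simp add: None_less_iff)
    have "\<one> \<in> pball j \<theta>" if "j < p" "\<theta> > 0" for j \<theta>
      using less.IH[OF that(1), of "\<one>" \<theta>] that(2) by (simp add: lenN_one)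
    then show ?thesis
      unfolding pball_iff[OF p] using less.prems by (auto intro!: bexI[of _ v])
  qed
qed

lemma one_in_pball: "\<delta> > 0 \<Longrightarrow> \<one> \<in> pball p \<delta>"
  by (rule N_in_pball) (simp_all add: lenN_one)

lemma pball_mono: "x \<in> pball p a \<Longrightarrow> a \<le> b \<Longrightarrow> x \<in> pball p b"
  by (cases "p = None") (simp_all add: pball_None pball_iff None_less_iff, meson order_less_le_trans)

text \<open>Between two indices other than \<open>None\<close> there are merely fewer conditions.
  For \<open>None\<close>, \<open>len0 \<le> lenN\<close> puts the elements of \<open>N\<close> of
  length below \<delta> into the \<open>d0\<close>-ball, and that ball is taken closed so that it
  also contains their limits.\<close>

lemma pball_antimono: "x \<in> pball p \<delta> \<Longrightarrow> i \<le> p \<Longrightarrow> x \<in> pball i \<delta>"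
proof (cases "i = None \<and> p \<noteq> None")
  case True
  assume x: "x \<in> pball p \<delta>"
  have p: "None < p" using True by (simp add: None_less_iff)
  have xc: "x \<in> carrier G" using x pball_carrier by blast
  have "len0 x \<le> \<delta> + \<theta>" if \<theta>: "\<theta> > 0" for \<theta>
  proof -
    obtain v where v: "v \<in> N" "lenN v < \<delta>" "inv v \<otimes> x \<in> pball None \<theta>"
      using x p \<theta> unfolding pball_iff[OF p] by blast
    have "len0 x = len0 (v \<otimes> (inv v \<otimes> x))" using v(1) xc by simp
    also have "\<dots> \<le> len0 v + len0 (inv v \<otimes> x)" using v(1) xc by (intro len0_mult) auto
    also have "\<dots> \<le> \<delta> + \<theta>" using v len0_le_lenN[OF v(1)] by (auto simp: pball_None)
    finally show ?thesis .
  qed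
  then have "len0 x \<le> \<delta>" by (rule field_le_epsilon)
  then show ?thesis using True xc by (simp add: pball_None)
next
  case False
  assume "x \<in> pball p \<delta>" "i \<le> p"
  then show ?thesis
  proof (cases "i = None")
    case False
    then have i: "None < i" by (simp add: None_less_iff)
    then have p: "None < p" using \<open>i \<le> p\<close> by (rule order_less_le_trans)
    have "j < p" if "j < i" for j using that \<open>i \<le> p\<close> by (rule order_less_le_trans)
    then show ?thesis
      using \<open>x \<in> pball p \<delta>\<close> unfolding pball_iff[OF i] pball_iff[OF p] by blast
  qed (use False in simp)
qed

text \<open>Since \<open>lenN \<le> 1\<close>, the radius \<open>2\<close> imposes no restriction. For \<open>p = Some \<alpha>\<close> this is $G_\alpha$.\<close>

definition phantom :: "omega1 option \<Rightarrow> 'a set" where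
  "phantom p = pball p 2"

lemma phantom_iff: "None < p \<Longrightarrow> x \<in> phantom p \<longleftrightarrow> x \<in> carrier G \<and>
    (\<forall>j<p. \<forall>\<theta>>0. \<exists>v\<in>N. inv v \<otimes> x \<in> pball j \<theta>)"
proof -
  have "lenN v < 2" if "v \<in> N" for v using lenN_le_1[OF that] by simp
  then show "None < p \<Longrightarrow> ?thesis" unfolding phantom_def by (auto simp: pball_iff)
qed

lemma phantom_carrier: "x \<in> phantom p \<Longrightarrow> x \<in> carrier G"
  unfolding phantom_def by (rule pball_carrier)

lemma pball_subset_phantom: "None < p \<Longrightarrow> pball p \<delta> \<subseteq> phantom p"
  unfolding subset_iff phantom_iff pball_iff by blast

lemma N_subset_phantom: "N \<subseteq> phantom p"
  unfolding phantom_def using lenN_le_1 by (fastforce intro: N_in_pball)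

lemma phantom_antimono: "i \<le> p \<Longrightarrow> phantom p \<subseteq> phantom i"
  unfolding phantom_def using pball_antimono by blast

lemma phantom_subgroup_G: "None < p \<Longrightarrow> subgroup (phantom p) G"
proof (rule subgroupI)
  assume p: "None < p"
  show "phantom p \<subseteq> carrier G" using phantom_carrier by blast
  show "phantom p \<noteq> {}" using N_subset_phantom N.one_closed by blast
  show "inv x \<in> phantom p" if "x \<in> phantom p" for x
    using that pball_inv unfolding phantom_def by blast
  \<comment> \<open>The product is only known to have radius 4; every radius leads back into
    \<open>phantom p\<close>.\<close>
  show "x \<otimes> y \<in> phantom p" if "x \<in> phantom p" "y \<in> phantom p" for x y
    using that pball_mult pball_subset_phantom[OF p] unfolding phantom_def by blast
qed


text \<open>The topology of \<open>phantom p\<close> is given by the countably many pseudometrics with balls \<open>pball j\<close>,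
  \<open>j < p\<close>; they are truncated at \<open>1\<close> and combined to one invariant metric.\<close>

definition plen :: "omega1 option \<Rightarrow> 'a \<Rightarrow> real" where
  "plen j x = Inf (insert 1 {\<delta>. 0 < \<delta> \<and> x \<in> pball j \<delta>})"

lemma bdd_below_plen: "bdd_below (insert 1 {\<delta>. (0::real) < \<delta> \<and> x \<in> pball j \<delta>})"
  by (rule bdd_belowI[of _ 0]) auto

lemma plen_nonneg: "0 \<le> plen j x"
  unfolding plen_def by (rule cInf_greatest) auto

lemma plen_le_1: "plen j x \<le> 1"
  unfolding plen_def by (rule cInf_lower[OF _ bdd_below_plen]) simp

lemma plen_le: "0 < \<delta> \<Longrightarrow> x \<in> pball j \<delta> \<Longrightarrow> plen j x \<le> \<delta>"
  unfolding plen_def by (rule cInf_lower[OF _ bdd_below_plen]) simp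

lemma plen_less: "plen j x < \<delta> \<Longrightarrow> \<delta> \<le> 1 \<Longrightarrow> x \<in> pball j \<delta>"
proof -
  assume "plen j x < \<delta>" "\<delta> \<le> 1"
  then obtain r where "r \<in> insert 1 {\<delta>. 0 < \<delta> \<and> x \<in> pball j \<delta>}" "r < \<delta>"
    unfolding plen_def by (meson cInf_lessD insert_not_empty)
  then show ?thesis using \<open>\<delta> \<le> 1\<close> pball_mono[of x j r \<delta>] by auto
qed

lemma plen_mult: "plen j (x \<otimes> y) \<le> plen j x + plen j y"
proof (rule field_le_epsilon)
  fix e :: real assume "e > 0"
  show "plen j (x \<otimes> y) \<le> plen j x + plen j y + e"
  proof (cases "plen j x + e / 2 \<le> 1 \<and> plen j y + e / 2 \<le> 1")
    case True
    then have "x \<in> pball j (plen j x + e / 2)" "y \<in> pball j (plen j y + e / 2)"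
      using \<open>e > 0\<close> by (auto intro: plen_less)
    from pball_mult[OF this] have "x \<otimes> y \<in> pball j (plen j x + plen j y + e)"
      by (simp add: algebra_simps)
    then show ?thesis
      using \<open>e > 0\<close> plen_nonneg[of j x] plen_nonneg[of j y] by (intro plen_le) linarith+
  next
    case False
    then show ?thesis
      using \<open>e > 0\<close> plen_nonneg[of j x] plen_nonneg[of j y] plen_le_1[of j "x \<otimes> y"] by linarith
  qed
qed

lemma plen_inv: "x \<in> carrier G \<Longrightarrow> plen j (inv x) = plen j x"
  unfolding plen_def using pball_inv[of x j] pball_inv[of "inv x" j]
  by (intro arg_cong[where f = Inf]) auto

lemma plen_one: "plen j \<one> = 0"
proof (rule antisym[OF field_le_epsilon plen_nonneg])
  fix e :: real assume "e > 0"
  then show "plen j \<one> \<le> 0 + e" using plen_le[OF _ one_in_pball] by simp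
qed

lemma plen_swap: "x \<in> carrier G \<Longrightarrow> y \<in> carrier G \<Longrightarrow> plen j (x \<otimes> y) = plen j (y \<otimes> x)"
  unfolding plen_def using pball_swap[of x y j] pball_swap[of y x j]
  by (intro arg_cong[where f = Inf]) auto

definition level :: "omega1 option \<Rightarrow> nat \<Rightarrow> omega1 option" where
  "level p = from_nat_into {j. j < p}"

lemma level_less: "None < p \<Longrightarrow> level p n < p"
  unfolding level_def using from_nat_into[of "{j. j < p}" n] by blast

lemma level_surj: "j < p \<Longrightarrow> \<exists>n. level p n = j"
  unfolding level_def using from_nat_into_surj[OF countable_lessThan_option, of j p] by auto

text \<open>The weights let only finitely many levels matter above a given bound, and a supremum
  inherits subadditivity and invariance term by term without a convergence question.\<close>

definition elen :: "omega1 option \<Rightarrow> 'a \<Rightarrow> real" where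
  "elen p x = (SUP n. plen (level p n) x / Suc n)"

lemma bdd_above_elen: "bdd_above (range (\<lambda>n. plen (level p n) x / Suc n))"
proof (rule bdd_aboveI2)
  show "plen (level p n) x / Suc n \<le> 1" for n
    using plen_le_1[of "level p n" x] by (simp add: divide_le_eq)
qed

lemma elen_upper: "plen (level p n) x / Suc n \<le> elen p x"
  unfolding elen_def by (rule cSUP_upper[OF _ bdd_above_elen]) simp

lemma elen_nonneg: "0 \<le> elen p x"
  using order_trans[OF _ elen_upper[of p 0 x]] plen_nonneg by simp

lemma elen_mult: "elen p (x \<otimes> y) \<le> elen p x + elen p y"
  unfolding elen_def[of p "x \<otimes> y"]
proof (rule cSUP_least)
  fix n
  have "plen (level p n) (x \<otimes> y) / Suc n \<le> plen (level p n) x / Suc n + plen (level p n) y / Suc n"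
    unfolding add_divide_distrib[symmetric] by (intro divide_right_mono plen_mult) simp
  then show "plen (level p n) (x \<otimes> y) / Suc n \<le> elen p x + elen p y"
    using elen_upper[of p n x] elen_upper[of p n y] by linarith
qed simp

lemma elen_inv: "x \<in> carrier G \<Longrightarrow> elen p (inv x) = elen p x"
  by (simp add: elen_def plen_inv)

lemma elen_swap: "x \<in> carrier G \<Longrightarrow> y \<in> carrier G \<Longrightarrow> elen p (x \<otimes> y) = elen p (y \<otimes> x)"
  by (simp add: elen_def plen_swap)

lemma elen_one: "elen p \<one> = 0"
  by (simp add: elen_def plen_one)

lemma elen_less_imp_pball:
  assumes "j < p" and "\<delta> > 0"
  shows "\<exists>\<epsilon>>0. \<forall>x. elen p x < \<epsilon> \<longrightarrow> x \<in> pball j \<delta>"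
proof -
  obtain n where n: "level p n = j" using level_surj[OF assms(1)] by blast
  show ?thesis
  proof (intro exI conjI allI impI)
    \<comment> \<open>\<open>plen\<close> is truncated at 1 and detects no larger radius; the factor
      undoes the weight of level \<open>n\<close>.\<close>
    show "min 1 \<delta> / Suc n > 0" using assms(2) by simp
    fix x assume "elen p x < min 1 \<delta> / Suc n"
    then have "plen j x / Suc n < min 1 \<delta> / Suc n" using elen_upper[of p n x] n by simp
    then have "plen j x < min 1 \<delta>" by (simp add: divide_less_cancel)
    then have "x \<in> pball j (min 1 \<delta>)" by (rule plen_less) simp
    then show "x \<in> pball j \<delta>" by (rule pball_mono) simp
  qed
qed

text \<open>The levels beyond \<open>k\<close> are small by their weight. The finitely many others
  have a largest index \<open>j\<close> below \<open>p\<close>, and the ball of index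
  \<open>j\<close> lies in all of theirs.\<close>

lemma pball_imp_elen_less:
  assumes "None < p" and "\<epsilon> > 0"
  shows "\<exists>j<p. \<exists>\<delta>>0. \<forall>x\<in>pball j \<delta>. elen p x < \<epsilon>"
proof -
  obtain k where k: "1 / Suc k < \<epsilon> / 2" using nat_approx_posE[of "\<epsilon> / 2"] assms(2) by auto
  define j where "j = Max (level p ` {..k})"
  have j: "j < p" unfolding j_def using level_less[OF assms(1)] by (subst Max_less_iff) auto
  have le: "level p n \<le> j" if "n \<le> k" for n unfolding j_def using that by (intro Max_ge) auto
  have "elen p x \<le> \<epsilon> / 2" if x: "x \<in> pball j (\<epsilon> / 2)" for x
    unfolding elen_def
  proof (rule cSUP_least)
    fix n
    show "plen (level p n) x / Suc n \<le> \<epsilon> / 2"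
    proof (cases "n \<le> k")
      case True
      have "plen (level p n) x \<le> \<epsilon> / 2"
        using pball_antimono[OF x le[OF True]] assms(2) by (intro plen_le) auto
      moreover have "plen (level p n) x / Suc n \<le> plen (level p n) x / 1"
        using plen_nonneg by (intro divide_left_mono) auto
      ultimately show ?thesis by linarith
    next
      case False
      have "plen (level p n) x / Suc n \<le> 1 / Suc n" by (intro divide_right_mono plen_le_1) simp
      also have "\<dots> \<le> 1 / Suc k" using False by (intro divide_left_mono) auto
      finally show ?thesis using k by linarith
    qed
  qed simp
  then have "\<forall>x\<in>pball j (\<epsilon> / 2). elen p x < \<epsilon>" using assms(2) by fastforce
  then show ?thesis using j assms(2) by (intro exI[of _ j] conjI exI[of _ "\<epsilon> / 2"]) auto
qed

lemma elen_eq_0: "None < p \<Longrightarrow> x \<in> carrier G \<Longrightarrow> elen p x = 0 \<Longrightarrow> x = \<one>"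
proof -
  assume p: "None < p" and x: "x \<in> carrier G" "elen p x = 0"
  have "len0 x \<le> 0 + e" if e: "e > 0" for e
    using elen_less_imp_pball[OF p e] x by (auto simp: pball_None)
  then have "len0 x \<le> 0" by (rule field_le_epsilon)
  then show ?thesis using len0_nonneg[of x] len0_eq_0[OF x(1)] by simp
qed

text \<open>The value 0 off the carrier is there because \<open>Metric_space\<close> asks for
  nonnegativity and symmetry at all arguments.\<close>

definition pdist :: "omega1 option \<Rightarrow> 'a \<Rightarrow> 'a \<Rightarrow> real" where
  "pdist p x y = (if x \<in> carrier G \<and> y \<in> carrier G then elen p (inv x \<otimes> y) else 0)"

definition ptop :: "omega1 option \<Rightarrow> 'a topology" where
  "ptop p = Metric_space.mtopology (phantom p) (pdist p)"

lemma pdist_eq: "x \<in> phantom p \<Longrightarrow> y \<in> phantom p \<Longrightarrow> pdist p x y = elen p (inv x \<otimes> y)"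
  by (auto simp: pdist_def dest: phantom_carrier)

lemma Metric_space_phantom:
  assumes p: "None < p"
  shows "Metric_space (phantom p) (pdist p)"
proof
  show "0 \<le> pdist p x y" for x y by (simp add: pdist_def elen_nonneg)
  show "pdist p x y = pdist p y x" for x y
    using elen_inv[of "inv x \<otimes> y" p] by (auto simp: pdist_def inv_mult_group)
  show "pdist p x y = 0 \<longleftrightarrow> x = y" if "x \<in> phantom p" "y \<in> phantom p" for x y
  proof -
    have xy: "x \<in> carrier G" "y \<in> carrier G" using that phantom_carrier by blast+
    show ?thesis
    proof
      assume "pdist p x y = 0"
      then have "inv x \<otimes> y = \<one>" using elen_eq_0[OF p, of "inv x \<otimes> y"] xy by (simp add: pdist_def)
      then show "x = y" using xy by (metis inv_inv inv_closed inv_equality)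
    qed (use xy in \<open>simp add: pdist_def elen_one\<close>)
  qed
  show "pdist p x z \<le> pdist p x y + pdist p y z"
    if "x \<in> phantom p" "y \<in> phantom p" "z \<in> phantom p" for x y z
  proof -
    have xy: "x \<in> carrier G" "y \<in> carrier G" "z \<in> carrier G" using that phantom_carrier by blast+
    have "inv x \<otimes> z = (inv x \<otimes> y) \<otimes> (inv y \<otimes> z)" using xy by (simp add: m_assoc)
    then show ?thesis using elen_mult[of p "inv x \<otimes> y" "inv y \<otimes> z"] xy by (simp add: pdist_def)
  qed
qed

lemma topspace_ptop: "None < p \<Longrightarrow> topspace (ptop p) = phantom p"
  unfolding ptop_def using Metric_space.topspace_mtopology[OF Metric_space_phantom] .

lemma openin_ptop:
  assumes p: "None < p"
  shows "openin (ptop p) A \<longleftrightarrow> A \<subseteq> phantom p \<and>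
    (\<forall>x\<in>A. \<exists>j<p. \<exists>\<delta>>0. \<forall>y\<in>phantom p. inv x \<otimes> y \<in> pball j \<delta> \<longrightarrow> y \<in> A)"
proof -
  interpret m: Metric_space "phantom p" "pdist p" by (rule Metric_space_phantom[OF p])
  have "(\<exists>r>0. m.mball x r \<subseteq> A) \<longleftrightarrow>
      (\<exists>j<p. \<exists>\<delta>>0. \<forall>y\<in>phantom p. inv x \<otimes> y \<in> pball j \<delta> \<longrightarrow> y \<in> A)" if x: "x \<in> phantom p" for x
  proof
    assume "\<exists>r>0. m.mball x r \<subseteq> A"
    then obtain r where r: "r > 0" "m.mball x r \<subseteq> A" by blast
    obtain j \<delta> where j: "j < p" "\<delta> > 0" "\<forall>x\<in>pball j \<delta>. elen p x < r"
      using pball_imp_elen_less[OF p r(1)] by blast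
    have "y \<in> A" if "y \<in> phantom p" "inv x \<otimes> y \<in> pball j \<delta>" for y
      using j(3) that x r(2) by (auto simp: pdist_eq subset_iff)
    then show "\<exists>j<p. \<exists>\<delta>>0. \<forall>y\<in>phantom p. inv x \<otimes> y \<in> pball j \<delta> \<longrightarrow> y \<in> A" using j by blast
  next
    assume "\<exists>j<p. \<exists>\<delta>>0. \<forall>y\<in>phantom p. inv x \<otimes> y \<in> pball j \<delta> \<longrightarrow> y \<in> A"
    then obtain j \<delta> where j: "j < p" "\<delta> > 0" "\<forall>y\<in>phantom p. inv x \<otimes> y \<in> pball j \<delta> \<longrightarrow> y \<in> A"
      by blast
    obtain r where r: "r > 0" "\<forall>x. elen p x < r \<longrightarrow> x \<in> pball j \<delta>"
      using elen_less_imp_pball[OF j(1,2)] by blast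
    have "m.mball x r \<subseteq> A" using j(3) r(2) x by (auto simp: pdist_eq)
    then show "\<exists>r>0. m.mball x r \<subseteq> A" using r(1) by blast
  qed
  then show ?thesis unfolding ptop_def m.openin_mtopology by blast
qed

section \<open>Separability and completeness of \<open>phantom p\<close>\<close>

lemma dense_N:
  obtains Q where "countable Q" "Q \<subseteq> N" "\<And>x e. x \<in> N \<Longrightarrow> e > 0 \<Longrightarrow> \<exists>q\<in>Q. lenN (inv q \<otimes> x) < e"
proof -
  have "second_countable TN"
    using polishN by (simp add: polish_subgroup_topology_def polish_group_def)
  then obtain Q where Q: "countable Q" "Q \<subseteq> N" "dN.mtopology closure_of Q = N"
    using second_countable_imp_separable_space topspace_TN
    unfolding separable_space_def mtopology_dN by metis
  have "\<exists>q\<in>Q. lenN (inv q \<otimes> x) < e" if x: "x \<in> N" "e > 0" for x e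
  proof -
    have "x \<in> dN.mtopology closure_of Q" using x Q(3) by simp
    then obtain q where "q \<in> Q" "dN x q < e" using x(2) unfolding dN.metric_closure_of by auto
    then show ?thesis
      using x Q(2) dN_eq[of q x] dN.commute[of q x] by (intro bexI[of _ q]) auto
  qed
  then show thesis using that Q by blast
qed

text \<open>\<open>N\<close> is dense in \<open>phantom p\<close> by the very definition, and
  \<open>Q\<close> is dense in \<open>N\<close>, whose small elements lie in every ball.\<close>

lemma dense_phantom:
  assumes "None < p" "Q \<subseteq> N" "\<And>x e. x \<in> N \<Longrightarrow> e > 0 \<Longrightarrow> \<exists>q\<in>Q. lenN (inv q \<otimes> x) < e"
    and "x \<in> phantom p" "j < p" "\<theta> > 0"
  shows "\<exists>q\<in>Q. inv q \<otimes> x \<in> pball j \<theta>"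
proof -
  have "\<theta> / 2 > 0" using assms(6) by simp
  then obtain v where v: "v \<in> N" "inv v \<otimes> x \<in> pball j (\<theta> / 2)"
    using assms(4,5) unfolding phantom_iff[OF assms(1)] by blast
  obtain q where q: "q \<in> Q" "lenN (inv q \<otimes> v) < \<theta> / 2"
    using assms(3)[OF v(1) \<open>\<theta> / 2 > 0\<close>] by blast
  have "inv q \<otimes> v \<in> pball j (\<theta> / 2)" using q v(1) assms(2) by (intro N_in_pball) auto
  from pball_mult[OF this v(2)] have "(inv q \<otimes> v) \<otimes> (inv v \<otimes> x) \<in> pball j \<theta>" by simp
  also have "(inv q \<otimes> v) \<otimes> (inv v \<otimes> x) = inv q \<otimes> x"
    using q(1) assms(2) v(1) phantom_carrier[OF assms(4)] by (simp add: m_assoc subsetD)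
  finally show ?thesis using q(1) by blast
qed

text \<open>The limit is taken in \<open>d0\<close>, as balls of index \<open>None\<close> bound
  \<open>len0\<close>. Convergence in the other balls follows by induction on the index, because
  each of them is closed with respect to the earlier ones.\<close>

lemma mcomplete_phantom:
  assumes p: "None < p"
  shows "Metric_space.mcomplete (phantom p) (pdist p)"
proof -
  interpret m: Metric_space "phantom p" "pdist p" by (rule Metric_space_phantom[OF p])
  have "\<exists>x. limitin m.mtopology \<sigma> x sequentially" if cau: "m.MCauchy \<sigma>" for \<sigma>
  proof -
    have \<sigma>: "\<sigma> n \<in> phantom p" for n using cau unfolding m.MCauchy_def by blast
    then have \<sigma>c: "\<sigma> n \<in> carrier G" for n using phantom_carrier by blast
    have cauchy: "\<exists>K. \<forall>m\<ge>K. \<forall>n\<ge>K. inv (\<sigma> m) \<otimes> \<sigma> n \<in> pball j \<delta>" if j: "j < p" "\<delta> > 0" for j \<delta>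
    proof -
      obtain r where r: "r > 0" "\<forall>x. elen p x < r \<longrightarrow> x \<in> pball j \<delta>"
        using elen_less_imp_pball[OF j] by blast
      obtain K where "\<forall>m n. K \<le> m \<longrightarrow> K \<le> n \<longrightarrow> pdist p (\<sigma> m) (\<sigma> n) < r"
        using cau r(1) unfolding m.MCauchy_def by blast
      then show ?thesis using r(2) \<sigma> by (intro exI[of _ K]) (simp add: pdist_eq)
    qed
    have "d0.MCauchy \<sigma>"
      unfolding d0.MCauchy_def
    proof (intro conjI allI impI)
      show "range \<sigma> \<subseteq> carrier G" using \<sigma>c by blast
      fix e :: real assume "e > 0"
      then have "e / 2 > 0" by simp
      then obtain K where "\<forall>m\<ge>K. \<forall>n\<ge>K. inv (\<sigma> m) \<otimes> \<sigma> n \<in> pball None (e / 2)"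
        using cauchy[OF p] by blast
      then show "\<exists>K. \<forall>m n. K \<le> m \<longrightarrow> K \<le> n \<longrightarrow> d0 (\<sigma> m) (\<sigma> n) < e"
        using \<open>e > 0\<close> \<sigma>c by (intro exI[of _ K]) (fastforce simp: pball_None d0_eq)
    qed
    then obtain x where "limitin d0.mtopology \<sigma> x sequentially"
      using mcomplete_d0 unfolding d0.mcomplete_def by blast
    then have x: "x \<in> carrier G" and lim0: "\<And>e. e > 0 \<Longrightarrow> \<exists>K. \<forall>n\<ge>K. d0 (\<sigma> n) x < e"
      unfolding d0.limit_metric_sequentially by blast+
    have lim: "\<exists>K. \<forall>n\<ge>K. inv (\<sigma> n) \<otimes> x \<in> pball j \<delta>" if "j < p" "\<delta> > 0" for j \<delta>
      using that
    proof (induction j arbitrary: \<delta> rule: less_induct)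
      case (less j)
      show ?case
      proof (cases "j = None")
        case True
        obtain K where "\<forall>n\<ge>K. d0 (\<sigma> n) x < \<delta>" using lim0[OF less.prems(2)] by blast
        then show ?thesis using True x \<sigma>c by (intro exI[of _ K]) (auto simp: pball_None d0_eq)
      next
        case False
        then have j: "None < j" by (simp add: None_less_iff)
        obtain K where K: "\<forall>m\<ge>K. \<forall>n\<ge>K. inv (\<sigma> m) \<otimes> \<sigma> n \<in> pball j \<delta>"
          using cauchy[OF less.prems] by blast
        have "inv (\<sigma> n) \<otimes> x \<in> pball j \<delta>" if n: "n \<ge> K" for n
          unfolding pball_iff[OF j]
        proof (intro conjI allI impI)
          show "inv (\<sigma> n) \<otimes> x \<in> carrier G" using x \<sigma>c by simp
          fix i and \<theta> :: real assume i: "i < j" and "\<theta> > 0"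
          then have t: "\<theta> / 2 > 0" by simp
          obtain K' where K': "\<forall>n\<ge>K'. inv (\<sigma> n) \<otimes> x \<in> pball i (\<theta> / 2)"
            using less.IH[OF i _ t] i less.prems(1) by (meson order_less_trans)
          \<comment> \<open>The late term may depend on \<open>i\<close> and \<theta>: the Cauchy
            condition at level \<open>j\<close> puts
            \<open>inv (\<sigma> n) \<otimes> \<sigma> m\<close> into one fixed ball for all late
            \<open>m\<close>.\<close>
          define m where "m = max K K'"
          have "inv (\<sigma> n) \<otimes> \<sigma> m \<in> pball j \<delta>" using K n by (simp add: m_def)
          then obtain v where v: "v \<in> N" "lenN v < \<delta>" "inv v \<otimes> (inv (\<sigma> n) \<otimes> \<sigma> m) \<in> pball i (\<theta> / 2)"
            using i t unfolding pball_iff[OF j] by blast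
          have "inv (\<sigma> m) \<otimes> x \<in> pball i (\<theta> / 2)" using K' by (simp add: m_def)
          from pball_mult[OF v(3) this]
          have "inv v \<otimes> (inv (\<sigma> n) \<otimes> \<sigma> m) \<otimes> (inv (\<sigma> m) \<otimes> x) \<in> pball i \<theta>" by simp
          also have "inv v \<otimes> (inv (\<sigma> n) \<otimes> \<sigma> m) \<otimes> (inv (\<sigma> m) \<otimes> x) = inv v \<otimes> (inv (\<sigma> n) \<otimes> x)"
            using v(1) \<sigma>c x by (simp add: m_assoc)
          finally show "\<exists>v\<in>N. lenN v < \<delta> \<and> inv v \<otimes> (inv (\<sigma> n) \<otimes> x) \<in> pball i \<theta>" using v by blast
        qed
        then show ?thesis by blast
      qed
    qed
    have xp: "x \<in> phantom p"
      unfolding phantom_iff[OF p]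
    proof (intro conjI allI impI x)
      fix j and \<theta> :: real assume j: "j < p" and "\<theta> > 0"
      then have t: "\<theta> / 2 > 0" by simp
      obtain K where K: "\<forall>n\<ge>K. inv (\<sigma> n) \<otimes> x \<in> pball j (\<theta> / 2)" using lim[OF j t] by blast
      obtain v where v: "v \<in> N" "inv v \<otimes> \<sigma> K \<in> pball j (\<theta> / 2)"
        using \<sigma>[of K] j t unfolding phantom_iff[OF p] by blast
      from pball_mult[OF v(2) K[rule_format, OF order_refl]]
      have "inv v \<otimes> \<sigma> K \<otimes> (inv (\<sigma> K) \<otimes> x) \<in> pball j \<theta>" by simp
      also have "inv v \<otimes> \<sigma> K \<otimes> (inv (\<sigma> K) \<otimes> x) = inv v \<otimes> x"
        using v(1) \<sigma>c x by (simp add: m_assoc)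
      finally show "\<exists>v\<in>N. inv v \<otimes> x \<in> pball j \<theta>" using v(1) by blast
    qed
    have "limitin m.mtopology \<sigma> x sequentially"
      unfolding m.limit_metric_sequentially
    proof (intro conjI allI impI xp)
      fix e :: real assume "e > 0"
      then obtain j \<delta> where j: "j < p" "\<delta> > 0" "\<forall>x\<in>pball j \<delta>. elen p x < e"
        using pball_imp_elen_less[OF p] by blast
      obtain K where "\<forall>n\<ge>K. inv (\<sigma> n) \<otimes> x \<in> pball j \<delta>" using lim[OF j(1,2)] by blast
      then show "\<exists>K. \<forall>n\<ge>K. \<sigma> n \<in> phantom p \<and> pdist p (\<sigma> n) x < e"
        using j(3) \<sigma> xp by (intro exI[of _ K]) (simp add: pdist_eq)
    qed
    then show ?thesis by blast
  qed
  then show ?thesis unfolding m.mcomplete_def by blast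
qed

lemma topological_group_phantom:
  assumes p: "None < p"
  shows "topological_group (G\<lparr>carrier := phantom p\<rparr>) (ptop p)"
  unfolding ptop_def
proof (rule biinvariant_topological_group[OF group_axioms phantom_subgroup_G[OF p] Metric_space_phantom[OF p]])
  fix x y z assume "x \<in> phantom p" "y \<in> phantom p" "z \<in> phantom p"
  then have xyz: "x \<in> carrier G" "y \<in> carrier G" "z \<in> carrier G" using phantom_carrier by blast+
  then show "pdist p (z \<otimes> x) (z \<otimes> y) = pdist p x y"
    by (simp add: pdist_def inv_mult_group m_assoc)
  have "elen p (inv z \<otimes> ((inv x \<otimes> y) \<otimes> z)) = elen p (inv x \<otimes> y \<otimes> z \<otimes> inv z)"
    using xyz by (intro elen_swap) auto
  then show "pdist p (x \<otimes> z) (y \<otimes> z) = pdist p x y"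
    using xyz by (simp add: pdist_def inv_mult_group m_assoc)
qed

lemma continuous_map_ptop_T:
  assumes p: "None < p"
  shows "continuous_map (ptop p) T (\<lambda>x. x)"
  unfolding continuous_map_def
proof (intro conjI allI impI)
  show "(\<lambda>x. x) \<in> topspace (ptop p) \<rightarrow> topspace T"
    using phantom_carrier by (auto simp: topspace_ptop[OF p] topspace_T)
  fix U assume U: "openin T U"
  show "openin (ptop p) {x \<in> topspace (ptop p). x \<in> U}"
    unfolding openin_ptop[OF p] topspace_ptop[OF p]
  proof (intro conjI ballI)
    fix x assume "x \<in> {x \<in> phantom p. x \<in> U}"
    then obtain r where r: "r > 0" "\<forall>y\<in>carrier G. len0 (inv x \<otimes> y) < r \<longrightarrow> y \<in> U"
      using U unfolding openin_T by blast
    show "\<exists>j<p. \<exists>\<delta>>0. \<forall>y\<in>phantom p. inv x \<otimes> y \<in> pball j \<delta> \<longrightarrow> y \<in> {x \<in> phantom p. x \<in> U}"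
    proof (intro exI conjI ballI impI)
      show "None < p" "r / 2 > 0" using p r(1) by auto
      fix y assume "y \<in> phantom p" "inv x \<otimes> y \<in> pball None (r / 2)"
      then show "y \<in> {x \<in> phantom p. x \<in> U}"
        using r phantom_carrier by (auto simp: pball_None)
    qed
  qed auto
qed

lemma polish_phantom:
  assumes p: "None < p"
  shows "polish_subgroup_topology G T (phantom p) (ptop p)"
proof -
  interpret m: Metric_space "phantom p" "pdist p" by (rule Metric_space_phantom[OF p])
  obtain Q where Q: "countable Q" "Q \<subseteq> N" "\<And>x e. x \<in> N \<Longrightarrow> e > 0 \<Longrightarrow> \<exists>q\<in>Q. lenN (inv q \<otimes> x) < e"
    using dense_N by metis
  have "second_countable m.mtopology"
  proof (rule m.second_countable_mtopology_dense[OF Q(1)])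
    show "Q \<subseteq> phantom p" using Q(2) N_subset_phantom by blast
    fix x and e :: real assume x: "x \<in> phantom p" and "e > 0"
    then obtain j \<delta> where j: "j < p" "\<delta> > 0" "\<forall>x\<in>pball j \<delta>. elen p x < e"
      using pball_imp_elen_less[OF p] by blast
    obtain q where "q \<in> Q" "inv q \<otimes> x \<in> pball j \<delta>"
      using dense_phantom[OF p Q(2,3) x j(1,2)] by blast
    then show "\<exists>q\<in>Q. pdist p q x < e"
      using j(3) x \<open>Q \<subseteq> phantom p\<close> by (auto simp: pdist_eq intro!: bexI[of _ q])
  qed
  moreover have "completely_metrizable_space m.mtopology"
    using m.completely_metrizable_space_mtopology mcomplete_phantom[OF p] by simp
  ultimately show ?thesis
    using topological_group_phantom[OF p] continuous_map_ptop_T[OF p]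
    by (simp add: polish_subgroup_topology_def polish_group_def ptop_def)
qed

text \<open>Uniqueness of Polish subgroup topologies evaluates the definite description at the
  topology constructed above.\<close>

lemma polish_top_phantom:
  assumes p: "None < p"
  shows "polish_top G T (phantom p) = ptop p"
  unfolding polish_top_def
proof (rule the_equality[where P = "polish_subgroup_topology G T (phantom p)"])
  show "polish_subgroup_topology G T (phantom p) (ptop p)" by (rule polish_phantom[OF p])
  fix S assume "polish_subgroup_topology G T (phantom p) S"
  then show "S = ptop p"
    using polish_phantom[OF p] polish_group_topology_unique metrizable_imp_Hausdorff_space[OF metrizable_T]
    unfolding polish_subgroup_topology_def by blast
qed


section \<open>Minimality of the phantom subgroups\<close>

lemma topological_group_T: "topological_group G T"
  using polish by (simp add: polish_group_def)

lemma Pi0_translate: "Pi0 T \<alpha> A \<Longrightarrow> g \<in> carrier G \<Longrightarrow> Pi0 T \<alpha> ((\<otimes>) g ` A)"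
  by (intro Pi0_homeomorphic_image[OF topological_group_left_translation[OF topological_group_T]])

lemma translate_cancel: "g \<in> carrier G \<Longrightarrow> A \<subseteq> carrier G \<Longrightarrow> (\<otimes>) g ` (\<otimes>) (inv g) ` A = A"
  by (force simp: image_image subset_iff)

section \<open>Groups between \<open>N\<close> and \<open>G\<close>, and the transfer of
  genericity\<close>

text \<open>The last clause is continuity of the inclusion of \<open>N\<close> at \<one>. The notion
  covers \<open>N\<close> and every \<open>phantom p\<close> at once, which lets one induction
  handle all of them.\<close>

definition stage :: "'a set \<Rightarrow> 'a topology \<Rightarrow> bool" where
  "stage K X \<longleftrightarrow> N \<subseteq> K \<and> subgroup K G \<and> polish_subgroup_topology G T K X \<and>
     (\<forall>A. openin X A \<and> \<one> \<in> A \<longrightarrow> (\<exists>\<delta>>0. \<forall>v\<in>N. lenN v < \<delta> \<longrightarrow> v \<in> A))"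

definition finer :: "'a set \<Rightarrow> 'a topology \<Rightarrow> omega1 option \<Rightarrow> bool" where
  "finer K X p \<longleftrightarrow> K \<subseteq> phantom p \<and> (\<forall>A. openin (ptop p) A \<longrightarrow> openin X (A \<inter> K))"

lemma stage_phantom: "None < p \<Longrightarrow> stage (phantom p) (ptop p)"
proof -
  assume p: "None < p"
  have "\<exists>\<delta>>0. \<forall>v\<in>N. lenN v < \<delta> \<longrightarrow> v \<in> A" if A: "openin (ptop p) A" "\<one> \<in> A" for A
  proof -
    obtain j \<delta> where j: "j < p" "\<delta> > 0" "\<forall>y\<in>phantom p. inv \<one> \<otimes> y \<in> pball j \<delta> \<longrightarrow> y \<in> A"
      using A unfolding openin_ptop[OF p] by blast
    then show ?thesis using N_subset_phantom[of p] N_in_pball[of _ \<delta> j] by (auto intro!: exI[of _ \<delta>])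
  qed
  then show ?thesis
    using N_subset_phantom phantom_subgroup_G[OF p] polish_phantom[OF p] by (auto simp: stage_def)
qed

lemma stage_N: "stage N TN"
proof -
  have "\<exists>\<delta>>0. \<forall>v\<in>N. lenN v < \<delta> \<longrightarrow> v \<in> A" if A: "openin TN A" "\<one> \<in> A" for A
    using A unfolding openin_TN by force
  then show ?thesis using polishN N.subgroup_axioms by (auto simp: stage_def)
qed

lemma finer_phantom:
  assumes "None < p" "p \<le> q"
  shows "finer (phantom q) (ptop q) p"
  unfolding finer_def
proof (intro conjI allI impI)
  have q: "None < q" using assms by (rule order_less_le_trans)
  show sub: "phantom q \<subseteq> phantom p" by (rule phantom_antimono[OF assms(2)])
  fix A assume A: "openin (ptop p) A"
  show "openin (ptop q) (A \<inter> phantom q)"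
    unfolding openin_ptop[OF q]
  proof (intro conjI ballI)
    fix x assume x: "x \<in> A \<inter> phantom q"
    then obtain j \<delta> where j: "j < p" "\<delta> > 0" "\<forall>y\<in>phantom p. inv x \<otimes> y \<in> pball j \<delta> \<longrightarrow> y \<in> A"
      using A unfolding openin_ptop[OF assms(1)] by blast
    then show "\<exists>j<q. \<exists>\<delta>>0. \<forall>y\<in>phantom q. inv x \<otimes> y \<in> pball j \<delta> \<longrightarrow> y \<in> A \<inter> phantom q"
      using sub order_less_le_trans[OF j(1) assms(2)] by (intro exI[of _ j] conjI exI[of _ \<delta>]) auto
  qed auto
qed

lemma finer_N:
  assumes "None < p"
  shows "finer N TN p"
  unfolding finer_def
proof (intro conjI allI impI N_subset_phantom)
  fix A assume A: "openin (ptop p) A"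
  show "openin TN (A \<inter> N)"
    unfolding openin_TN
  proof (intro conjI ballI)
    fix x assume x: "x \<in> A \<inter> N"
    then obtain j \<delta> where j: "\<delta> > 0" "\<forall>y\<in>phantom p. inv x \<otimes> y \<in> pball j \<delta> \<longrightarrow> y \<in> A"
      using A unfolding openin_ptop[OF assms(1)] by blast
    then show "\<exists>r>0. \<forall>y\<in>N. lenN (inv x \<otimes> y) < r \<longrightarrow> y \<in> A \<inter> N"
      using x N_subset_phantom[of p] by (intro exI[of _ \<delta>]) (auto intro: N_in_pball)
  qed auto
qed

lemma finer_trans:
  assumes "finer K X p" "None < i" "i \<le> p"
  shows "finer K X i"
  unfolding finer_def
proof (intro conjI allI impI)
  have sub: "phantom p \<subseteq> phantom i" "K \<subseteq> phantom p"
    using phantom_antimono[OF assms(3)] assms(1) by (auto simp: finer_def)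
  then show "K \<subseteq> phantom i" by blast
  fix A assume "openin (ptop i) A"
  then have "openin (ptop p) (A \<inter> phantom p)"
    using finer_phantom[OF assms(2,3)] by (simp add: finer_def)
  then have "openin X (A \<inter> phantom p \<inter> K)" using assms(1) by (simp add: finer_def)
  moreover have "A \<inter> phantom p \<inter> K = A \<inter> K" using sub by blast
  ultimately show "openin X (A \<inter> K)" by simp
qed

lemma stageD:
  assumes "stage K X"
  shows "N \<subseteq> K" "subgroup K G" "K \<subseteq> carrier G" "topspace X = K" "completely_metrizable_space X"
    "second_countable X" "continuous_map X T (\<lambda>x. x)" "topological_group (G\<lparr>carrier := K\<rparr>) X"
  using assms subgroup.subset[of K G]
  unfolding stage_def polish_subgroup_topology_def polish_group_def topological_group_def by auto

lemma stage_translation: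
  assumes "stage K X" "g \<in> K"
  shows "homeomorphic_map X X ((\<otimes>) g)"
  using topological_group_left_translation[OF stageD(8)[OF assms(1)], of g] assms(2) by simp

lemma stage_translate_open:
  assumes "stage K X" "g \<in> K" "openin X A"
  shows "openin X ((\<otimes>) g ` A)"
  using homeomorphic_map_openness[OF stage_translation[OF assms(1,2)] openin_subset[OF assms(3)]] assms(3)
  by simp

lemma stage_translate_meager:
  assumes "stage K X" "g \<in> K" "meager_in X (S - A)"
  shows "meager_in X ((\<otimes>) g ` S - (\<otimes>) g ` A)"
  by (rule meager_in_subset[OF meager_in_homeomorphic_image[OF stage_translation[OF assms(1,2)] assms(3)]])
    (rule image_diff_subset)

text \<open>The exceptional part is open in \<open>X\<close> and meager, hence empty. This is the
  base case of both transfers.\<close>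

lemma stage_closed_comeager:
  assumes "stage K X" "closedin T A" "openin X S" "meager_in X (S - A)"
  shows "S \<subseteq> A"
proof -
  have "closedin X {x \<in> topspace X. x \<in> A}"
    by (rule closedin_continuous_map_preimage[OF stageD(7)[OF assms(1)] assms(2)])
  then have "openin X (S - {x \<in> topspace X. x \<in> A})" using assms(3) by (rule openin_diff[rotated])
  moreover have "S - {x \<in> topspace X. x \<in> A} = S - A" using openin_subset[OF assms(3)] by blast
  ultimately show ?thesis
    using not_meager_in_open[OF stageD(5)[OF assms(1)] _ assms(4)] by simp
qed

text \<open>Allowing any smaller radius leaves room for multiplication by a small element. This
  makes the set open, as localization of category requires.\<close>

definition oball :: "omega1 option \<Rightarrow> omega1 option \<Rightarrow> real \<Rightarrow> 'a set" where
  "oball p j \<delta> = {x \<in> phantom p. \<exists>\<delta>'<\<delta>. x \<in> pball j \<delta>'}"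

lemma N_in_oball: "v \<in> N \<Longrightarrow> lenN v < \<delta> \<Longrightarrow> v \<in> oball p j \<delta>"
  using dense[of "lenN v" \<delta>] N_subset_phantom by (auto simp: oball_def intro: N_in_pball)

lemma one_in_oball: "\<delta> > 0 \<Longrightarrow> \<one> \<in> oball p j \<delta>"
  by (rule N_in_oball) (simp_all add: lenN_one)

lemma openin_oball:
  assumes "j < p"
  shows "openin (ptop p) (oball p j \<delta>)"
proof -
  have p: "None < p" using assms by (cases p) auto
  show ?thesis
    unfolding openin_ptop[OF p]
  proof (intro conjI ballI)
    show "oball p j \<delta> \<subseteq> phantom p" by (auto simp: oball_def)
    fix x assume "x \<in> oball p j \<delta>"
    then obtain \<delta>' where x: "x \<in> phantom p" "\<delta>' < \<delta>" "x \<in> pball j \<delta>'" by (auto simp: oball_def)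
    show "\<exists>i<p. \<exists>\<theta>>0. \<forall>y\<in>phantom p. inv x \<otimes> y \<in> pball i \<theta> \<longrightarrow> y \<in> oball p j \<delta>"
    proof (intro exI conjI ballI impI)
      show "j < p" by (rule assms)
      show "(\<delta> - \<delta>') / 2 > 0" using x(2) by simp
      fix y assume y: "y \<in> phantom p" "inv x \<otimes> y \<in> pball j ((\<delta> - \<delta>') / 2)"
      have "x \<otimes> (inv x \<otimes> y) \<in> pball j (\<delta>' + (\<delta> - \<delta>') / 2)"
        by (rule pball_mult[OF x(3) y(2)])
      then have "y \<in> pball j (\<delta>' + (\<delta> - \<delta>') / 2)"
        using phantom_carrier[OF x(1)] phantom_carrier[OF y(1)] by simp
      moreover have "\<delta>' + (\<delta> - \<delta>') / 2 < \<delta>" using x(2) by (simp add: field_simps)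
      ultimately show "y \<in> oball p j \<delta>" using y(1) by (auto simp: oball_def)
    qed
  qed
qed

text \<open>\<open>pushes_down \<alpha>\<close>: genericity of a $\Pi^0_{1+\alpha}$ set near the identity in a finer group passes
  to the balls of radius index at least \<open>\<alpha>\<close> in \<open>phantom p\<close>. \<open>pulls_back \<alpha>\<close> is the converse transfer,
  from \<open>phantom q\<close> to finer groups. The two are proved by a simultaneous induction.\<close>

definition pushes_down :: "omega1 \<Rightarrow> bool" where
  "pushes_down \<alpha> \<longleftrightarrow> (\<forall>K X p j \<delta> A S. stage K X \<longrightarrow> finer K X p \<longrightarrow> Some \<alpha> \<le> j \<longrightarrow> j < p \<longrightarrow>
     Pi0 T \<alpha> A \<longrightarrow> openin X S \<longrightarrow> (\<forall>v\<in>N. lenN v < \<delta> \<longrightarrow> v \<in> S) \<longrightarrow> meager_in X (S - A) \<longrightarrow>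
     meager_in (ptop p) (oball p j \<delta> - A))"

definition pulls_back :: "omega1 \<Rightarrow> bool" where
  "pulls_back \<alpha> \<longleftrightarrow> (\<forall>K X q A S. stage K X \<longrightarrow> finer K X q \<longrightarrow> Some \<alpha> \<le> q \<longrightarrow>
     Pi0 T \<alpha> A \<longrightarrow> openin (ptop q) S \<longrightarrow> meager_in (ptop q) (S - A) \<longrightarrow> meager_in X (S \<inter> K - A))"

text \<open>Translation by the inverse of \<open>y\<close> moves the open set to \<one>, where it
  contains all short elements of \<open>N\<close>; \<open>pushes_down\<close> applies to such sets
  only.\<close>

lemma stage_recenter:
  assumes "stage K X" "openin X P" "y \<in> P" "meager_in X (P - B)"
  obtains \<theta> S where "\<theta> > 0" "openin X S" "\<forall>v\<in>N. lenN v < \<theta> \<longrightarrow> v \<in> S"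
    "meager_in X (S - (\<otimes>) (inv y) ` B)"
proof -
  have yK: "y \<in> K" using assms(2,3) openin_subset[OF assms(2)] stageD(4)[OF assms(1)] by blast
  have inv: "inv y \<in> K" by (rule subgroup.m_inv_closed[OF stageD(2)[OF assms(1)] yK])
  have op: "openin X ((\<otimes>) (inv y) ` P)" by (rule stage_translate_open[OF assms(1) inv assms(2)])
  moreover have "\<one> \<in> (\<otimes>) (inv y) ` P"
    using yK stageD(3)[OF assms(1)] by (intro image_eqI[OF _ assms(3)]) auto
  ultimately obtain \<theta> where \<theta>: "\<theta> > 0" "\<forall>v\<in>N. lenN v < \<theta> \<longrightarrow> v \<in> (\<otimes>) (inv y) ` P"
    using assms(1) unfolding stage_def by blast
  show thesis
    by (rule that[OF \<theta>(1) op \<theta>(2) stage_translate_meager[OF assms(1) inv assms(4)]])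
qed

text \<open>\<open>pushes_down\<close> freed from the identity: translate a point \<open>y\<close>
  to \<one>, apply it with \<open>j\<close> equal to \<open>Some \<alpha>\<close>, and translate
  back. The Borel class is preserved because translations are homeomorphisms of
  \<open>T\<close>.\<close>

lemma pushes_downD:
  assumes "pushes_down \<alpha>" "stage K X" "finer K X p" "Some \<alpha> < p" "Pi0 T \<alpha> B"
    and "openin X P" "y \<in> P" "meager_in X (P - B)"
  obtains \<theta> where "\<theta> > 0" "meager_in (ptop p) ((\<otimes>) y ` oball p (Some \<alpha>) \<theta> - B)"
proof -
  have p: "None < p" using assms(4) by (cases p) auto
  have yK: "y \<in> K" using openin_subset[OF assms(6)] assms(7) stageD(4)[OF assms(2)] by blast
  then have yc: "y \<in> carrier G" and yp: "y \<in> phantom p"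
    using stageD(3)[OF assms(2)] assms(3) by (auto simp: finer_def)
  obtain \<theta> S where \<theta>: "\<theta> > 0" "openin X S" "\<forall>v\<in>N. lenN v < \<theta> \<longrightarrow> v \<in> S"
      "meager_in X (S - (\<otimes>) (inv y) ` B)"
    using stage_recenter[OF assms(2,6,7,8)] by metis
  have "Pi0 T \<alpha> ((\<otimes>) (inv y) ` B)" using Pi0_translate[OF assms(5)] yc by simp
  then have "meager_in (ptop p) (oball p (Some \<alpha>) \<theta> - (\<otimes>) (inv y) ` B)"
    using assms(1-4) \<theta> unfolding pushes_down_def by blast
  then have "meager_in (ptop p) ((\<otimes>) y ` oball p (Some \<alpha>) \<theta> - (\<otimes>) y ` (\<otimes>) (inv y) ` B)"
    by (rule stage_translate_meager[OF stage_phantom[OF p] yp])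
  moreover have "(\<otimes>) y ` (\<otimes>) (inv y) ` B = B"
    using translate_cancel[OF yc] Pi0_subset[OF assms(5)] topspace_T by simp
  ultimately show thesis using that[OF \<theta>(1)] by simp
qed

text \<open>If genericity of \<open>A\<close> is lost in \<open>X\<close>, some \<open>B n\<close>
  of lower index is comeager in a piece of \<open>S \<inter> K\<close>. Pushed down to
  \<open>phantom q\<close>, it is comeager in an open set that meets \<open>S\<close>. There
  \<open>A\<close> is generic too, but \<open>A\<close> and \<open>B n\<close> are disjoint.\<close>

lemma pulls_back_step:
  assumes IH: "\<And>\<beta>. \<beta> < \<alpha> \<Longrightarrow> pushes_down \<beta>"
  shows "pulls_back \<alpha>"
  unfolding pulls_back_def
proof (intro allI impI)
  fix K X q A S
  assume st: "stage K X" and fi: "finer K X q" and q: "Some \<alpha> \<le> q" and A: "Pi0 T \<alpha> A"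
    and S: "openin (ptop q) S" "meager_in (ptop q) (S - A)"
  have q0: "None < q" by (rule None_less_if_Some_le[OF q])
  show "meager_in X (S \<inter> K - A)"
    using A
  proof (cases rule: Pi0_cases)
    case 1
    have "S \<subseteq> A" by (rule stage_closed_comeager[OF stage_phantom[OF q0] 1(2) S])
    then have "S \<inter> K - A = {}" by blast
    then show ?thesis using meager_in_empty by metis
  next
    case (2 \<beta> B)
    show ?thesis
    proof (rule ccontr)
      assume neg: "\<not> meager_in X (S \<inter> K - A)"
      have SK: "openin X (S \<inter> K)" using fi S(1) by (simp add: finer_def)
      obtain n P where P: "openin X P" "P \<noteq> {}" "P \<subseteq> S \<inter> K" "meager_in X (P - B n)"
        using not_comeager_compl_UnionE[OF 2(2) stageD(6,7)[OF st] SK neg[unfolded 2(3)]] by metis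
      obtain y where y: "y \<in> P" using P(2) by blast
      have less: "Some (\<beta> n) < q" using 2(1)[of n] q by (meson less_option_Some order_less_le_trans)
      obtain \<theta> where \<theta>: "\<theta> > 0" "meager_in (ptop q) ((\<otimes>) y ` oball q (Some (\<beta> n)) \<theta> - B n)"
        using pushes_downD[OF IH[OF 2(1)] st fi less 2(2) P(1) y P(4)] by metis
      have yK: "y \<in> K" using y P(3) by blast
      then have yq: "y \<in> phantom q" using fi by (auto simp: finer_def)
      have "y \<in> (\<otimes>) y ` oball q (Some (\<beta> n)) \<theta>"
        using phantom_carrier[OF yq] by (intro image_eqI[OF _ one_in_oball[OF \<theta>(1)]]) simp
      then have "y \<in> S \<inter> (\<otimes>) y ` oball q (Some (\<beta> n)) \<theta>" using y P(3) by blast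
      then have "A \<inter> B n \<inter> S \<inter> (\<otimes>) y ` oball q (Some (\<beta> n)) \<theta> \<noteq> {}"
        by (rule comeager_in_open_meet[OF stageD(5)[OF stage_phantom[OF q0]] S(1)
              stage_translate_open[OF stage_phantom[OF q0] yq openin_oball[OF less]] S(2) \<theta>(2)])
      then show False using 2(3) by blast
    qed
  qed
qed

text \<open>Suppose some \<open>B n\<close> is comeager in a piece of the ball in
  \<open>phantom p\<close>, and let \<open>y\<close> be a point of that piece. Then
  \<open>B n\<close> is pushed down to \<open>phantom j\<close> around \<open>y\<close> and pulled
  back from there to \<open>K\<close>. By the definition of \<open>pball j\<close>, short elements
  of \<open>N\<close> come close to \<open>y\<close>, so the resulting open set meets
  \<open>S\<close>, where \<open>A\<close> is generic.\<close>

lemma pushes_down_step: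
  assumes IH: "\<And>\<beta>. \<beta> < \<alpha> \<Longrightarrow> pushes_down \<beta>" and IH': "\<And>\<beta>. \<beta> < \<alpha> \<Longrightarrow> pulls_back \<beta>"
  shows "pushes_down \<alpha>"
  unfolding pushes_down_def
proof (intro allI impI)
  fix K X p j \<delta> A S
  assume st: "stage K X" and fi: "finer K X p" and j: "Some \<alpha> \<le> j" "j < p" and A: "Pi0 T \<alpha> A"
    and S: "openin X S" "\<forall>v\<in>N. lenN v < \<delta> \<longrightarrow> v \<in> S" "meager_in X (S - A)"
  have j0: "None < j" by (rule None_less_if_Some_le[OF j(1)])
  have p0: "None < p" using j0 j(2) by (rule order_less_trans)
  note stp = stage_phantom[OF p0] and stj = stage_phantom[OF j0]
  show "meager_in (ptop p) (oball p j \<delta> - A)"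
    using A
  proof (cases rule: Pi0_cases)
    case 1
    have "S \<subseteq> A" by (rule stage_closed_comeager[OF st 1(2) S(1,3)])
    \<comment> \<open>Points of the ball are \<open>d0\<close>-limits of elements of
      \<open>N\<close> shorter than \<delta>. These lie in \<open>S\<close>, hence in the closed set
      \<open>A\<close>.\<close>
    have "oball p j \<delta> \<subseteq> A"
    proof (rule ccontr)
      assume "\<not> oball p j \<delta> \<subseteq> A"
      then obtain x \<delta>' where x: "x \<notin> A" "\<delta>' < \<delta>" "x \<in> pball j \<delta>'" by (auto simp: oball_def)
      have xc: "x \<in> carrier G" by (rule pball_carrier[OF x(3)])
      have "openin T (carrier G - A)" using 1(2) topspace_T by (metis openin_closedin_eq closedin_def)
      then obtain r where r: "r > 0" "\<forall>y\<in>carrier G. len0 (inv x \<otimes> y) < r \<longrightarrow> y \<in> carrier G - A"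
        using x(1) xc unfolding openin_T by blast
      have "r / 2 > 0" using r(1) by simp
      then obtain v where v: "v \<in> N" "lenN v < \<delta>'" "inv v \<otimes> x \<in> pball None (r / 2)"
        using x(3) j0 unfolding pball_iff[OF j0] by blast
      have "inv x \<otimes> v \<in> pball None (r / 2)"
        using pball_inv[OF v(3)] v(1) xc by (simp add: inv_mult_group)
      then have "v \<in> carrier G - A" using r v(1) by (auto simp: pball_None)
      then show False using S(2) v x(2) \<open>S \<subseteq> A\<close> by auto
    qed
    then have "oball p j \<delta> - A = {}" by blast
    then show ?thesis using meager_in_empty by metis
  next
    case (2 \<beta> B)
    show ?thesis
    proof (rule ccontr)
      assume neg: "\<not> meager_in (ptop p) (oball p j \<delta> - A)"
      obtain n P where P: "openin (ptop p) P" "P \<noteq> {}" "P \<subseteq> oball p j \<delta>" "meager_in (ptop p) (P - B n)"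
        using not_comeager_compl_UnionE[OF 2(2) stageD(6,7)[OF stp] openin_oball[OF j(2)] neg[unfolded 2(3)]]
        by metis
      obtain y where y: "y \<in> P" using P(2) by blast
      then obtain \<delta>' where \<delta>': "\<delta>' < \<delta>" "y \<in> pball j \<delta>'" using P(3) by (auto simp: oball_def)
      have yp: "y \<in> phantom p" using y P(3) by (auto simp: oball_def)
      have fj: "finer (phantom p) (ptop p) j" using finer_phantom[OF j0] j(2) by simp
      then have yj: "y \<in> phantom j" using yp by (auto simp: finer_def)
      have yc: "y \<in> carrier G" by (rule phantom_carrier[OF yp])
      have less: "Some (\<beta> n) < j" using 2(1)[of n] j(1) by (meson less_option_Some order_less_le_trans)
      \<comment> \<open>The detour through \<open>phantom j\<close> is forced:
        \<open>y \<in> pball j \<delta>'\<close> provides approximation from \<open>N\<close> only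
        in balls of index below \<open>j\<close>, which are those that define the topology of
        \<open>phantom j\<close>.\<close>
      obtain \<theta> where \<theta>: "\<theta> > 0" "meager_in (ptop j) ((\<otimes>) y ` oball j (Some (\<beta> n)) \<theta> - B n)"
        using pushes_downD[OF IH[OF 2(1)] stp fj less 2(2) P(1) y P(4)] by metis
      let ?O = "(\<otimes>) y ` oball j (Some (\<beta> n)) \<theta>"
      have opO: "openin (ptop j) ?O"
        by (rule stage_translate_open[OF stj yj openin_oball[OF less]])
      have fi': "finer K X j" using finer_trans[OF fi j0] j(2) by simp
      have mO: "meager_in X (?O \<inter> K - B n)"
        using IH'[OF 2(1)] st fi' less 2(2) opO \<theta>(2) unfolding pulls_back_def
        by (meson order_less_imp_le)
      have opOK: "openin X (?O \<inter> K)" using fi' opO by (simp add: finer_def)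
      have "\<theta> / 2 > 0" using \<theta>(1) by simp
      \<comment> \<open>The common point: its length below \<delta>' places \<open>v\<close> in
        \<open>S\<close>, and its closeness to \<open>y\<close> in the ball of index
        \<open>\<beta> n\<close> places it in \<open>?O\<close>.\<close>
      then obtain v where v: "v \<in> N" "lenN v < \<delta>'" "inv v \<otimes> y \<in> pball (Some (\<beta> n)) (\<theta> / 2)"
        using \<delta>'(2) less unfolding pball_iff[OF j0] by blast
      have "inv y \<otimes> v \<in> oball j (Some (\<beta> n)) \<theta>"
      proof -
        have "inv y \<otimes> v \<in> pball (Some (\<beta> n)) (\<theta> / 2)"
          using pball_inv[OF v(3)] v(1) yc by (simp add: inv_mult_group)
        moreover have "inv y \<otimes> v \<in> phantom j"
          using yj v(1) N_subset_phantom[of j] phantom_subgroup_G[OF j0]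
          by (meson subgroup.m_closed subgroup.m_inv_closed subsetD)
        ultimately show ?thesis using \<theta>(1) by (auto simp: oball_def intro!: exI[of _ "\<theta> / 2"])
      qed
      then have "v \<in> ?O" using yc v(1) by (intro image_eqI[of _ _ "inv y \<otimes> v"]) simp_all
      moreover have "v \<in> S" using S(2) v \<delta>'(1) by auto
      moreover have "v \<in> K" using v(1) stageD(1)[OF st] by blast
      ultimately have "v \<in> S \<inter> (?O \<inter> K)" by blast
      then have "A \<inter> B n \<inter> S \<inter> (?O \<inter> K) \<noteq> {}"
        by (rule comeager_in_open_meet[OF stageD(5)[OF st] S(1) opOK S(3) mO])
      then show False using 2(3) by blast
    qed
  qed
qed

lemma pushes_down: "pushes_down \<alpha>"
proof (induction \<alpha> rule: less_induct)
  case (less \<alpha>)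
  \<comment> \<open>Pulling back at \<beta> uses \<open>pushes_down\<close> strictly below \<beta>,
    so an induction on \<open>pushes_down\<close> alone is enough.\<close>
  have "pulls_back \<beta>" if "\<beta> < \<alpha>" for \<beta>
    using pulls_back_step less.IH that by (meson order_less_trans)
  then show ?case using pushes_down_step less.IH by blast
qed

lemma pulls_back: "pulls_back \<alpha>"
  using pulls_back_step pushes_down by blast

section \<open>Minimality by category\<close>

text \<open>If \<open>L\<close> were not comeager, some \<open>B n\<close> disjoint from
  \<open>N\<close> would be comeager in an open set \<open>P\<close>. Pulled back to
  \<open>N\<close>, this makes \<open>P \<inter> N\<close> meager, hence empty, although
  \<open>N\<close> is dense.\<close>

lemma phantom_minimal:
  assumes L: "Pi0 T (osucc \<alpha>) L" "subgroup L G" "N \<subseteq> L"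
  shows "phantom (Some \<alpha>) \<subseteq> L"
proof -
  define p where "p = Some \<alpha>"
  have p0: "None < p" by (simp add: p_def)
  note st = stage_phantom[OF p0]
  have opR: "openin (ptop p) (phantom p)" using openin_topspace topspace_ptop[OF p0] by metis
  have mR: "meager_in (ptop p) (phantom p - L)"
    using L(1)
  proof (cases rule: Pi0_cases)
    case 1
    then show ?thesis using less_osucc[of \<alpha>] zero_le_omega1[of \<alpha>] by simp
  next
    case (2 \<beta> B)
    show ?thesis
    proof (rule ccontr)
      assume neg: "\<not> meager_in (ptop p) (phantom p - L)"
      obtain n P where P: "openin (ptop p) P" "P \<noteq> {}" "P \<subseteq> phantom p" "meager_in (ptop p) (P - B n)"
        using not_comeager_compl_UnionE[OF 2(2) stageD(6,7)[OF st] opR neg[unfolded 2(3)]] by metis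
      \<comment> \<open>An index below the successor of \<alpha> is at most \<alpha>, which is just
        what \<open>pulls_back\<close> admits for \<open>phantom p\<close>.\<close>
      have "Some (\<beta> n) \<le> p" using 2(1)[of n] by (simp add: p_def less_osucc_iff)
      then have "meager_in TN (P \<inter> N - B n)"
        using pulls_back[of "\<beta> n"] stage_N finer_N[OF p0] 2(2)[of n] P(1,4)
        unfolding pulls_back_def by blast
      moreover have "P \<inter> N - B n = P \<inter> N" using L(3) 2(3) by blast
      moreover have "openin TN (P \<inter> N)" using finer_N[OF p0] P(1) by (simp add: finer_def)
      ultimately have "P \<inter> N = {}" using not_meager_in_open stageD(5)[OF stage_N] by metis
      obtain x where x: "x \<in> P" using P(2) by blast
      obtain j \<delta> where j: "j < p" "\<delta> > 0" "\<forall>y\<in>phantom p. inv x \<otimes> y \<in> pball j \<delta> \<longrightarrow> y \<in> P"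
        using P(1) x unfolding openin_ptop[OF p0] by blast
      obtain v where v: "v \<in> N" "inv v \<otimes> x \<in> pball j \<delta>"
        using x P(3) j(1,2) phantom_iff[OF p0, of x] by blast
      have "inv x \<otimes> v \<in> pball j \<delta>"
        using pball_inv[OF v(2)] v(1) x P(3) phantom_carrier by (auto simp: inv_mult_group)
      then have "v \<in> P" using j(3) v(1) N_subset_phantom by blast
      then show False using v(1) \<open>P \<inter> N = {}\<close> by blast
    qed
  qed
  show ?thesis
  proof
    fix x assume "x \<in> phantom (Some \<alpha>)"
    then have x: "x \<in> phantom p" by (simp add: p_def)
    have one: "\<one> \<in> phantom p" using N_subset_phantom N.one_closed by blast
    \<comment> \<open>A comeager subgroup is everything: \<open>L\<close> and its translate by
      \<open>x\<close> are both comeager, so they meet, and \<open>x\<close> is a quotient of two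
      elements of \<open>L\<close>.\<close>
    have "x \<in> phantom p \<inter> (\<otimes>) x ` phantom p"
      using x phantom_carrier[OF x] by (auto intro!: image_eqI[OF _ one])
    then have "L \<inter> (\<otimes>) x ` L \<inter> phantom p \<inter> (\<otimes>) x ` phantom p \<noteq> {}"
      by (rule comeager_in_open_meet[OF stageD(5)[OF st] opR stage_translate_open[OF st x opR] mR
            stage_translate_meager[OF st x mR]])
    then obtain l where l: "l \<in> L" "x \<otimes> l \<in> L" by blast
    have lc: "l \<in> carrier G" using l(1) subgroup.subset[OF L(2)] by blast
    have "(x \<otimes> l) \<otimes> inv l \<in> L" using l L(2) by (meson subgroup.m_closed subgroup.m_inv_closed)
    then show "x \<in> L" using lc phantom_carrier[OF x] by (simp add: m_assoc)
  qed
qed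


section \<open>Borel complexity of the phantom subgroups\<close>

lemma openin_ball_N: "openin TN {v \<in> N. lenN v < \<epsilon>}"
proof -
  have "{v \<in> N. lenN v < \<epsilon>} = dN.mball \<one> \<epsilon>" using dN.commute by (auto simp: lenN_def)
  then show ?thesis using dN.openin_mball[of "\<one>" \<epsilon>] by (simp add: mtopology_dN)
qed

lemma openin_ball_T: "openin T {x \<in> carrier G. len0 x < \<epsilon>}"
proof -
  have "{x \<in> carrier G. len0 x < \<epsilon>} = d0.mball \<one> \<epsilon>" using d0.commute by (auto simp: len0_def)
  then show ?thesis using d0.openin_mball[of "\<one>" \<epsilon>] by (simp add: mtopology_d0)
qed

text \<open>\<open>None\<close> is the only index below \<open>Some 0\<close>, so this is a closure
  for the metric \<open>d0\<close>; the complement is open by the triangle inequality.\<close>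

lemma closedin_pball_0: "closedin T (pball (Some 0) \<delta>)"
proof -
  have iff: "x \<in> pball (Some 0) \<delta> \<longleftrightarrow> x \<in> carrier G \<and>
      (\<forall>\<theta>>0. \<exists>v\<in>N. lenN v < \<delta> \<and> inv v \<otimes> x \<in> pball None \<theta>)" for x
  proof -
    have "j < Some 0 \<longleftrightarrow> j = None" for j :: "omega1 option"
      using zero_le_omega1 by (cases j) (auto simp: not_less)
    then show ?thesis by (simp add: pball_iff)
  qed
  have "openin T (carrier G - pball (Some 0) \<delta>)"
    unfolding openin_T
  proof (intro conjI ballI)
    fix x assume x: "x \<in> carrier G - pball (Some 0) \<delta>"
    then have "x \<in> carrier G" "x \<notin> pball (Some 0) \<delta>" by auto
    then obtain \<theta> where \<theta>: "\<theta> > 0" "\<And>v. v \<in> N \<Longrightarrow> lenN v < \<delta> \<Longrightarrow> inv v \<otimes> x \<notin> pball None \<theta>"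
      using iff[of x] by blast
    have "y \<in> carrier G - pball (Some 0) \<delta>" if y: "y \<in> carrier G" "len0 (inv x \<otimes> y) < \<theta> / 2" for y
    proof (rule ccontr)
      assume "\<not> ?thesis"
      then have "y \<in> pball (Some 0) \<delta>" using y by blast
      moreover have "\<theta> / 2 > 0" using \<theta>(1) by simp
      ultimately obtain v where v: "v \<in> N" "lenN v < \<delta>" "inv v \<otimes> y \<in> pball None (\<theta> / 2)"
        using iff[of y] by blast
      have "inv x \<otimes> y \<in> pball None (\<theta> / 2)" using x y by (simp add: pball_None)
      then have "inv y \<otimes> x \<in> pball None (\<theta> / 2)"
        using pball_inv[of "inv x \<otimes> y" None "\<theta> / 2"] x y by (simp add: inv_mult_group)
      from pball_mult[OF v(3) this] have "inv v \<otimes> x \<in> pball None \<theta>"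
        using x y v(1) by (simp add: m_assoc)
      then show False using \<theta>(2) v by blast
    qed
    then show "\<exists>r>0. \<forall>y\<in>carrier G. len0 (inv x \<otimes> y) < r \<longrightarrow> y \<in> carrier G - pball (Some 0) \<delta>"
      using \<theta>(1) by (intro exI[of _ "\<theta> / 2"]) auto
  qed auto
  then show ?thesis using pball_carrier by (auto simp: closedin_def topspace_T)
qed

lemma phantom_lower: "x \<in> phantom (Some \<alpha>) \<Longrightarrow> \<beta> < \<alpha> \<Longrightarrow> x \<in> phantom (Some \<beta>)"
  using phantom_antimono[of "Some \<beta>" "Some \<alpha>"] by (auto dest: order_less_imp_le)

lemma translateE:
  assumes "x \<in> (\<otimes>) g ` A" "g \<in> carrier G" "A \<subseteq> carrier G"
  shows "inv g \<otimes> x \<in> A"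
  using assms by auto

lemma translateI:
  assumes "inv g \<otimes> x \<in> A" "g \<in> carrier G" "x \<in> carrier G"
  shows "x \<in> (\<otimes>) g ` A"
  using assms by (intro image_eqI[OF _ assms(1)]) simp

text \<open>Up to intersection with \<open>phantom (Some \<alpha>)\<close>, the balls of index \<open>Some \<alpha>\<close> are $\Pi^0_{1+\alpha}$: the
  complement is covered by translates of smaller balls of lower index centered in a countable dense
  subset of \<open>N\<close>.\<close>

lemma pball_Pi0:
  assumes "\<theta> > 0"
  shows "\<exists>F. Pi0 T \<alpha> F \<and> pball (Some \<alpha>) \<theta> = phantom (Some \<alpha>) \<inter> F"
  using assms
proof (induction \<alpha> arbitrary: \<theta> rule: less_induct)
  case (less \<alpha>)
  show ?case
  proof (cases "\<alpha> = 0")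
    case True
    then show ?thesis
      using closedin_pball_0[of \<theta>] pball_subset_phantom[of "Some 0" \<theta>]
      by (intro exI[of _ "pball (Some 0) \<theta>"]) (auto intro: Pi0.closed)
  next
    case False
    then have pos: "0 < \<alpha>" using zero_le_omega1[of \<alpha>] by order
    obtain Q where Q: "countable Q" "Q \<subseteq> N" "\<And>x e. x \<in> N \<Longrightarrow> e > 0 \<Longrightarrow> \<exists>q\<in>Q. lenN (inv q \<otimes> x) < e"
      using dense_N by metis
    have "\<exists>F. Pi0 T i F \<and> pball (Some i) (1 / real (Suc n)) = phantom (Some i) \<inter> F"
      if "i < \<alpha>" for i n
      by (rule less.IH[OF that]) simp
    then obtain F where F: "\<And>i n. i < \<alpha> \<Longrightarrow> Pi0 T i (F i n)"
        "\<And>i n. i < \<alpha> \<Longrightarrow> pball (Some i) (1 / real (Suc n)) = phantom (Some i) \<inter> F i n"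
      by metis
    have Fc: "F i n \<subseteq> carrier G" if "i < \<alpha>" for i n
      using Pi0_subset[OF F(1)[OF that]] by (simp add: topspace_T)
    \<comment> \<open>The centers at distance at least \<open>2 / Suc n\<close> from all admissible
      \<open>v\<close>. The factor 2 makes the ball of radius \<open>1 / Suc n\<close> around such a
      center miss \<open>pball (Some \<alpha>) \<theta>\<close>.\<close>
    define I where "I = {(i, n, q). i < \<alpha> \<and> q \<in> Q \<and>
        (\<forall>v\<in>N. lenN v < \<theta> \<longrightarrow> inv v \<otimes> q \<notin> pball (Some i) (2 / real (Suc n)))}"
    define F' where "F' = topspace T - (\<Union>s\<in>I. case s of (i, n, q) \<Rightarrow> (\<otimes>) q ` F i n)"
    have "Pi0 T \<alpha> F'"
      unfolding F'_def
    proof (rule Pi0_compl_countable_Union[OF pos])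
      have "I \<subseteq> {..<\<alpha>} \<times> UNIV \<times> Q" unfolding I_def by auto
      moreover have "countable ({..<\<alpha>} \<times> (UNIV :: nat set) \<times> Q)"
        using countable_lessThan_omega1 Q(1) by simp
      ultimately show "countable I" by (rule countable_subset)
      fix s assume s: "s \<in> I"
      obtain i n q where "s = (i, n, q)" by (cases s)
      with s have "s = (i, n, q)" "i < \<alpha>" "q \<in> Q" unfolding I_def by auto
      then show "\<exists>\<beta><\<alpha>. Pi0 T \<beta> (case s of (i, n, q) \<Rightarrow> (\<otimes>) q ` F i n)"
        using Pi0_translate[OF F(1)[OF \<open>i < \<alpha>\<close>], of q n] Q(2) by (auto intro!: exI[of _ i])
    qed
    moreover have "pball (Some \<alpha>) \<theta> = phantom (Some \<alpha>) \<inter> F'"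
    proof (intro equalityI subsetI)
      fix x assume x: "x \<in> pball (Some \<alpha>) \<theta>"
      have xp: "x \<in> phantom (Some \<alpha>)" using x pball_subset_phantom[of "Some \<alpha>" \<theta>] by auto
      have xc: "x \<in> carrier G" by (rule pball_carrier[OF x])
      have "x \<notin> (\<otimes>) q ` F i n" if I: "(i, n, q) \<in> I" for i n q
      proof
        assume "x \<in> (\<otimes>) q ` F i n"
        have i: "i < \<alpha>" and q: "q \<in> N" using I Q(2) unfolding I_def by auto
        have "inv q \<otimes> x \<in> F i n"
          using translateE[OF \<open>x \<in> (\<otimes>) q ` F i n\<close> _ Fc[OF i]] q by simp
        \<comment> \<open>\<open>F i n\<close> describes the ball only inside
          \<open>phantom (Some i)\<close>, so membership there has to be supplied.\<close>
        moreover have "inv q \<otimes> x \<in> phantom (Some i)"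
        proof -
          have "x \<in> phantom (Some i)" using phantom_lower[OF xp i] .
          moreover have "inv q \<in> phantom (Some i)" using q N_subset_phantom[of "Some i"] by auto
          ultimately show ?thesis using subgroup.m_closed[OF phantom_subgroup_G] by simp
        qed
        ultimately have "inv q \<otimes> x \<in> pball (Some i) (1 / real (Suc n))" using F(2)[OF i] by blast
        then have 1: "inv x \<otimes> q \<in> pball (Some i) (1 / real (Suc n))"
          using pball_inv[of "inv q \<otimes> x"] q xc by (simp add: inv_mult_group)
        have "Some i < Some \<alpha>" "1 / real (Suc n) > 0" using i by auto
        then obtain v where v: "v \<in> N" "lenN v < \<theta>" "inv v \<otimes> x \<in> pball (Some i) (1 / real (Suc n))"
          using x pball_iff[of "Some \<alpha>" x \<theta>] by (metis less_option_None_Some)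
        have "inv v \<otimes> q \<in> pball (Some i) (2 / real (Suc n))"
          using pball_mult[OF v(3) 1] v(1) q xc by (simp add: m_assoc add_divide_distrib[symmetric])
        then show False using I v unfolding I_def by auto
      qed
      then show "x \<in> phantom (Some \<alpha>) \<inter> F'" using xp xc unfolding F'_def by (auto simp: topspace_T)
    next
      fix x assume x: "x \<in> phantom (Some \<alpha>) \<inter> F'"
      then have xc: "x \<in> carrier G" using phantom_carrier by blast
      show "x \<in> pball (Some \<alpha>) \<theta>"
      proof (rule ccontr)
        assume "x \<notin> pball (Some \<alpha>) \<theta>"
        then obtain j \<eta> where j: "j < Some \<alpha>" "\<eta> > 0"
            "\<And>v. v \<in> N \<Longrightarrow> lenN v < \<theta> \<Longrightarrow> inv v \<otimes> x \<notin> pball j \<eta>"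
          using xc pball_iff[of "Some \<alpha>" x \<theta>] by auto
        \<comment> \<open>The failing index may be \<open>None\<close>, for which no set
          \<open>F\<close> was chosen; \<open>Some 0\<close> has smaller balls, so approximation
          fails there too.\<close>
        define i where "i = (case j of None \<Rightarrow> 0 | Some i \<Rightarrow> i)"
        have i: "i < \<alpha>" "j \<le> Some i" using j(1) pos by (auto simp: i_def split: option.splits)
        have ji: "inv v \<otimes> x \<notin> pball (Some i) \<eta>" if "v \<in> N" "lenN v < \<theta>" for v
          using j(3)[OF that] pball_antimono[OF _ i(2)] by blast
        \<comment> \<open>A third of \<eta>, because the radii \<open>2 / Suc n\<close> and
          \<open>1 / Suc n\<close> are added below.\<close>
        obtain n where n: "1 / Suc n < \<eta> / 3" using nat_approx_posE[of "\<eta> / 3"] j(2) by auto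
        have "\<exists>q\<in>Q. inv q \<otimes> x \<in> pball (Some i) (1 / real (Suc n))"
          using x i(1) by (intro dense_phantom[OF _ Q(2,3), of "Some \<alpha>"]) auto
        then obtain q where q: "q \<in> Q" "inv q \<otimes> x \<in> pball (Some i) (1 / real (Suc n))" by blast
        have qN: "q \<in> N" using q(1) Q(2) by blast
        have "(i, n, q) \<in> I"
        proof -
          have "inv v \<otimes> q \<notin> pball (Some i) (2 / real (Suc n))" if v: "v \<in> N" "lenN v < \<theta>" for v
          proof
            assume "inv v \<otimes> q \<in> pball (Some i) (2 / real (Suc n))"
            from pball_mult[OF this q(2)]
            have "inv v \<otimes> x \<in> pball (Some i) (2 / real (Suc n) + 1 / real (Suc n))"
              using v(1) qN xc by (simp add: m_assoc)
            moreover have "2 / real (Suc n) + 1 / real (Suc n) \<le> \<eta>" using n by simp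
            ultimately show False using ji[OF v] pball_mono by blast
          qed
          then show ?thesis using i(1) q(1) by (simp add: I_def)
        qed
        moreover have "x \<in> (\<otimes>) q ` F i n"
          using q(2) F(2)[OF i(1), of n] xc qN by (intro translateI) auto
        ultimately have "x \<notin> F'" unfolding F'_def by blast
        then show False using x by blast
      qed
    qed
    ultimately show ?thesis by blast
  qed
qed

section \<open>Complexity at successors and limits\<close>

text \<open>Below \<open>Some (osucc \<alpha>)\<close> the index \<open>Some \<alpha>\<close> is the
  largest, and its balls imply the others. So membership in the next group means: for every
  \<open>n\<close> some \<open>q\<close> in the dense set moves \<open>x\<close> into the ball of
  radius \<open>1 / Suc n\<close>. The countable union and the countable intersection raise the
  index by two.\<close>

lemma phantom_succ_Pi0:
  assumes "Pi0 T (osucc \<alpha>) (phantom (Some \<alpha>))"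
  shows "Pi0 T (osucc (osucc \<alpha>)) (phantom (Some (osucc \<alpha>)))"
proof -
  obtain Q where Q: "countable Q" "Q \<subseteq> N" "\<And>x e. x \<in> N \<Longrightarrow> e > 0 \<Longrightarrow> \<exists>q\<in>Q. lenN (inv q \<otimes> x) < e"
    using dense_N by metis
  have "\<exists>F. Pi0 T \<alpha> F \<and> pball (Some \<alpha>) (1 / real (Suc n)) = phantom (Some \<alpha>) \<inter> F" for n
    by (rule pball_Pi0) simp
  then obtain F where F: "\<And>n. Pi0 T \<alpha> (F n)"
      "\<And>n. pball (Some \<alpha>) (1 / real (Suc n)) = phantom (Some \<alpha>) \<inter> F n"
    by metis
  have Fc: "F n \<subseteq> carrier G" for n using Pi0_subset[OF F(1)] by (simp add: topspace_T)
  define E where "E n = (\<Union>q\<in>Q. (\<otimes>) q ` F n)" for n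
  have Ec: "E n \<subseteq> topspace T" for n unfolding E_def topspace_T using Q(2) Fc by fastforce
  have posl: "0 < osucc \<beta>" for \<beta> using less_osucc_iff zero_le_omega1 by blast
  have "Pi0 T (osucc \<alpha>) (topspace T - E n)" for n
    unfolding E_def
    using Q(1,2) Pi0_translate[OF F(1)] less_osucc
    by (intro Pi0_compl_countable_Union[OF posl] exI[of _ \<alpha>]) auto
  then have "Pi0 T (osucc (osucc \<alpha>)) (topspace T - (\<Union>n. topspace T - E n))"
    using less_osucc by (intro Pi0_compl_countable_Union[OF posl]) auto
  moreover have "Pi0 T (osucc (osucc \<alpha>)) (phantom (Some \<alpha>))"
    using less_osucc by (intro Pi0_mono[OF metrizable_T assms] order_less_imp_le)
  ultimately have "Pi0 T (osucc (osucc \<alpha>)) (phantom (Some \<alpha>) \<inter> (topspace T - (\<Union>n. topspace T - E n)))"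
    by (intro Pi0_Int[OF metrizable_T])
  moreover have "phantom (Some \<alpha>) \<inter> (topspace T - (\<Union>n. topspace T - E n)) = phantom (Some (osucc \<alpha>))"
  proof (intro equalityI subsetI)
    fix x assume "x \<in> phantom (Some \<alpha>) \<inter> (topspace T - (\<Union>n. topspace T - E n))"
    then have x: "x \<in> phantom (Some \<alpha>)" "\<And>n. x \<in> E n" by auto
    have xc: "x \<in> carrier G" by (rule phantom_carrier[OF x(1)])
    have "\<exists>v\<in>N. inv v \<otimes> x \<in> pball j \<theta>" if "j < Some (osucc \<alpha>)" and \<theta>: "\<theta> > 0" for j \<theta>
    proof -
      have j: "j \<le> Some \<alpha>" using that(1) by (cases j) (auto simp: less_osucc_iff)
      obtain n where n: "1 / Suc n < \<theta>" using nat_approx_posE[OF \<theta>] by blast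
      obtain q where q: "q \<in> Q" "x \<in> (\<otimes>) q ` F n" using x(2)[of n] unfolding E_def by blast
      have qN: "q \<in> N" using q(1) Q(2) by blast
      then have "inv q \<otimes> x \<in> F n" using translateE[OF q(2) _ Fc] by simp
      moreover have "inv q \<otimes> x \<in> phantom (Some \<alpha>)"
        using x(1) qN N_subset_phantom[of "Some \<alpha>"] subgroup.m_closed[OF phantom_subgroup_G] by auto
      ultimately have "inv q \<otimes> x \<in> pball (Some \<alpha>) (1 / real (Suc n))" using F(2) by blast
      then have "inv q \<otimes> x \<in> pball j \<theta>" using pball_antimono[OF _ j] pball_mono n by (meson order_less_imp_le)
      then show ?thesis using qN by blast
    qed
    then show "x \<in> phantom (Some (osucc \<alpha>))" using xc by (simp add: phantom_iff)
  next
    fix x assume x: "x \<in> phantom (Some (osucc \<alpha>))"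
    have xc: "x \<in> carrier G" by (rule phantom_carrier[OF x])
    have xa: "x \<in> phantom (Some \<alpha>)"
      by (rule phantom_lower[OF x less_osucc])
    have "x \<in> E n" for n
    proof -
      have "\<exists>q\<in>Q. inv q \<otimes> x \<in> pball (Some \<alpha>) (1 / real (Suc n))"
        using x less_osucc by (intro dense_phantom[OF _ Q(2,3), of "Some (osucc \<alpha>)"]) auto
      then obtain q where q: "q \<in> Q" "inv q \<otimes> x \<in> pball (Some \<alpha>) (1 / real (Suc n))" by blast
      then have "x \<in> (\<otimes>) q ` F n" using F(2)[of n] xc Q(2) by (intro translateI) auto
      then show ?thesis using q(1) unfolding E_def by blast
    qed
    then show "x \<in> phantom (Some \<alpha>) \<inter> (topspace T - (\<Union>n. topspace T - E n))"
      using xa xc by (auto simp: topspace_T)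
  qed
  ultimately show ?thesis by simp
qed

text \<open>Every index below a limit \<alpha> lies strictly below some \<open>Some \<beta>\<close>
  with \<beta> < \<alpha>, so the group is the intersection of the earlier ones, each of index at
  most \<alpha>.\<close>

lemma phantom_limit_Pi0:
  assumes "\<alpha> \<noteq> 0" "\<nexists>\<beta>. \<alpha> = osucc \<beta>"
    and "\<And>\<beta>. \<beta> < \<alpha> \<Longrightarrow> Pi0 T (osucc \<beta>) (phantom (Some \<beta>))"
  shows "Pi0 T \<alpha> (phantom (Some \<alpha>))"
proof -
  have pos: "0 < \<alpha>" using assms(1) zero_le_omega1[of \<alpha>] by order
  have lim: "osucc \<beta> < \<alpha>" if "\<beta> < \<alpha>" for \<beta>
    using that assms(2) by (metis order_le_less osucc_le_iff)
  have "Pi0 T \<alpha> (\<Inter>\<beta>\<in>{..<\<alpha>}. phantom (Some \<beta>))"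
    using pos countable_lessThan_omega1 order_less_imp_le[OF lim]
    by (intro Pi0_Inter[OF metrizable_T] Pi0_mono[OF metrizable_T assms(3)]) auto
  moreover have "(\<Inter>\<beta>\<in>{..<\<alpha>}. phantom (Some \<beta>)) = phantom (Some \<alpha>)"
  proof (intro equalityI subsetI)
    fix x assume x: "x \<in> (\<Inter>\<beta>\<in>{..<\<alpha>}. phantom (Some \<beta>))"
    have "\<exists>v\<in>N. inv v \<otimes> x \<in> pball j \<theta>" if "j < Some \<alpha>" "\<theta> > 0" for j \<theta>
    proof -
      obtain \<beta> where \<beta>: "\<beta> < \<alpha>" "j < Some \<beta>"
      proof (cases j)
        case None
        then show thesis using that pos by auto
      next
        case (Some i)
        then have "i < \<alpha>" using \<open>j < Some \<alpha>\<close> by simp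
        then show thesis using lim[of i] less_osucc[of i] Some by (intro that[of "osucc i"]) auto
      qed
      then have "x \<in> phantom (Some \<beta>)" using x by blast
      then show ?thesis using \<beta>(2) that(2) by (simp add: phantom_iff)
    qed
    moreover have "x \<in> carrier G" using x pos phantom_carrier by blast
    ultimately show "x \<in> phantom (Some \<alpha>)" by (simp add: phantom_iff)
  next
    fix x assume x: "x \<in> phantom (Some \<alpha>)"
    then show "x \<in> (\<Inter>\<beta>\<in>{..<\<alpha>}. phantom (Some \<beta>))"
      using phantom_lower by blast
  qed
  ultimately show ?thesis by simp
qed

lemma phantom_Pi0: "Pi0 T (osucc \<alpha>) (phantom (Some \<alpha>))"
proof (induction \<alpha> rule: less_induct)
  case (less \<alpha>)
  consider "\<alpha> = 0" | \<beta> where "\<alpha> = osucc \<beta>" | "\<alpha> \<noteq> 0" "\<nexists>\<beta>. \<alpha> = osucc \<beta>" by blast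
  then show ?case
  proof cases
    case 1
    have "Pi0 T 0 (phantom (Some 0))" unfolding phantom_def by (intro Pi0.closed closedin_pball_0)
    then show ?thesis using Pi0_mono[OF metrizable_T] zero_le_omega1 1 by blast
  next
    case 2
    then show ?thesis using phantom_succ_Pi0 less.IH less_osucc by blast
  next
    case 3
    then have "Pi0 T \<alpha> (phantom (Some \<alpha>))" using phantom_limit_Pi0 less.IH by blast
    then show ?thesis using Pi0_mono[OF metrizable_T] less_osucc order_less_imp_le by blast
  qed
qed

text \<open>\<open>phantom_Pi0\<close> is the bound required at successors. At zero and at limits
  the class is one step lower: there the group is closed, or an intersection of earlier
  groups.\<close>

lemma phantom_Gamma_class: "Gamma_class T \<alpha> (phantom (Some \<alpha>))"
proof -
  have "Pi0 T \<alpha> (phantom (Some \<alpha>))" if "\<nexists>\<beta>. \<alpha> = osucc \<beta>"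
  proof (cases "\<alpha> = 0")
    case True
    then show ?thesis unfolding phantom_def by (auto intro: Pi0.closed closedin_pball_0)
  next
    case False
    then show ?thesis using phantom_limit_Pi0 phantom_Pi0 that by blast
  qed
  then show ?thesis using phantom_Pi0 by (simp add: Gamma_class_def)
qed

lemma phantom_subgroup_eq: "phantom_subgroup G T N \<alpha> = phantom (Some \<alpha>)"
  unfolding phantom_subgroup_def
proof (rule Least_equality)
  show "polish_subgroup G T (phantom (Some \<alpha>)) \<and> N \<subseteq> phantom (Some \<alpha>) \<and> Gamma_class T \<alpha> (phantom (Some \<alpha>))"
    using phantom_subgroup_G polish_phantom[of "Some \<alpha>"] N_subset_phantom phantom_Gamma_class
    by (auto simp: polish_subgroup_def)
  fix L assume L: "polish_subgroup G T L \<and> N \<subseteq> L \<and> Gamma_class T \<alpha> L"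
  \<comment> \<open>Both cases of \<open>Gamma_class\<close> are contained in this class, so a
    single minimality argument covers them.\<close>
  then have "Pi0 T (osucc \<alpha>) L"
    using Pi0_mono[OF metrizable_T] less_osucc order_less_imp_le
    unfolding Gamma_class_def by (metis (full_types))
  then show "phantom (Some \<alpha>) \<subseteq> L" using phantom_minimal L by (auto simp: polish_subgroup_def)
qed

end

section \<open>From the definition of a TSI cover to the locale\<close>

lemma polish_subgroup_topology_polish_top:
  assumes "polish_group G T" "polish_subgroup G T N"
  shows "polish_subgroup_topology G T N (polish_top G T N)"
proof -
  have "Hausdorff_space T"
    using assms(1) completely_metrizable_imp_metrizable_space metrizable_imp_Hausdorff_space
    unfolding polish_group_def by blast
  then have "S = S'" if "polish_subgroup_topology G T N S" "polish_subgroup_topology G T N S'" for S S'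
    using that polish_group_topology_unique unfolding polish_subgroup_topology_def by blast
  then have "\<exists>!S. polish_subgroup_topology G T N S" using assms(2) unfolding polish_subgroup_def by blast
  then show ?thesis unfolding polish_top_def by (rule theI')
qed

lemma tsi_polish_cover_imp_tsi_cover:
  assumes "tsi_polish_cover G T N"
  obtains dN d0 where "tsi_cover G T N (polish_top G T N) dN d0"
proof -
  have c: "polish_group G T" "N \<lhd> G" "polish_subgroup G T N"
    using assms by (auto simp: tsi_polish_cover_def polish_cover_def)
  have g: "group G" using c(1) by (simp add: polish_group_def topological_group_def)
  obtain dN d0 where d: "tsi_metric G (polish_top G T N) dN" "tsi_metric G T d0"
      "\<forall>x\<in>N. \<forall>y\<in>N. d0 x y \<le> dN x y \<and> dN x y \<le> 1"
      "\<forall>g\<in>carrier G. \<forall>x\<in>N. \<forall>y\<in>N.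
         dN (g \<otimes>\<^bsub>G\<^esub> x \<otimes>\<^bsub>G\<^esub> inv\<^bsub>G\<^esub> g) (g \<otimes>\<^bsub>G\<^esub> y \<otimes>\<^bsub>G\<^esub> inv\<^bsub>G\<^esub> g) = dN x y"
    using assms unfolding tsi_polish_cover_def by blast
  have "tsi_cover G T N (polish_top G T N) dN d0"
    using g c d polish_subgroup_topology_polish_top[OF c(1,3)]
    by (simp add: tsi_cover_def tsi_cover_axioms_def)
  then show thesis by (rule that)
qed

section \<open>Pseudomorphisms\<close>

locale pseudo =
  G: tsi_cover G TG N TN dN d0 + H: tsi_cover H TH M TM dM e0
  for G :: "('a, 'm) monoid_scheme" and TG N TN dN d0
    and H :: "('b, 'n) monoid_scheme" and TH M TM dM e0 +
  fixes W U :: "'a set" and \<phi> :: "'a \<Rightarrow> 'b"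
  assumes TN: "TN = polish_top G TG N" and TM: "TM = polish_top H TH M"
    and pseudomorphism: "pseudomorphism G TG N H TH M W U \<phi>"
begin

lemma luc: "local_uniformly_continuous_map G TG N H TH M W U \<phi>"
  using pseudomorphism by (simp add: pseudomorphism_def)

lemma W_open: "openin TG W"
  and U_open: "openin TN U" and one_U: "\<one>\<^bsub>G\<^esub> \<in> U"
  and \<phi>_uc: "group_uniformly_continuous G TG H TH W \<phi>"
  and \<phi>_N: "x \<in> W \<inter> N \<Longrightarrow> \<phi> x \<in> M"
  using luc unfolding local_uniformly_continuous_map_def TN by blast+

lemma W_carrier: "x \<in> W \<Longrightarrow> x \<in> carrier G"
  using openin_subset[OF W_open] G.topspace_T by blast

lemma \<phi>_carrier: "x \<in> W \<Longrightarrow> \<phi> x \<in> carrier H"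
  using \<phi>_uc H.topspace_T by (auto simp: group_uniformly_continuous_def)

text \<open>A ball of any index lies in the \<open>d0\<close>-ball of the same radius, so openness
  of \<open>W\<close> in \<open>G\<close> keeps approximants inside \<open>W\<close> at every level.
  The radius depends on \<open>y\<close>.\<close>

lemma W_nbhd:
  assumes "y \<in> W"
  shows "\<exists>r>0. \<forall>x\<in>carrier G. y \<otimes>\<^bsub>G\<^esub> inv\<^bsub>G\<^esub> x \<in> G.pball j r \<longrightarrow> x \<in> W"
proof -
  obtain r where r: "r > 0" "\<forall>x\<in>carrier G. G.len0 (inv\<^bsub>G\<^esub> y \<otimes>\<^bsub>G\<^esub> x) < r \<longrightarrow> x \<in> W"
    using assms W_open unfolding G.openin_T by blast
  have yc: "y \<in> carrier G" by (rule W_carrier[OF assms])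
  have "x \<in> W" if x: "x \<in> carrier G" "y \<otimes>\<^bsub>G\<^esub> inv\<^bsub>G\<^esub> x \<in> G.pball j (r / 2)" for x
  proof -
    have "inv\<^bsub>G\<^esub> x \<otimes>\<^bsub>G\<^esub> y \<in> G.pball j (r / 2)"
      using G.pball_swap[OF x(2)] x(1) yc by simp
    then have "inv\<^bsub>G\<^esub> y \<otimes>\<^bsub>G\<^esub> x \<in> G.pball j (r / 2)"
      using G.pball_inv[of "inv\<^bsub>G\<^esub> x \<otimes>\<^bsub>G\<^esub> y"] x(1) yc by (simp add: G.inv_mult_group)
    then have "inv\<^bsub>G\<^esub> y \<otimes>\<^bsub>G\<^esub> x \<in> G.pball None (r / 2)"
      by (rule G.pball_antimono) simp
    then show ?thesis using r x(1) by (auto simp: G.pball_None)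
  qed
  then show ?thesis using r(1) by (intro exI[of _ "r / 2"]) auto
qed

text \<open>The quotient is \<open>\<sigma> (v, x)\<close>, and \<sigma> takes the value \<one> at
  \<one> by cancellation. Comparing the two values by uniform continuity in the first variable
  bounds it, with a \<delta> independent of \<open>x\<close>.\<close>

lemma small_left_factor:
  assumes "\<epsilon> > 0"
  shows "\<exists>\<delta>>0. \<forall>v\<in>N. \<forall>x\<in>W. G.lenN v < \<delta> \<longrightarrow> v \<otimes>\<^bsub>G\<^esub> x \<in> W \<longrightarrow>
    \<phi> (v \<otimes>\<^bsub>G\<^esub> x) \<otimes>\<^bsub>H\<^esub> inv\<^bsub>H\<^esub> (\<phi> x) \<in> M \<and> H.lenN (\<phi> (v \<otimes>\<^bsub>G\<^esub> x) \<otimes>\<^bsub>H\<^esub> inv\<^bsub>H\<^esub> (\<phi> x)) < \<epsilon>"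
proof -
  let ?D = "{(z, x). z \<in> N \<and> x \<in> W \<and> z \<otimes>\<^bsub>G\<^esub> x \<in> W}"
  let ?V = "{m \<in> M. H.lenN m < \<epsilon>}"
  obtain \<sigma> where \<sigma>: "\<sigma> \<in> ?D \<rightarrow> M" "\<forall>(z, x)\<in>?D. \<phi> (z \<otimes>\<^bsub>G\<^esub> x) = \<sigma> (z, x) \<otimes>\<^bsub>H\<^esub> \<phi> x"
      and uc: "\<forall>V. openin TM V \<and> \<one>\<^bsub>H\<^esub> \<in> V \<longrightarrow> (\<exists>O'. openin TN O' \<and> \<one>\<^bsub>G\<^esub> \<in> O' \<and>
        (\<forall>x z z'. (z, x) \<in> {(z, x) \<in> ?D. z \<in> U} \<and> (z', x) \<in> {(z, x) \<in> ?D. z \<in> U} \<and>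
          inv\<^bsub>G\<^esub> z \<otimes>\<^bsub>G\<^esub> z' \<in> O' \<longrightarrow> inv\<^bsub>H\<^esub> (\<sigma> (z, x)) \<otimes>\<^bsub>H\<^esub> \<sigma> (z', x) \<in> V))"
    using pseudomorphism unfolding pseudomorphism_def Let_def TN TM by (elim conjE exE)
  have "openin TM ?V" "\<one>\<^bsub>H\<^esub> \<in> ?V" using H.openin_ball_N assms by (simp_all add: H.lenN_one)
  then obtain O' where O': "openin TN O'" "\<one>\<^bsub>G\<^esub> \<in> O'"
      "\<And>x z z'. (z, x) \<in> ?D \<Longrightarrow> z \<in> U \<Longrightarrow> (z', x) \<in> ?D \<Longrightarrow> z' \<in> U \<Longrightarrow>
        inv\<^bsub>G\<^esub> z \<otimes>\<^bsub>G\<^esub> z' \<in> O' \<Longrightarrow> inv\<^bsub>H\<^esub> (\<sigma> (z, x)) \<otimes>\<^bsub>H\<^esub> \<sigma> (z', x) \<in> ?V"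
    using uc[rule_format, of ?V] by auto
  have "openin TN (O' \<inter> U)" "\<one>\<^bsub>G\<^esub> \<in> O' \<inter> U" using O' U_open one_U by auto
  then obtain \<delta> where \<delta>: "\<delta> > 0" "\<forall>v\<in>N. G.lenN v < \<delta> \<longrightarrow> v \<in> O' \<inter> U"
    unfolding G.openin_TN by force
  have "\<phi> (v \<otimes>\<^bsub>G\<^esub> x) \<otimes>\<^bsub>H\<^esub> inv\<^bsub>H\<^esub> (\<phi> x) \<in> ?V"
    if v: "v \<in> N" "G.lenN v < \<delta>" and x: "x \<in> W" "v \<otimes>\<^bsub>G\<^esub> x \<in> W" for v x
  proof -
    have vU: "v \<in> U" "v \<in> O'" using \<delta>(2) v by auto
    have D: "(\<one>\<^bsub>G\<^esub>, x) \<in> ?D" "(v, x) \<in> ?D" using v x W_carrier by auto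
    have M: "\<sigma> (\<one>\<^bsub>G\<^esub>, x) \<in> M" "\<sigma> (v, x) \<in> M" using \<sigma>(1) D by blast+
    have eq: "\<phi> (\<one>\<^bsub>G\<^esub> \<otimes>\<^bsub>G\<^esub> x) = \<sigma> (\<one>\<^bsub>G\<^esub>, x) \<otimes>\<^bsub>H\<^esub> \<phi> x"
      "\<phi> (v \<otimes>\<^bsub>G\<^esub> x) = \<sigma> (v, x) \<otimes>\<^bsub>H\<^esub> \<phi> x"
      using bspec[OF \<sigma>(2) D(1)] bspec[OF \<sigma>(2) D(2)] by simp_all
    have "\<sigma> (\<one>\<^bsub>G\<^esub>, x) = \<one>\<^bsub>H\<^esub>"
      using eq(1) M(1) \<phi>_carrier[OF x(1)] W_carrier[OF x(1)] by (simp add: H.r_cancel_one')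
    moreover have "inv\<^bsub>G\<^esub> \<one>\<^bsub>G\<^esub> \<otimes>\<^bsub>G\<^esub> v \<in> O'" using vU(2) v(1) by simp
    ultimately have "\<sigma> (v, x) \<in> ?V" using O'(3)[OF D(1) one_U D(2) vU(1)] M(2) by simp
    moreover have "\<phi> (v \<otimes>\<^bsub>G\<^esub> x) \<otimes>\<^bsub>H\<^esub> inv\<^bsub>H\<^esub> (\<phi> x) = \<sigma> (v, x)"
      using eq(2) M(2) \<phi>_carrier[OF x(1)] by (simp add: H.m_assoc)
    ultimately show ?thesis by simp
  qed
  then show ?thesis using \<delta>(1) by (intro exI[of _ \<delta>]) auto
qed

text \<open>A point \<open>y\<close> with \<open>y x\<^sup>-\<^sup>1 \<in> pball j \<delta>\<close> is approximated by points \<open>v x\<close> with \<open>v \<in> N\<close> small; these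
  stay in \<open>W\<close> once they are close to \<open>y\<close>. The change from \<open>\<phi> x\<close> to \<open>\<phi> (v x)\<close> is controlled in \<open>M\<close> and
  that from \<open>\<phi> (v x)\<close> to \<open>\<phi> y\<close> by induction.\<close>

lemma \<phi>_pball:
  assumes "\<epsilon> > 0"
  shows "\<exists>\<delta>>0. \<forall>x\<in>W. \<forall>y\<in>W. y \<otimes>\<^bsub>G\<^esub> inv\<^bsub>G\<^esub> x \<in> G.pball j \<delta> \<longrightarrow>
    \<phi> y \<otimes>\<^bsub>H\<^esub> inv\<^bsub>H\<^esub> (\<phi> x) \<in> H.pball j \<epsilon>"
  using assms
proof (induction j arbitrary: \<epsilon> rule: less_induct)
  case (less j)
  show ?case
  proof (cases "j = None")
    case True
    let ?V = "{h \<in> carrier H. H.len0 h < \<epsilon>}"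
    have "openin TH ?V" "\<one>\<^bsub>H\<^esub> \<in> ?V"
      using H.openin_ball_T less.prems by (simp_all add: H.len0_def)
    then obtain O' where O': "openin TG O'" "\<one>\<^bsub>G\<^esub> \<in> O'"
        "\<forall>x\<in>W. \<forall>y\<in>W. inv\<^bsub>G\<^esub> x \<otimes>\<^bsub>G\<^esub> y \<in> O' \<longrightarrow> inv\<^bsub>H\<^esub> (\<phi> x) \<otimes>\<^bsub>H\<^esub> \<phi> y \<in> ?V"
      using \<phi>_uc unfolding group_uniformly_continuous_def by blast
    obtain r where r: "r > 0" "\<forall>y\<in>carrier G. G.len0 (inv\<^bsub>G\<^esub> \<one>\<^bsub>G\<^esub> \<otimes>\<^bsub>G\<^esub> y) < r \<longrightarrow> y \<in> O'"
      using O'(1,2) unfolding G.openin_T by blast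
    have "\<phi> y \<otimes>\<^bsub>H\<^esub> inv\<^bsub>H\<^esub> (\<phi> x) \<in> H.pball None \<epsilon>"
      if xy: "x \<in> W" "y \<in> W" "y \<otimes>\<^bsub>G\<^esub> inv\<^bsub>G\<^esub> x \<in> G.pball None (r / 2)" for x y
    proof -
      have "inv\<^bsub>G\<^esub> x \<otimes>\<^bsub>G\<^esub> y \<in> G.pball None (r / 2)"
        using G.pball_swap[OF xy(3)] xy(1,2) W_carrier by simp
      then have "inv\<^bsub>G\<^esub> x \<otimes>\<^bsub>G\<^esub> y \<in> O'" using r by (auto simp: G.pball_None)
      then have "inv\<^bsub>H\<^esub> (\<phi> x) \<otimes>\<^bsub>H\<^esub> \<phi> y \<in> H.pball None \<epsilon>"
        using O'(3) xy(1,2) by (auto simp: H.pball_None less_imp_le)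
      then show ?thesis by (rule H.pball_swap) (simp_all add: \<phi>_carrier xy)
    qed
    then show ?thesis using True r(1) by (intro exI[of _ "r / 2"]) auto
  next
    case False
    then have j: "None < j" by (simp add: None_less_iff)
    \<comment> \<open>This \<delta> depends on \<epsilon> alone and serves all points and all lower
      indices. The constants chosen later may depend on \<open>i\<close>, \<theta> and
      \<open>y\<close>, as they only restrict the choice of \<open>v\<close>.\<close>
    obtain \<delta> where \<delta>: "\<delta> > 0" "\<And>v x. v \<in> N \<Longrightarrow> x \<in> W \<Longrightarrow> G.lenN v < \<delta> \<Longrightarrow> v \<otimes>\<^bsub>G\<^esub> x \<in> W \<Longrightarrow>
        \<phi> (v \<otimes>\<^bsub>G\<^esub> x) \<otimes>\<^bsub>H\<^esub> inv\<^bsub>H\<^esub> (\<phi> x) \<in> M \<and> H.lenN (\<phi> (v \<otimes>\<^bsub>G\<^esub> x) \<otimes>\<^bsub>H\<^esub> inv\<^bsub>H\<^esub> (\<phi> x)) < \<epsilon>"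
      using small_left_factor[OF less.prems] by blast
    have "\<phi> y \<otimes>\<^bsub>H\<^esub> inv\<^bsub>H\<^esub> (\<phi> x) \<in> H.pball j \<epsilon>"
      if xy: "x \<in> W" "y \<in> W" "y \<otimes>\<^bsub>G\<^esub> inv\<^bsub>G\<^esub> x \<in> G.pball j \<delta>" for x y
      unfolding H.pball_iff[OF j]
    proof (intro conjI allI impI)
      note c = W_carrier[OF xy(1)] W_carrier[OF xy(2)] \<phi>_carrier[OF xy(1)] \<phi>_carrier[OF xy(2)]
      show "\<phi> y \<otimes>\<^bsub>H\<^esub> inv\<^bsub>H\<^esub> (\<phi> x) \<in> carrier H" using c by simp
      fix i and \<theta> :: real assume i: "i < j" and "\<theta> > 0"
      obtain \<eta> where \<eta>: "\<eta> > 0" "\<And>x y. x \<in> W \<Longrightarrow> y \<in> W \<Longrightarrow> y \<otimes>\<^bsub>G\<^esub> inv\<^bsub>G\<^esub> x \<in> G.pball i \<eta> \<Longrightarrow>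
          \<phi> y \<otimes>\<^bsub>H\<^esub> inv\<^bsub>H\<^esub> (\<phi> x) \<in> H.pball i \<theta>"
        using less.IH[OF i \<open>\<theta> > 0\<close>] by blast
      obtain r where r: "r > 0" "\<forall>x\<in>carrier G. y \<otimes>\<^bsub>G\<^esub> inv\<^bsub>G\<^esub> x \<in> G.pball i r \<longrightarrow> x \<in> W"
        using W_nbhd[OF xy(2)] by blast
      \<comment> \<open>\<eta> makes the induction hypothesis applicable at \<open>v x\<close> and
        \<open>y\<close>, and \<open>r\<close> makes sure that \<open>v x\<close> stays in
        \<open>W\<close>.\<close>
      have "min \<eta> r > 0" using \<eta>(1) r(1) by simp
      then obtain v where v: "v \<in> N" "G.lenN v < \<delta>"
          "inv\<^bsub>G\<^esub> v \<otimes>\<^bsub>G\<^esub> (y \<otimes>\<^bsub>G\<^esub> inv\<^bsub>G\<^esub> x) \<in> G.pball i (min \<eta> r)"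
        using xy(3) i unfolding G.pball_iff[OF j] by blast
      have "(y \<otimes>\<^bsub>G\<^esub> inv\<^bsub>G\<^esub> x) \<otimes>\<^bsub>G\<^esub> inv\<^bsub>G\<^esub> v \<in> G.pball i (min \<eta> r)"
        using G.pball_swap[OF v(3)] v(1) c by simp
      then have near: "y \<otimes>\<^bsub>G\<^esub> inv\<^bsub>G\<^esub> (v \<otimes>\<^bsub>G\<^esub> x) \<in> G.pball i (min \<eta> r)"
        using v(1) c by (simp add: G.m_assoc G.inv_mult_group)
      then have "y \<otimes>\<^bsub>G\<^esub> inv\<^bsub>G\<^esub> (v \<otimes>\<^bsub>G\<^esub> x) \<in> G.pball i r" by (rule G.pball_mono) simp
      then have vx: "v \<otimes>\<^bsub>G\<^esub> x \<in> W" using r(2) v(1) c(1) by simp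
      define w where "w = \<phi> (v \<otimes>\<^bsub>G\<^esub> x) \<otimes>\<^bsub>H\<^esub> inv\<^bsub>H\<^esub> (\<phi> x)"
      have w: "w \<in> M" "H.lenN w < \<epsilon>" using \<delta>(2)[OF v(1) xy(1) v(2) vx] by (auto simp: w_def)
      have "y \<otimes>\<^bsub>G\<^esub> inv\<^bsub>G\<^esub> (v \<otimes>\<^bsub>G\<^esub> x) \<in> G.pball i \<eta>" using near by (rule G.pball_mono) simp
      then have "\<phi> y \<otimes>\<^bsub>H\<^esub> inv\<^bsub>H\<^esub> (\<phi> (v \<otimes>\<^bsub>G\<^esub> x)) \<in> H.pball i \<theta>"
        by (rule \<eta>(2)[OF vx xy(2)])
      \<comment> \<open>The induction hypothesis leaves the correction \<open>w\<close> on the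
        right; \<open>pball_swap\<close> then moves it to the left, where \<open>pball_iff\<close>
        expects it.\<close>
      moreover have "\<phi> y \<otimes>\<^bsub>H\<^esub> inv\<^bsub>H\<^esub> (\<phi> (v \<otimes>\<^bsub>G\<^esub> x)) = (\<phi> y \<otimes>\<^bsub>H\<^esub> inv\<^bsub>H\<^esub> (\<phi> x)) \<otimes>\<^bsub>H\<^esub> inv\<^bsub>H\<^esub> w"
        using c \<phi>_carrier[OF vx] by (simp add: w_def H.m_assoc H.inv_mult_group)
      ultimately have "inv\<^bsub>H\<^esub> w \<otimes>\<^bsub>H\<^esub> (\<phi> y \<otimes>\<^bsub>H\<^esub> inv\<^bsub>H\<^esub> (\<phi> x)) \<in> H.pball i \<theta>"
        using w(1) c by - (rule H.pball_swap, auto)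
      then show "\<exists>m\<in>M. H.lenN m < \<epsilon> \<and> inv\<^bsub>H\<^esub> m \<otimes>\<^bsub>H\<^esub> (\<phi> y \<otimes>\<^bsub>H\<^esub> inv\<^bsub>H\<^esub> (\<phi> x)) \<in> H.pball i \<theta>"
        using w by blast
    qed
    then show ?thesis using \<delta>(1) by blast
  qed
qed

text \<open>An element of \<open>W\<close> in the phantom subgroup is close to some z in
  \<open>N\<close>, which lies in \<open>W\<close> if it is close enough. Then \<phi> z is in
  \<open>M\<close>, and \<open>\<phi>_pball\<close> shows that it is close to \<phi> x.\<close>

lemma \<phi>_phantom:
  assumes p: "None < p" and x: "x \<in> W" "x \<in> G.phantom p"
  shows "\<phi> x \<in> H.phantom p"
  unfolding H.phantom_iff[OF p]
proof (intro conjI allI impI)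
  note c = W_carrier[OF x(1)] \<phi>_carrier[OF x(1)]
  show "\<phi> x \<in> carrier H" by (rule c)
  fix j and \<theta> :: real assume j: "j < p" and "\<theta> > 0"
  obtain \<eta> where \<eta>: "\<eta> > 0" "\<And>x y. x \<in> W \<Longrightarrow> y \<in> W \<Longrightarrow> y \<otimes>\<^bsub>G\<^esub> inv\<^bsub>G\<^esub> x \<in> G.pball j \<eta> \<Longrightarrow>
      \<phi> y \<otimes>\<^bsub>H\<^esub> inv\<^bsub>H\<^esub> (\<phi> x) \<in> H.pball j \<theta>"
    using \<phi>_pball[OF \<open>\<theta> > 0\<close>] by blast
  obtain r where r: "r > 0" "\<forall>y\<in>carrier G. x \<otimes>\<^bsub>G\<^esub> inv\<^bsub>G\<^esub> y \<in> G.pball j r \<longrightarrow> y \<in> W"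
    using W_nbhd[OF x(1)] by blast
  have "min \<eta> r > 0" using \<eta>(1) r(1) by simp
  then obtain z where z: "z \<in> N" "inv\<^bsub>G\<^esub> z \<otimes>\<^bsub>G\<^esub> x \<in> G.pball j (min \<eta> r)"
    using x(2) j unfolding G.phantom_iff[OF p] by blast
  have near: "x \<otimes>\<^bsub>G\<^esub> inv\<^bsub>G\<^esub> z \<in> G.pball j (min \<eta> r)"
    using G.pball_swap[OF z(2)] z(1) c by simp
  then have "x \<otimes>\<^bsub>G\<^esub> inv\<^bsub>G\<^esub> z \<in> G.pball j r" by (rule G.pball_mono) simp
  then have zW: "z \<in> W" using r(2) z(1) by simp
  then have zM: "\<phi> z \<in> M" using \<phi>_N z(1) by blast
  have "x \<otimes>\<^bsub>G\<^esub> inv\<^bsub>G\<^esub> z \<in> G.pball j \<eta>" using near by (rule G.pball_mono) simp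
  then have "\<phi> x \<otimes>\<^bsub>H\<^esub> inv\<^bsub>H\<^esub> (\<phi> z) \<in> H.pball j \<theta>" by (rule \<eta>(2)[OF zW x(1)])
  then have "inv\<^bsub>H\<^esub> (\<phi> z) \<otimes>\<^bsub>H\<^esub> \<phi> x \<in> H.pball j \<theta>"
    using zM c by - (rule H.pball_swap, auto)
  then show "\<exists>m\<in>M. inv\<^bsub>H\<^esub> m \<otimes>\<^bsub>H\<^esub> \<phi> x \<in> H.pball j \<theta>" using zM by blast
qed

text \<open>On both sides the balls of index below \<open>p\<close> give the neighborhoods of
  \<one>, and \<open>\<phi>_pball\<close> provides a modulus at each index separately.\<close>

lemma \<phi>_uniformly_continuous:
  assumes p: "None < p"
  shows "group_uniformly_continuous G (G.ptop p) H (H.ptop p) (W \<inter> G.phantom p) \<phi>"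
  unfolding group_uniformly_continuous_def
proof (intro conjI allI impI)
  show "W \<inter> G.phantom p \<subseteq> topspace (G.ptop p)" by (simp add: G.topspace_ptop[OF p])
  show "\<phi> \<in> W \<inter> G.phantom p \<rightarrow> topspace (H.ptop p)"
    using \<phi>_phantom[OF p] by (auto simp: H.topspace_ptop[OF p])
  fix V assume V: "openin (H.ptop p) V \<and> \<one>\<^bsub>H\<^esub> \<in> V"
  then have "\<exists>j<p. \<exists>\<delta>>0. \<forall>y\<in>H.phantom p. inv\<^bsub>H\<^esub> \<one>\<^bsub>H\<^esub> \<otimes>\<^bsub>H\<^esub> y \<in> H.pball j \<delta> \<longrightarrow> y \<in> V"
    unfolding H.openin_ptop[OF p] by blast
  then obtain j \<epsilon> where j: "j < p" "\<epsilon> > 0" "\<And>y. y \<in> H.phantom p \<Longrightarrow> y \<in> H.pball j \<epsilon> \<Longrightarrow> y \<in> V"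
    using H.phantom_carrier by force
  obtain \<delta> where \<delta>: "\<delta> > 0" "\<And>x y. x \<in> W \<Longrightarrow> y \<in> W \<Longrightarrow> y \<otimes>\<^bsub>G\<^esub> inv\<^bsub>G\<^esub> x \<in> G.pball j \<delta> \<Longrightarrow>
      \<phi> y \<otimes>\<^bsub>H\<^esub> inv\<^bsub>H\<^esub> (\<phi> x) \<in> H.pball j \<epsilon>"
    using \<phi>_pball[OF j(2)] by blast
  show "\<exists>O'. openin (G.ptop p) O' \<and> \<one>\<^bsub>G\<^esub> \<in> O' \<and>
      (\<forall>x\<in>W \<inter> G.phantom p. \<forall>y\<in>W \<inter> G.phantom p. inv\<^bsub>G\<^esub> x \<otimes>\<^bsub>G\<^esub> y \<in> O' \<longrightarrow>
        inv\<^bsub>H\<^esub> (\<phi> x) \<otimes>\<^bsub>H\<^esub> \<phi> y \<in> V)"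
  proof (intro exI conjI ballI impI)
    show "openin (G.ptop p) (G.oball p j \<delta>)" by (rule G.openin_oball[OF j(1)])
    show "\<one>\<^bsub>G\<^esub> \<in> G.oball p j \<delta>" by (rule G.one_in_oball[OF \<delta>(1)])
    fix x y
    assume x: "x \<in> W \<inter> G.phantom p" and y: "y \<in> W \<inter> G.phantom p"
      and "inv\<^bsub>G\<^esub> x \<otimes>\<^bsub>G\<^esub> y \<in> G.oball p j \<delta>"
    then have "inv\<^bsub>G\<^esub> x \<otimes>\<^bsub>G\<^esub> y \<in> G.pball j \<delta>"
      unfolding G.oball_def by (auto intro: G.pball_mono)
    then have "y \<otimes>\<^bsub>G\<^esub> inv\<^bsub>G\<^esub> x \<in> G.pball j \<delta>"
      using x y W_carrier by - (rule G.pball_swap, auto)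
    then have "\<phi> y \<otimes>\<^bsub>H\<^esub> inv\<^bsub>H\<^esub> (\<phi> x) \<in> H.pball j \<epsilon>" using \<delta>(2) x y by blast
    then have "inv\<^bsub>H\<^esub> (\<phi> x) \<otimes>\<^bsub>H\<^esub> \<phi> y \<in> H.pball j \<epsilon>"
      using x y \<phi>_carrier by - (rule H.pball_swap, auto)
    moreover have "inv\<^bsub>H\<^esub> (\<phi> x) \<otimes>\<^bsub>H\<^esub> \<phi> y \<in> H.phantom p"
      using \<phi>_phantom[OF p] x y subgroup.m_closed[OF H.phantom_subgroup_G[OF p]]
        subgroup.m_inv_closed[OF H.phantom_subgroup_G[OF p]] by simp
    ultimately show "inv\<^bsub>H\<^esub> (\<phi> x) \<otimes>\<^bsub>H\<^esub> \<phi> y \<in> V" using j(3) by blast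
  qed
qed

end

theorem proposition4p5:
  fixes G :: "('a, 'm) monoid_scheme" and TG :: "'a topology" and N :: "'a set"
    and H :: "('b, 'n) monoid_scheme" and TH :: "'b topology" and M :: "'b set"
    and W U :: "'a set" and \<phi> :: "'a \<Rightarrow> 'b"
  assumes "tsi_polish_cover G TG N"
    and "tsi_polish_cover H TH M"
    and "pseudomorphism G TG N H TH M W U \<phi>"
  shows "\<forall>\<alpha> :: omega1.
    let G\<^sub>\<alpha> = phantom_subgroup G TG N \<alpha>;
        H\<^sub>\<alpha> = phantom_subgroup H TH M \<alpha>;
        W\<^sub>\<alpha> = W \<inter> G\<^sub>\<alpha>
    in \<phi> ` W\<^sub>\<alpha> \<subseteq> H\<^sub>\<alpha> \<and>
       group_uniformly_continuous G (polish_top G TG G\<^sub>\<alpha>) H (polish_top H TH H\<^sub>\<alpha>) W\<^sub>\<alpha> \<phi>"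
proof
  fix \<alpha> :: omega1
  obtain dN d0 where G: "tsi_cover G TG N (polish_top G TG N) dN d0"
    using tsi_polish_cover_imp_tsi_cover[OF assms(1)] .
  obtain dM e0 where H: "tsi_cover H TH M (polish_top H TH M) dM e0"
    using tsi_polish_cover_imp_tsi_cover[OF assms(2)] .
  interpret P: pseudo G TG N "polish_top G TG N" dN d0 H TH M "polish_top H TH M" dM e0 W U \<phi>
    using G H assms(3) by (simp add: pseudo_def pseudo_axioms_def)
  have p: "None < Some \<alpha>" by simp
  show "let G\<^sub>\<alpha> = phantom_subgroup G TG N \<alpha>;
        H\<^sub>\<alpha> = phantom_subgroup H TH M \<alpha>;
        W\<^sub>\<alpha> = W \<inter> G\<^sub>\<alpha>
    in \<phi> ` W\<^sub>\<alpha> \<subseteq> H\<^sub>\<alpha> \<and>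
       group_uniformly_continuous G (polish_top G TG G\<^sub>\<alpha>) H (polish_top H TH H\<^sub>\<alpha>) W\<^sub>\<alpha> \<phi>"
    using P.\<phi>_phantom[OF p] P.\<phi>_uniformly_continuous[OF p]
    by (auto simp: Let_def P.G.phantom_subgroup_eq P.H.phantom_subgroup_eq
        P.G.polish_top_phantom[OF p] P.H.polish_top_phantom[OF p])
qed

end
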